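(* Let $T\in(0,\infty)$, let $D\subset\mathbb{R}^{d+1}$ be an $A$-type bounded domain with $\bar D\subset \mathcal{O}_T=(0,T)\times\mathbb{R}^d$, let $0<\beta<1$, $p_0>2$ and $2\le p\le p_0$. Let $g_1:Z\times\Omega\to[0,\infty)$ be measurable with $$\mathbb{E}\Big[\Big(\int_Z|g_1(z)|^2\nu(dz)\Big)^{p_0/2}+\int_Z|g_1(z)|^{p_0}\nu(dz)\Big]<\infty .$$ Let $g:[0,T]\times\mathbb{R}^d\times Z\times\Omega\to\mathbb{R}$ be predictable and suppose that there is a constant $C_g$ such that, almost surely, for all $z\in Z$ and all $(t,x),(s,y)\in[0,T]\times\mathbb{R}^d$, $$|g(t,x,z)-g(s,y,z)|\le C_g\max\{|t-s|^{1/2},|x-y|\}^\beta g_1(z),\qquad g(0,0,z)=0 .$$ Let $K:\mathbb{R}\times\mathbb{R}^d\to\mathbb{R}$ be a non-random measurable kernel, and assume that there are constants $\gamma_1,\gamma_2>0$, $N_0>0$ and $N_1=N_1(T,\beta)>0$ such that for all $0\le s<t\le T$ $$\int_0^s\Big(\int_{\mathbb{R}^d}|K(t-r,z)-K(s-r,z)|(1+|z|^\beta)\,dz\Big)^pdr\le N_1(t-s)^{\frac{\gamma_1p}{2}},$$ $$\int_0^s\Big(\int_{\mathbb{R}^d}|K(s-r,z)|\,dz\Big)^pdr\le N_0,$$ $$\int_s^t\Big(\int_{\mathbb{R}^d}|K(t-r,z)|(1+|z|^\beta)\,dz\Big)^pdr\le N_1(t-s)^{\frac{\gamma_2p}{2}}.$$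 Let $\mathcal{G}g(t,x)=\int_0^t\int_Z\int_{\mathbb{R}^d}K(t-s,x-y)\,g(s,y,z)\,dy\,\tilde N(dz,ds)$ and $\gamma=\min\{\gamma_1,\gamma_2,\beta\}$. Then $$\mathcal{G}g\in C^{\gamma}((\bar D;\delta);L^p(\Omega)).$$
   Context: $(\Omega,\mathcal{F},\mathbb{P})$ is a complete probability space with a filtration $\{\mathcal{F}_t\}_{t\in[0,T]}$ containing all null sets; "predictable" refers to the predictable $\sigma$-algebra of this filtration (jointly measurable with the variables $x$ and $z$). $(Z,\mathcal{Z},\nu)$ is a $\sigma$-finite measure space, $\mu$ is a Poisson random measure on $[0,T]\times Z$ on this stochastic basis with compensator $\mathrm{Leb}\otimes\nu$, and $\tilde N=\mu-\mathrm{Leb}\otimes\nu$ is the compensated martingale measure. The parabolic distance on $\mathbb{R}\times\mathbb{R}^d$ is $\delta((t,x),(s,y))=\max\{|x-y|,|t-s|^{1/2}\}$, and $Q_c(t,x)=(t-c^2,t+c^2)\times B_c(x)$ is its ball of radius $c$. For $D\subset\mathbb{R}^{d+1}$ and $X\in D$ put $D(X,\rho)=D\cap Q_\rho(X)$; $\operatorname{diam}D$ is the diameter with respect to $\delta$. $D$ is called $A$-type if there is a constant $A>0$ such that $|D(X,\rho)|\ge A|Q_\rho(X)|$ (Lebesgue measure) for all $X\in D$ and $0<\rho\le\operatorname{diam}D$. $u\in C^\gamma((\bar D;\delta);L^p(\Omega))$ means that $u$ is $\gamma$-Hölder continuous with respect to $\delta$ as an $L^p(\Omega)$-valued map on $\bar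 D$: $\sup_{X\in\bar D}\|u(X)\|_{L^p(\Omega)}+\sup_{X\ne Y\in\bar D}\frac{\|u(X)-u(Y)\|_{L^p(\Omega)}}{\delta(X,Y)^\gamma}<\infty$. *)

theory Defs
  imports "HOL-Probability.Probability"
begin

section \<open>Parabolic geometry\<close>

definition pdist :: "real \<times> 'x::euclidean_space \<Rightarrow> real \<times> 'x \<Rightarrow> real" where
  "pdist X Y = max (norm (snd X - snd Y)) (sqrt \<bar>fst X - fst Y\<bar>)"

definition pball :: "real \<Rightarrow> real \<times> 'x::euclidean_space \<Rightarrow> (real \<times> 'x) set" where
  "pball c X = {fst X - c\<^sup>2 <..< fst X + c\<^sup>2} \<times> ball (snd X) c"

text \<open>A real supremum, hence meaningful only for bounded nonempty sets.\<close>

definition pdiam :: "(real \<times> 'x::euclidean_space) set \<Rightarrow> real" where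
  "pdiam D = (SUP (X, Y)\<in>D \<times> D. pdist X Y)"

definition A_type :: "(real \<times> 'x::euclidean_space) set \<Rightarrow> bool" where
  "A_type D \<longleftrightarrow> (\<exists>A>0. \<forall>X\<in>D. \<forall>\<rho>. 0 < \<rho> \<and> \<rho> \<le> pdiam D \<longrightarrow>
     emeasure lebesgue (D \<inter> pball \<rho> X) \<ge> ennreal A * emeasure lebesgue (pball \<rho> X))"


section \<open>\<open>L\<^sup>p\<close> norms and parabolic Hoelder spaces\<close>

text \<open>Real powers in \<open>[0, \<infinity>]\<close>, for positive exponents.\<close>

definition epowr :: "ennreal \<Rightarrow> real \<Rightarrow> ennreal" where
  "epowr x a = (if x = \<infinity> then \<infinity> else ennreal (enn2real x powr a))"

definition Lp_norm :: "'w measure \<Rightarrow> real \<Rightarrow> ('w \<Rightarrow> real) \<Rightarrow> ennreal" where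
  "Lp_norm M p X = epowr (\<integral>\<^sup>+\<omega>. ennreal (\<bar>X \<omega>\<bar> powr p) \<partial>M) (1 / p)"

definition holder_Lp ::
  "'w measure \<Rightarrow> real \<Rightarrow> real \<Rightarrow> (real \<times> 'x::euclidean_space) set \<Rightarrow> (real \<times> 'x \<Rightarrow> 'w \<Rightarrow> real) \<Rightarrow> bool"
where
  "holder_Lp M p \<gamma> S u \<longleftrightarrow>
     (\<forall>X\<in>S. u X \<in> borel_measurable M) \<and>
     (SUP X\<in>S. Lp_norm M p (u X)) +
     (SUP (X, Y)\<in>{(X, Y). X \<in> S \<and> Y \<in> S \<and> X \<noteq> Y}.
        Lp_norm M p (\<lambda>\<omega>. u X \<omega> - u Y \<omega>) / ennreal (pdist X Y powr \<gamma>)) < \<infinity>"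


section \<open>Stochastic basis, predictability, Poisson random measures\<close>

text \<open>Only the values \<open>F t\<close> with \<open>0 \<le> t \<le> T\<close> matter. Right-continuity is not required.\<close>

definition stochastic_basis :: "'w measure \<Rightarrow> real \<Rightarrow> (real \<Rightarrow> 'w measure) \<Rightarrow> bool" where
  "stochastic_basis M T F \<longleftrightarrow>
     prob_space M \<and> complete_measure M \<and>
     (\<forall>t\<in>{0..T}. subalgebra M (F t) \<and> null_sets M \<subseteq> sets (F t)) \<and>
     (\<forall>s t. 0 \<le> s \<and> s \<le> t \<and> t \<le> T \<longrightarrow> sets (F s) \<subseteq> sets (F t))"

definition predictable_sigma :: "'w measure \<Rightarrow> real \<Rightarrow> (real \<Rightarrow> 'w measure) \<Rightarrow> (real \<times> 'w) measure" where
  "predictable_sigma M T F = sigma ({0..T} \<times> space M)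
     ({{0} \<times> A |A. A \<in> sets (F 0)} \<union>
      {{s<..t} \<times> A |s t A. 0 \<le> s \<and> s < t \<and> t \<le> T \<and> A \<in> sets (F s)})"

definition intensity :: "real \<Rightarrow> 'z measure \<Rightarrow> (real \<times> 'z) measure" where
  "intensity T \<nu> = restrict_space lborel {0..T} \<Otimes>\<^sub>M \<nu>"

text \<open>
  A Poisson random measure relative to the filtration: besides being a Poisson random measure
  with the given intensity, it is adapted and its restriction to \<open>(t, T] \<times> Z\<close> is independent
  of \<open>F t\<close>. On sets of infinite intensity the value is almost surely infinite, which follows from
  the conditions below when \<open>\<nu>\<close> is sigma-finite.
\<close>

definition poisson_random_measure ::
  "'w measure \<Rightarrow> real \<Rightarrow> (real \<Rightarrow> 'w measure) \<Rightarrow> 'z measure \<Rightarrow> ('w \<Rightarrow> (real \<times> 'z) measure) \<Rightarrow> bool"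
where
  "poisson_random_measure M T F \<nu> \<mu> \<longleftrightarrow>
     (\<forall>\<omega>\<in>space M. sets (\<mu> \<omega>) = sets (intensity T \<nu>)) \<and>
     (\<forall>A\<in>sets (intensity T \<nu>). (\<lambda>\<omega>. emeasure (\<mu> \<omega>) A) \<in> borel_measurable M) \<and>
     (\<forall>A\<in>sets (intensity T \<nu>). emeasure (intensity T \<nu>) A < \<infinity> \<longrightarrow>
        (\<forall>k::nat. measure M {\<omega>\<in>space M. emeasure (\<mu> \<omega>) A = of_nat k} =
           exp (- measure (intensity T \<nu>) A) * measure (intensity T \<nu>) A ^ k / fact k)) \<and>
     (\<forall>A::nat \<Rightarrow> (real \<times> 'z) set. range A \<subseteq> sets (intensity T \<nu>) \<and> disjoint_family A \<longrightarrow>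
        prob_space.indep_vars M (\<lambda>_. borel) (\<lambda>i \<omega>. emeasure (\<mu> \<omega>) (A i)) UNIV) \<and>
     (\<forall>t\<in>{0..T}. \<forall>A\<in>sets (intensity T \<nu>). A \<subseteq> {0..t} \<times> space \<nu> \<longrightarrow>
        (\<lambda>\<omega>. emeasure (\<mu> \<omega>) A) \<in> borel_measurable (F t)) \<and>
     (\<forall>t\<in>{0..T}. prob_space.indep_set M (sets (F t))
        (sigma_sets (space M)
           {(\<lambda>\<omega>. emeasure (\<mu> \<omega>) A) -` B \<inter> space M |A B.
              A \<in> sets (intensity T \<nu>) \<and> A \<subseteq> {t<..T} \<times> space \<nu> \<and> B \<in> sets borel}))"


section \<open>Integration against the compensated Poisson random measure\<close>

text \<open>
  An elementary integrand is a list of quadruples \<open>(a, b, A, \<xi>)\<close> standing for the sum of the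
  processes \<open>\<xi>(\<omega>) 1\<^bsub>(a, b]\<^esub>(s) 1\<^bsub>A\<^esub>(z)\<close>.
\<close>

type_synonym ('z, 'w) elem = "(real \<times> real \<times> 'z set \<times> ('w \<Rightarrow> real)) list"

definition elementary :: "real \<Rightarrow> (real \<Rightarrow> 'w measure) \<Rightarrow> 'z measure \<Rightarrow> ('z, 'w) elem \<Rightarrow> bool" where
  "elementary T F \<nu> L \<longleftrightarrow> (\<forall>(a, b, A, \<xi>)\<in>set L.
     0 \<le> a \<and> a \<le> b \<and> b \<le> T \<and> A \<in> sets \<nu> \<and> emeasure \<nu> A < \<infinity> \<and>
     \<xi> \<in> borel_measurable (F a) \<and> (\<exists>C. \<forall>\<omega>\<in>space (F a). \<bar>\<xi> \<omega>\<bar> \<le> C))"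

definition elem_fun :: "('z, 'w) elem \<Rightarrow> real \<Rightarrow> 'z \<Rightarrow> 'w \<Rightarrow> real" where
  "elem_fun L s z \<omega> = (\<Sum>(a, b, A, \<xi>)\<leftarrow>L. \<xi> \<omega> * indicator {a<..b} s * indicator A z)"

definition elem_integral ::
  "'z measure \<Rightarrow> ('w \<Rightarrow> (real \<times> 'z) measure) \<Rightarrow> ('z, 'w) elem \<Rightarrow> 'w \<Rightarrow> real" where
  "elem_integral \<nu> \<mu> L \<omega> =
     (\<Sum>(a, b, A, \<xi>)\<leftarrow>L. \<xi> \<omega> * (measure (\<mu> \<omega>) ({a<..b} \<times> A) - (b - a) * measure \<nu> A))"

definition L2_integrand ::
  "'w measure \<Rightarrow> real \<Rightarrow> (real \<Rightarrow> 'w measure) \<Rightarrow> 'z measure \<Rightarrow> (real \<Rightarrow> 'z \<Rightarrow> 'w \<Rightarrow> real) \<Rightarrow> bool" where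
  "L2_integrand M T F \<nu> f \<longleftrightarrow>
     (\<lambda>((s, \<omega>), z). f s z \<omega>) \<in> borel_measurable (predictable_sigma M T F \<Otimes>\<^sub>M \<nu>) \<and>
     (\<integral>\<^sup>+\<omega>. (\<integral>\<^sup>+s\<in>{0..T}. (\<integral>\<^sup>+z. ennreal ((f s z \<omega>)\<^sup>2) \<partial>\<nu>) \<partial>lborel) \<partial>M) < \<infinity>"

text \<open>
  \<open>I\<close> is a version of the integral of \<open>f\<close> over \<open>[0, T] \<times> Z\<close>, i.e. of the value at \<open>f\<close> of the
  isometric extension of the elementary integral to the predictable square-integrable integrands.
\<close>

definition is_stoch_integral ::
  "'w measure \<Rightarrow> real \<Rightarrow> (real \<Rightarrow> 'w measure) \<Rightarrow> 'z measure \<Rightarrow> ('w \<Rightarrow> (real \<times> 'z) measure) \<Rightarrow>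
   (real \<Rightarrow> 'z \<Rightarrow> 'w \<Rightarrow> real) \<Rightarrow> ('w \<Rightarrow> real) \<Rightarrow> bool"
where
  "is_stoch_integral M T F \<nu> \<mu> f I \<longleftrightarrow>
     L2_integrand M T F \<nu> f \<and> I \<in> borel_measurable M \<and>
     (\<exists>L :: nat \<Rightarrow> ('z, 'w) elem. (\<forall>n. elementary T F \<nu> (L n)) \<and>
        (\<lambda>n. \<integral>\<^sup>+\<omega>. (\<integral>\<^sup>+s\<in>{0..T}. (\<integral>\<^sup>+z. ennreal ((f s z \<omega> - elem_fun (L n) s z \<omega>)\<^sup>2) \<partial>\<nu>) \<partial>lborel) \<partial>M)
          \<longlonglongrightarrow> 0 \<and>
        (\<lambda>n. \<integral>\<^sup>+\<omega>. ennreal ((I \<omega> - elem_integral \<nu> \<mu> (L n) \<omega>)\<^sup>2) \<partial>M) \<longlonglongrightarrow> 0)"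

text \<open>
  The integrand whose stochastic integral over \<open>[0, T] \<times> Z\<close> is \<open>\<G>g(t, x)\<close>; the upper limit \<open>t\<close> of
  the time integral is realised by an indicator.
\<close>

definition kernel_integrand ::
  "(real \<Rightarrow> 'x::euclidean_space \<Rightarrow> real) \<Rightarrow> (real \<Rightarrow> 'x \<Rightarrow> 'z \<Rightarrow> 'w \<Rightarrow> real) \<Rightarrow> real \<times> 'x \<Rightarrow>
   real \<Rightarrow> 'z \<Rightarrow> 'w \<Rightarrow> real"
where
  "kernel_integrand K g X s z \<omega> =
     indicator {0..fst X} s * (LINT y|lborel. K (fst X - s) (snd X - y) * g s y z \<omega>)"

text \<open>A version of the integral, which is determined only up to almost sure equality.\<close>

definition stoch_conv ::
  "'w measure \<Rightarrow> real \<Rightarrow> (real \<Rightarrow> 'w measure) \<Rightarrow> 'z measure \<Rightarrow> ('w \<Rightarrow> (real \<times> 'z) measure) \<Rightarrow>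
   (real \<Rightarrow> 'x::euclidean_space \<Rightarrow> real) \<Rightarrow> (real \<Rightarrow> 'x \<Rightarrow> 'z \<Rightarrow> 'w \<Rightarrow> real) \<Rightarrow> real \<times> 'x \<Rightarrow> 'w \<Rightarrow> real"
where
  "stoch_conv M T F \<nu> \<mu> K g X = (SOME I. is_stoch_integral M T F \<nu> \<mu> (kernel_integrand K g X) I)"

end

theory Submission
  imports Defs
begin

text \<open>
  The only probabilistic input is a moment bound for the stochastic integral: for \<open>p \<ge> 2\<close>,
  \<open>E|I(f)|\<^sup>p \<le> C \<integral>\<^sub>0\<^sup>T E[(\<integral> f\<^sup>2 d\<nu>)\<^bsup>p/2\<^esup> + \<integral> |f|\<^sup>p d\<nu>] ds\<close> with \<open>C\<close> depending on \<open>p\<close> and \<open>T\<close>.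
  For an elementary integrand, expand \<open>|I\<^sub>t|\<^sup>p\<close> to second order over a short time step; the linear term
  has mean zero, and since a Poisson measure has at most one point in a short step up to an error
  quadratic in its length, the remainder is bounded by the step length times
  \<open>E|I\<^sub>t|\<^sup>p\<close> plus the integrand of the right-hand side. Gronwall's inequality concludes. The case
  \<open>p = 2\<close> yields existence of the integral by density of the elementary integrands, and Fatou's
  lemma carries the bound over to all integrands.

  An increment of \<open>\<G>g\<close> is the integral of a function dominated by \<open>h(r) g\<^sub>1(z, \<omega>)\<close> with deterministic
  \<open>h\<close>, so the bound factors into \<open>\<integral> h\<^sup>p dr\<close>, which the kernel conditions estimate by the required
  power of the parabolic distance, and the moments of \<open>g\<^sub>1\<close>.
\<close>

section \<open>Powers\<close>

text \<open>The stochastic integral is given only as an extension of elementary integrals, and the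
  probabilistic facts at hand are that counts on rectangles are Poisson and independent of the past.
  Both act on a single step \<open>(s, t]\<close> with coefficients already known at
  \<open>s\<close>; hence the discretisation in place of an Ito formula. Mark sets of an elementary
  integrand may overlap, so they are cut into atoms before points are counted. The error of a step
  depends on the integrand (its bound, the \<nu>-mass of its support), but only through the
  coefficient of the squared length; refining the partition removes it and leaves a constant uniform
  over elementary integrands.

  Extending the bound needs elementary integrands that approximate in \<open>L\<^sup>2\<close> and
  also keep the mixed moment under control. A version of the integral comes with an approximating
  sequence lacking that control, so it is compared with a controlled one.

  For the kernel, the reflection \<open>w = x - y\<close> lets increments in space fall on
  \<open>g\<close> and increments in time on \<open>K\<close>; the weight
  \<open>1 + |w|^\<beta>\<close> pays for the growth of \<open>g\<close>, which vanishes at the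
  origin.\<close>

lemma powr_one_plus_le:
  fixes p :: real
  assumes p: "2 \<le> p"
  shows "\<exists>C\<ge>0. \<forall>x. \<bar>x\<bar> \<le> 1/2 \<longrightarrow> (1 + x) powr p \<le> 1 + p * x + C * x\<^sup>2"
proof (intro exI conjI allI impI)
  \<comment> \<open>\<open>p * (p - 1) * t powr (p - 2)\<close> is the second derivative of
    \<open>t powr p\<close>. The intermediate point of the Taylor expansion at 1 lies in
    \<open>[1/2, 3/2]\<close>, where \<open>t powr (p - 2)\<close> is at most
    \<open>2 powr (p - 2)\<close>; the factor 1/2 of the remainder is given away.\<close>
  let ?C = "p * (p - 1) * 2 powr (p - 2)"
  show "0 \<le> ?C" using p by simp
  fix x :: real assume x: "\<bar>x\<bar> \<le> 1/2"
  show "(1 + x) powr p \<le> 1 + p * x + ?C * x\<^sup>2"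
  proof (cases "x = 0")
    case False
    define diff :: "nat \<Rightarrow> real \<Rightarrow> real" where
      "diff m t = (if m = 0 then t powr p else if m = 1 then p * t powr (p - 1)
         else p * (p - 1) * t powr (p - 2))" for m t
    have D: "\<forall>m t. m < 2 \<and> 1/2 \<le> t \<and> t \<le> 3/2 \<longrightarrow> (diff m has_real_derivative diff (Suc m) t) (at t)"
    proof (intro allI impI)
      fix m t assume A: "m < (2::nat) \<and> 1/2 \<le> t \<and> t \<le> (3/2::real)"
      then have "m = 0 \<or> m = 1" by auto
      then show "(diff m has_real_derivative diff (Suc m) t) (at t)"
      proof
        assume m: "m = 0"
        have "diff m = (\<lambda>t. t powr p)" "diff (Suc m) t = p * t powr (p - 1)"
          using m by (auto simp: diff_def)
        then show ?thesis
          using A by (auto intro!: derivative_eq_intros)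
      next
        assume m: "m = 1"
        have "diff m = (\<lambda>t. p * t powr (p - 1))" "diff (Suc m) t = p * ((p - 1) * t powr (p - 1 - 1))"
          using m by (auto simp: diff_def)
        then show ?thesis
          using A by (auto intro!: derivative_eq_intros)
      qed
    qed
    have "\<exists>t. (if 1 + x < 1 then 1 + x < t \<and> t < 1 else 1 < t \<and> t < 1 + x) \<and>
      (1 + x) powr p = (\<Sum>m<2. (diff m 1 / fact m) * (1 + x - 1)^m) + (diff 2 t / fact 2) * (1 + x - 1)^2"
      by (rule Taylor[OF _ _ D])
         (use x False in \<open>auto simp: diff_def[of 0] abs_le_iff\<close>)
    then obtain t where t: "1/2 \<le> t" "t \<le> 3/2"
      and eq: "(1 + x) powr p = (\<Sum>m<2. (diff m 1 / fact m) * (1 + x - 1)^m) + (diff 2 t / fact 2) * (1 + x - 1)^2"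
      using x by (smt (verit) field_sum_of_halves)
    have "(1 + x) powr p = 1 + p * x + p * (p - 1) * t powr (p - 2) / 2 * x\<^sup>2"
      unfolding eq by (simp add: diff_def numeral_2_eq_2)
    also have "\<dots> \<le> 1 + p * x + ?C * x\<^sup>2"
    proof -
      have "t powr (p - 2) \<le> 2 powr (p - 2)" using t p by (intro powr_mono2) auto
      then have "p * (p - 1) * t powr (p - 2) \<le> ?C" "0 \<le> p * (p - 1) * t powr (p - 2)"
        using p by (auto intro!: mult_left_mono)
      then have "p * (p - 1) * t powr (p - 2) / 2 \<le> ?C" by linarith
      from mult_right_mono[OF this zero_le_power2[of x]] show ?thesis by linarith
    qed
    finally show ?thesis .
  qed simp
qed

text \<open>The term linear in \<open>b\<close> vanishes in expectation when \<open>b\<close> is a martingale increment.\<close>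

lemma abs_add_powr_le:
  fixes p :: real
  assumes p: "2 \<le> p"
  shows "\<exists>C\<ge>0. \<forall>a b::real. \<bar>a + b\<bar> powr p \<le>
    \<bar>a\<bar> powr p + p * (a * \<bar>a\<bar> powr (p - 2)) * b + C * (\<bar>a\<bar> powr (p - 2) * b\<^sup>2 + \<bar>b\<bar> powr p)"
proof -
  obtain C0 where C0: "C0 \<ge> 0" and le: "\<And>x. \<bar>x\<bar> \<le> 1/2 \<Longrightarrow> (1 + x) powr p \<le> 1 + p * x + C0 * x\<^sup>2"
    using powr_one_plus_le[OF p] by blast
  \<comment> \<open>\<open>C0\<close> serves \<open>|b| < a / 2\<close>, where dividing by
    \<open>a\<close> leads back to the expansion at 1. For \<open>a <= 2 * |b|\<close> the term
    \<open>|b| powr p\<close> alone dominates: \<open>3 powr p\<close> comes from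
    \<open>|a + b| <= 3 * |b|\<close>, and \<open>p * 2 powr (p - 1)\<close> compensates a negative
    linear term.\<close>
  define C where "C = C0 + 3 powr p + p * 2 powr (p - 1)"
  have C: "C \<ge> 0" "C \<ge> C0" "C \<ge> 3 powr p + p * 2 powr (p - 1)"
    using C0 p by (auto simp: C_def)
  have pos: "\<bar>a + b\<bar> powr p \<le>
    \<bar>a\<bar> powr p + p * (a * \<bar>a\<bar> powr (p - 2)) * b + C * (\<bar>a\<bar> powr (p - 2) * b\<^sup>2 + \<bar>b\<bar> powr p)"
    if a: "0 \<le> a" for a b :: real
  proof (cases "\<bar>b\<bar> < a / 2")
    case True
    then have a0: "0 < a" by auto
    define x where "x = b / a"
    have x: "\<bar>x\<bar> \<le> 1/2" using True a0 by (simp add: x_def field_simps)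
    have b: "b = a * x" using a0 by (simp add: x_def)
    have "a * \<bar>a\<bar> powr (p - 2) * a = a powr p"
    proof -
      have "a powr p = a powr (p - 2) * a powr 2" by (simp flip: powr_add)
      then show ?thesis using a0 by (simp add: power2_eq_square)
    qed
    note ap = this
    have "\<bar>a + b\<bar> powr p = a powr p * (1 + x) powr p"
    proof -
      have "\<bar>a + b\<bar> = a * (1 + x)" using a0 True b by (simp add: algebra_simps)
      then show ?thesis using a0 x by (simp add: powr_mult)
    qed
    also have "\<dots> \<le> a powr p * (1 + p * x + C0 * x\<^sup>2)"
      using le[OF x] by (intro mult_left_mono) auto
    also have "\<dots> = a powr p + p * (a * \<bar>a\<bar> powr (p - 2)) * b + C0 * (\<bar>a\<bar> powr (p - 2) * b\<^sup>2)"
      by (simp add: b power2_eq_square ap[symmetric] algebra_simps)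
    also have "\<dots> \<le> a powr p + p * (a * \<bar>a\<bar> powr (p - 2)) * b + C * (\<bar>a\<bar> powr (p - 2) * b\<^sup>2 + \<bar>b\<bar> powr p)"
      using C C0 by (intro add_left_mono mult_mono) auto
    finally show ?thesis using a by simp
  next
    case False
    then have ab: "a \<le> 2 * \<bar>b\<bar>" by auto
    have 1: "\<bar>a + b\<bar> powr p \<le> 3 powr p * \<bar>b\<bar> powr p"
    proof -
      have "\<bar>a + b\<bar> powr p \<le> (3 * \<bar>b\<bar>) powr p"
        using ab a p by (intro powr_mono2) auto
      then show ?thesis by (simp add: powr_mult)
    qed
    have 2: "- (p * (a * \<bar>a\<bar> powr (p - 2)) * b) \<le> p * 2 powr (p - 1) * \<bar>b\<bar> powr p"
    proof -
      have "a * \<bar>a\<bar> powr (p - 2) \<le> (2 * \<bar>b\<bar>) * (2 * \<bar>b\<bar>) powr (p - 2)"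
        using ab a p by (intro mult_mono powr_mono2) auto
      also have "\<dots> = (2 * \<bar>b\<bar>) powr (p - 1)"
      proof (cases "b = 0")
        case False
        then show ?thesis
          using powr_add[of "2 * \<bar>b\<bar>" 1 "p - 2"] by simp
      qed simp
      finally have *: "a * \<bar>a\<bar> powr (p - 2) \<le> (2 * \<bar>b\<bar>) powr (p - 1)" .
      have "- (p * (a * \<bar>a\<bar> powr (p - 2)) * b) \<le> p * (a * \<bar>a\<bar> powr (p - 2)) * \<bar>b\<bar>"
        using p a by (smt (verit, ccfv_threshold) mult_minus_right mult_nonneg_nonneg powr_ge_zero)
      also have "\<dots> \<le> p * (2 * \<bar>b\<bar>) powr (p - 1) * \<bar>b\<bar>"
        using * p by (intro mult_left_mono mult_right_mono) auto
      also have "\<dots> = p * 2 powr (p - 1) * (\<bar>b\<bar> powr (p - 1) * \<bar>b\<bar>)"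
        by (simp add: powr_mult algebra_simps)
      also have "\<bar>b\<bar> powr (p - 1) * \<bar>b\<bar> = \<bar>b\<bar> powr p"
      proof (cases "b = 0")
        case False
        then show ?thesis
          using powr_add[of "\<bar>b\<bar>" 1 "p - 1"] by simp
      qed simp
      finally show ?thesis .
    qed
    have "(3 powr p + p * 2 powr (p - 1)) * \<bar>b\<bar> powr p \<le> C * \<bar>b\<bar> powr p"
      using C by (intro mult_right_mono) auto
    moreover have "0 \<le> \<bar>a\<bar> powr p" "0 \<le> C * (\<bar>a\<bar> powr (p - 2) * b\<^sup>2)"
      using C by auto
    ultimately show ?thesis using 1 2 unfolding distrib_left distrib_right by linarith
  qed
  show ?thesis
  proof (intro exI conjI allI)
    show "0 \<le> C" by fact
    fix a b :: real
    show "\<bar>a + b\<bar> powr p \<le>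
    \<bar>a\<bar> powr p + p * (a * \<bar>a\<bar> powr (p - 2)) * b + C * (\<bar>a\<bar> powr (p - 2) * b\<^sup>2 + \<bar>b\<bar> powr p)"
      using pos[of a b] pos[of "- a" "- b"]
      by (cases "0 \<le> a") (auto simp: abs_minus_commute, smt (verit))
  qed
qed

lemma abs_add_powr_le_two_powr:
  fixes a b p :: real
  assumes "0 \<le> p"
  shows "\<bar>a + b\<bar> powr p \<le> 2 powr p * (\<bar>a\<bar> powr p + \<bar>b\<bar> powr p)"
proof -
  have "\<bar>a + b\<bar> powr p \<le> (2 * max \<bar>a\<bar> \<bar>b\<bar>) powr p"
    using assms by (intro powr_mono2) auto
  also have "\<dots> = 2 powr p * max \<bar>a\<bar> \<bar>b\<bar> powr p" by (simp add: powr_mult)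
  also have "\<dots> \<le> 2 powr p * (\<bar>a\<bar> powr p + \<bar>b\<bar> powr p)"
    by (intro mult_left_mono) (auto simp: max_def)
  finally show ?thesis .
qed

text \<open>A Young inequality with constant one, by comparing \<open>q\<close> with
  \<open>a\<^sup>2\<close>. It separates the product of \<open>|X| powr (p - 2)\<close> with the
  rate of quadratic variation into the moment of \<open>X\<close>, which Gronwall's inequality
  absorbs, and a term of the right-hand side of the moment bound.\<close>

lemma powr_mult_le_add_powr:
  fixes a q p :: real
  assumes "2 \<le> p" "0 \<le> a" "0 \<le> q"
  shows "a powr (p - 2) * q \<le> a powr p + q powr (p / 2)"
proof (cases "q \<le> a\<^sup>2")
  case True
  show ?thesis
  proof (cases "a = 0")
    case False
    have "a powr (p - 2) * q \<le> a powr (p - 2) * a powr 2"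
      using True assms False by (intro mult_left_mono) auto
    also have "\<dots> = a powr p" by (simp flip: powr_add)
    finally show ?thesis using powr_ge_zero[of q "p/2"] by linarith
  qed (use True in auto)
next
  case False
  then have q: "0 < q" using assms by (smt (verit) zero_le_power2)
  have "a = (a\<^sup>2) powr (1/2)" using assms by (simp add: powr_half_sqrt)
  also have "\<dots> \<le> q powr (1/2)" using False by (intro powr_mono2) auto
  finally have "a powr (p - 2) \<le> (q powr (1/2)) powr (p - 2)"
    using assms by (intro powr_mono2) auto
  then have "a powr (p - 2) * q \<le> q powr ((p - 2)/2) * q powr 1"
    using q by (auto simp: powr_powr)
  also have "\<dots> = q powr (p/2)" unfolding powr_add[symmetric] by (simp add: field_simps)
  finally show ?thesis using powr_ge_zero[of a p] by linarith
qed

section \<open>Powers with values in \<open>[0, \<infinity>]\<close>\<close>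

lemma epowr_ennreal: "0 \<le> x \<Longrightarrow> epowr (ennreal x) a = ennreal (x powr a)"
  by (simp add: epowr_def)

lemma epowr_top [simp]: "epowr \<top> a = \<top>"
  by (simp add: epowr_def)

lemma epowr_zero [simp]: "epowr 0 a = 0"
  using epowr_ennreal[of 0 a] by simp

lemma epowr_mono: "0 < a \<Longrightarrow> x \<le> y \<Longrightarrow> epowr x a \<le> epowr y a"
  by (cases x; cases y) (auto simp: epowr_ennreal top_unique intro!: ennreal_leI powr_mono2)

lemma epowr_mult: "0 < a \<Longrightarrow> epowr (x * y) a = epowr x a * epowr y a"
proof (cases x; cases y)
  fix r s assume "0 < a" "0 \<le> r" "x = ennreal r" "0 \<le> s" "y = ennreal s"
  then show ?thesis by (simp add: epowr_ennreal powr_mult flip: ennreal_mult)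
qed (auto simp: epowr_ennreal ennreal_top_mult ennreal_mult_top epowr_def)

lemma epowr_one [simp]: "epowr x 1 = x"
  by (cases x) (auto simp: epowr_ennreal)

lemma epowr_add_le: "0 < a \<Longrightarrow> epowr (x + y) a \<le> ennreal (2 powr a) * (epowr x a + epowr y a)"
proof (cases x; cases y)
  fix r s assume *: "0 < a" "0 \<le> r" "x = ennreal r" "0 \<le> s" "y = ennreal s"
  then show ?thesis
    using abs_add_powr_le_two_powr[of a r s]
    by (simp add: epowr_ennreal flip: ennreal_plus ennreal_mult)
qed (auto simp: ennreal_mult_top)

lemma epowr_le_add_one: "0 < a \<Longrightarrow> a \<le> b \<Longrightarrow> epowr x a \<le> 1 + epowr x b"
proof (cases x)
  case (real r)
  assume ab: "0 < a" "a \<le> b"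
  have "r powr a \<le> 1 + r powr b"
  proof (cases "r \<le> 1")
    case True
    then show ?thesis using real ab powr_mono2[of a r 1] by (smt (verit) powr_ge_zero powr_one_eq_one)
  next
    case False
    then show ?thesis using powr_mono[of a b r] ab by linarith
  qed
  then have "ennreal (r powr a) \<le> ennreal (1 + r powr b)" by (rule ennreal_leI)
  then show ?thesis using real by (simp add: epowr_ennreal)
qed auto

lemma borel_measurable_epowr [measurable (raw)]:
  assumes [measurable]: "f \<in> borel_measurable M"
  shows "(\<lambda>x. epowr (f x) a) \<in> borel_measurable M"
  unfolding epowr_def by measurable

section \<open>Counts of a Poisson random measure\<close>

lemma suminf_poisson_first_moment:
  fixes l :: real assumes "0 \<le> l"
  shows "(\<Sum>k. ennreal (real k) * ennreal (exp (- l) * l ^ k / fact k)) = ennreal l"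
proof -
  have "(\<lambda>k. l * (exp (- l) * (l ^ k /\<^sub>R fact k))) sums (l * (exp (- l) * exp l))"
    by (intro sums_mult exp_converges)
  moreover have "l * (exp (- l) * (l ^ k /\<^sub>R fact k)) = real (Suc k) * (exp (- l) * l ^ Suc k / fact (Suc k))" for k
    by (simp add: field_simps del: of_nat_Suc)
  ultimately have "(\<lambda>k. real (Suc k) * (exp (- l) * l ^ Suc k / fact (Suc k))) sums l"
    by (simp flip: exp_add)
  then have "(\<lambda>k. real k * (exp (- l) * l ^ k / fact k)) sums l"
    using sums_Suc_iff[of "\<lambda>k. real k * (exp (- l) * l ^ k / fact k)" l] by simp
  then have "(\<Sum>k. ennreal (real k * (exp (- l) * l ^ k / fact k))) = ennreal l"
    using assms by (intro suminf_ennreal_eq) auto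
  then show ?thesis using assms by (simp flip: ennreal_mult)
qed

text \<open>A single term of the exponential series. It reduces polynomial moments of a Poisson law
  to exponential ones, whose series are explicit.\<close>

lemma power_le_fact_mult_exp: "real k ^ m \<le> fact m * exp (real k)"
proof -
  have "real k ^ m / fact m \<le> (\<Sum>n. real k ^ n / fact n)"
    using sum_le_suminf[of "\<lambda>n. real k ^ n / fact n" "{m}"]
      summable_exp[of "real k"] by (simp add: field_simps)
  also have "\<dots> = exp (real k)" by (simp add: exp_def field_simps)
  finally show ?thesis by (simp add: field_simps)
qed

lemma suminf_poisson_moment_finite:
  fixes l :: real assumes "0 \<le> l"
  shows "(\<Sum>k. ennreal (real k ^ m) * ennreal (exp (- l) * l ^ k / fact k)) < \<infinity>"
proof -
  have "(\<lambda>k. fact m * ((exp 1 * l) ^ k /\<^sub>R fact k)) sums (fact m * exp (exp 1 * l))"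
    by (intro sums_mult exp_converges)
  then have "(\<Sum>k. ennreal (fact m * ((exp 1 * l) ^ k /\<^sub>R fact k))) = ennreal (fact m * exp (exp 1 * l))"
    using assms by (intro suminf_ennreal_eq) auto
  moreover have "(\<Sum>k. ennreal (real k ^ m) * ennreal (exp (- l) * l ^ k / fact k)) \<le>
    (\<Sum>k. ennreal (fact m * ((exp 1 * l) ^ k /\<^sub>R fact k)))"
  proof (intro suminf_le summableI)
    fix k
    have "real k ^ m * (exp (- l) * l ^ k / fact k) \<le> (fact m * exp (real k)) * (1 * l ^ k / fact k)"
      using assms by (intro mult_mono power_le_fact_mult_exp divide_right_mono mult_right_mono) auto
    also have "\<dots> = fact m * ((exp 1 * l) ^ k /\<^sub>R fact k)"
      by (simp add: power_mult_distrib field_simps flip: exp_of_nat_mult)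
    finally show "ennreal (real k ^ m) * ennreal (exp (- l) * l ^ k / fact k) \<le>
      ennreal (fact m * ((exp 1 * l) ^ k /\<^sub>R fact k))"
      using assms by (simp add: ennreal_leI flip: ennreal_mult)
  qed
  ultimately show ?thesis by (simp add: less_top[symmetric] top_unique)
     (metis ennreal_neq_top top_unique)
qed

text \<open>With at least two points and \<open>l <= 1\<close>, the factor \<open>l ^ k\<close> is
  at most \<open>l\<^sup>2\<close>, which leaves the sum; the remaining series of
  \<open>exp 1 ^ k / fact k\<close> gives \<open>exp (exp 1)\<close>. The square is essential:
  summed over a fine partition in time, these errors vanish.\<close>

lemma suminf_poisson_tail_moment:
  fixes l :: real assumes "0 \<le> l" "l \<le> 1"
  shows "(\<Sum>k. ennreal (real k ^ m * indicator {2..} (real k)) * ennreal (exp (- l) * l ^ k / fact k))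
    \<le> ennreal (fact m * exp (exp 1) * l\<^sup>2)"
proof -
  have "(\<lambda>k. fact m * l\<^sup>2 * (exp 1 ^ k /\<^sub>R fact k)) sums (fact m * l\<^sup>2 * exp (exp 1))"
    by (intro sums_mult exp_converges)
  then have "(\<Sum>k. ennreal (fact m * l\<^sup>2 * (exp 1 ^ k /\<^sub>R fact k))) = ennreal (fact m * l\<^sup>2 * exp (exp 1))"
    using assms by (intro suminf_ennreal_eq) auto
  moreover have "(\<Sum>k. ennreal (real k ^ m * indicator {2..} (real k)) * ennreal (exp (- l) * l ^ k / fact k)) \<le>
    (\<Sum>k. ennreal (fact m * l\<^sup>2 * (exp 1 ^ k /\<^sub>R fact k)))"
  proof (intro suminf_le summableI)
    fix k
    show "ennreal (real k ^ m * indicator {2..} (real k)) * ennreal (exp (- l) * l ^ k / fact k) \<le>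
      ennreal (fact m * l\<^sup>2 * (exp 1 ^ k /\<^sub>R fact k))"
    proof (cases "2 \<le> k")
      case True
      have "real k ^ m * (exp (- l) * l ^ k / fact k) \<le> (fact m * exp (real k)) * (1 * l\<^sup>2 / fact k)"
        using assms True
        by (intro mult_mono power_le_fact_mult_exp divide_right_mono power_decreasing) auto
      also have "\<dots> = fact m * l\<^sup>2 * (exp 1 ^ k /\<^sub>R fact k)"
        by (simp add: field_simps flip: exp_of_nat_mult)
      finally show ?thesis
        using assms True by (simp add: ennreal_leI flip: ennreal_mult)
    qed auto
  qed
  ultimately show ?thesis by (simp add: mult_ac)
qed

section \<open>Law and independence of the counts on rectangles\<close>

locale poisson_basis =
  fixes M :: "'w measure" and T :: real and F :: "real \<Rightarrow> 'w measure"
    and \<nu> :: "'z measure" and \<mu> :: "'w \<Rightarrow> (real \<times> 'z) measure"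
  assumes T_pos: "0 < T"
    and basis: "stochastic_basis M T F"
    and sigma_finite_nu: "sigma_finite_measure \<nu>"
    and prm: "poisson_random_measure M T F \<nu> \<mu>"
begin

sublocale prob_space M
  using basis by (simp add: stochastic_basis_def)

sublocale nu: sigma_finite_measure \<nu>
  by (rule sigma_finite_nu)

lemma subalg: "0 \<le> t \<Longrightarrow> t \<le> T \<Longrightarrow> subalgebra M (F t)"
  using basis by (simp add: stochastic_basis_def)

lemma space_F: "0 \<le> t \<Longrightarrow> t \<le> T \<Longrightarrow> space (F t) = space M"
  using subalg by (simp add: subalgebra_def)

lemma F_mono: "0 \<le> s \<Longrightarrow> s \<le> t \<Longrightarrow> t \<le> T \<Longrightarrow> X \<in> measurable (F s) S \<Longrightarrow> X \<in> measurable (F t) S"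
proof -
  assume st: "0 \<le> s" "s \<le> t" "t \<le> T" and X: "X \<in> measurable (F s) S"
  have "sets (F s) \<subseteq> sets (F t)" using basis st by (simp add: stochastic_basis_def)
  moreover have "space (F s) = space (F t)" using st by (simp add: space_F)
  ultimately have "subalgebra (F t) (F s)" by (simp add: subalgebra_def)
  then show ?thesis using X by (rule measurable_from_subalg)
qed

lemma F_measurable_M: "0 \<le> t \<Longrightarrow> t \<le> T \<Longrightarrow> X \<in> measurable (F t) S \<Longrightarrow> X \<in> measurable M S"
  using measurable_from_subalg subalg by blast

text \<open>A real-valued count: where the count is infinite, \<open>measure\<close> returns 0. For
  \<open>A\<close> of finite \<nu>-mass and time bounds in \<open>[0, T]\<close> this concerns a
  null set only, by \<open>AE_mu_nat\<close>.\<close>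

definition N :: "real \<Rightarrow> real \<Rightarrow> 'z set \<Rightarrow> 'w \<Rightarrow> real" where
  "N u v A \<omega> = measure (\<mu> \<omega>) ({u<..v} \<times> A)"

lemma sets_intensity: "0 \<le> u \<Longrightarrow> v \<le> T \<Longrightarrow> A \<in> sets \<nu> \<Longrightarrow> {u<..v} \<times> A \<in> sets (intensity T \<nu>)"
  unfolding intensity_def
  by (intro pair_measureI) (auto simp: sets_restrict_space intro!: image_eqI[where x="{u<..v}"])

lemma emeasure_intensity:
  assumes "0 \<le> u" "u \<le> v" "v \<le> T" "A \<in> sets \<nu>"
  shows "emeasure (intensity T \<nu>) ({u<..v} \<times> A) = ennreal (v - u) * emeasure \<nu> A"
proof -
  have "{u<..v} \<in> sets (restrict_space lborel {0..T})"
    using assms by (auto simp: sets_restrict_space intro!: image_eqI[where x="{u<..v}"])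
  then have "emeasure (intensity T \<nu>) ({u<..v} \<times> A) = emeasure (restrict_space lborel {0..T}) {u<..v} * emeasure \<nu> A"
    using assms unfolding intensity_def by (intro nu.emeasure_pair_measure_Times) auto
  also have "emeasure (restrict_space lborel {0..T}) {u<..v} = ennreal (v - u)"
    using assms by (subst emeasure_restrict_space) auto
  finally show ?thesis .
qed

lemmas prm_conjs = prm[unfolded poisson_random_measure_def]
lemmas measurable_emeasure_mu = prm_conjs[THEN conjunct2, THEN conjunct1, rule_format]
lemmas prob_mu = prm_conjs[THEN conjunct2, THEN conjunct2, THEN conjunct1, rule_format]
lemmas adapted_mu = prm_conjs[THEN conjunct2, THEN conjunct2, THEN conjunct2, THEN conjunct2, THEN conjunct1, rule_format]
lemmas indep_mu = prm_conjs[THEN conjunct2, THEN conjunct2, THEN conjunct2, THEN conjunct2, THEN conjunct2, rule_format]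

lemma N_measurable_F:
  assumes "0 \<le> u" "v \<le> t" "t \<le> T" "A \<in> sets \<nu>" "0 \<le> t"
  shows "N u v A \<in> borel_measurable (F t)"
proof -
  have "{u<..v} \<times> A \<subseteq> {0..t} \<times> space \<nu>" using assms sets.sets_into_space[of A \<nu>] by auto
  then have "(\<lambda>\<omega>. emeasure (\<mu> \<omega>) ({u<..v} \<times> A)) \<in> borel_measurable (F t)"
    using assms by (intro adapted_mu sets_intensity) auto
  then show ?thesis unfolding N_def measure_def by measurable
qed

lemma N_measurable [measurable]:
  assumes "0 \<le> u" "v \<le> T" "A \<in> sets \<nu>"
  shows "N u v A \<in> borel_measurable M"
  using F_measurable_M[OF _ _ N_measurable_F[of u v T A]] assms T_pos by auto

lemma N_nonneg [simp]: "0 \<le> N u v A \<omega>" by (simp add: N_def)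

definition lam :: "real \<Rightarrow> real \<Rightarrow> 'z set \<Rightarrow> real" where
  "lam u v A = (v - u) * measure \<nu> A"

lemma measure_intensity:
  assumes "0 \<le> u" "u \<le> v" "v \<le> T" "A \<in> sets \<nu>"
  shows "measure (intensity T \<nu>) ({u<..v} \<times> A) = lam u v A"
  using assms by (simp add: measure_def emeasure_intensity enn2real_mult lam_def)

lemma lam_nonneg: "u \<le> v \<Longrightarrow> 0 \<le> lam u v A" by (simp add: lam_def)

context
  fixes u v :: real and A :: "'z set"
  assumes uv: "0 \<le> u" "u \<le> v" "v \<le> T" and A: "A \<in> sets \<nu>" "emeasure \<nu> A < \<infinity>"
begin

lemma prob_mu_eq:
  "measure M {\<omega>\<in>space M. emeasure (\<mu> \<omega>) ({u<..v} \<times> A) = of_nat k} = exp (- lam u v A) * lam u v A ^ k / fact k"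
proof -
  have "emeasure (intensity T \<nu>) ({u<..v} \<times> A) < \<infinity>"
    using uv A by (simp add: emeasure_intensity ennreal_mult_less_top)
  then show ?thesis
    using prob_mu[OF sets_intensity[of u v A]] uv A by (simp add: measure_intensity)
qed

text \<open>Integer values are not built into the notion of a Poisson random measure used here; they
  follow because the Poisson weights sum to one, so that the events of having exactly
  \<open>k\<close> points exhaust the space up to a null set.\<close>

lemma AE_mu_nat: "AE \<omega> in M. \<exists>k::nat. emeasure (\<mu> \<omega>) ({u<..v} \<times> A) = of_nat k"
proof -
  let ?E = "\<lambda>k::nat. {\<omega>\<in>space M. emeasure (\<mu> \<omega>) ({u<..v} \<times> A) = of_nat k}"
  have [measurable]: "(\<lambda>\<omega>. emeasure (\<mu> \<omega>) ({u<..v} \<times> A)) \<in> borel_measurable M"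
    by (intro measurable_emeasure_mu sets_intensity uv A)
  have [measurable]: "?E k \<in> sets M" for k by measurable
  have "(\<lambda>k. prob (?E k)) sums prob (\<Union>k. ?E k)"
    by (intro finite_measure_UNION) (auto simp: disjoint_family_on_def)
  moreover have "(\<lambda>k. prob (?E k)) sums 1"
  proof -
    have "(\<lambda>k. exp (- lam u v A) * (lam u v A ^ k /\<^sub>R fact k)) sums (exp (- lam u v A) * exp (lam u v A))"
      by (intro sums_mult exp_converges)
    then show ?thesis by (simp add: prob_mu_eq field_simps flip: exp_add)
  qed
  ultimately have "prob (\<Union>k. ?E k) = 1" by (rule sums_unique2)
  then have "AE \<omega> in M. \<omega> \<in> (\<Union>k. ?E k)" by (subst AE_in_set_eq_1) auto
  then show ?thesis by eventually_elim auto
qed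

lemma nn_integral_N:
  fixes \<phi> :: "real \<Rightarrow> ennreal"
  shows "(\<integral>\<^sup>+\<omega>. \<phi> (N u v A \<omega>) \<partial>M) = (\<Sum>k. \<phi> (real k) * ennreal (exp (- lam u v A) * lam u v A ^ k / fact k))"
proof -
  let ?E = "\<lambda>k::nat. {\<omega>\<in>space M. emeasure (\<mu> \<omega>) ({u<..v} \<times> A) = of_nat k}"
  have [measurable]: "(\<lambda>\<omega>. emeasure (\<mu> \<omega>) ({u<..v} \<times> A)) \<in> borel_measurable M"
    by (intro measurable_emeasure_mu sets_intensity uv A)
  have [measurable]: "?E k \<in> sets M" for k by measurable
  have "(\<integral>\<^sup>+\<omega>. \<phi> (N u v A \<omega>) \<partial>M) = (\<integral>\<^sup>+\<omega>. (\<Sum>k. \<phi> (real k) * indicator (?E k) \<omega>) \<partial>M)"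
  proof (rule nn_integral_cong_AE)
    show "AE \<omega> in M. \<phi> (N u v A \<omega>) = (\<Sum>k. \<phi> (real k) * indicator (?E k) \<omega>)"
      using AE_mu_nat AE_space
    proof eventually_elim
      case (elim \<omega>)
      then obtain k :: nat where k: "emeasure (\<mu> \<omega>) ({u<..v} \<times> A) = of_nat k" by auto
      then have "N u v A \<omega> = real k"
        by (simp add: N_def measure_def)
      moreover have "(\<lambda>j. \<phi> (real j) * indicator (?E j) \<omega>) = (\<lambda>j. if j = k then \<phi> (real k) else 0)"
        using elim k by (auto simp: fun_eq_iff indicator_def)
      ultimately show ?case using suminf_finite[of "{k}" "\<lambda>j. if j = k then \<phi> (real k) else 0"] by simp
    qed
  qed
  also have "\<dots> = (\<Sum>k. \<integral>\<^sup>+\<omega>. \<phi> (real k) * indicator (?E k) \<omega> \<partial>M)"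
    by (intro nn_integral_suminf) measurable
  also have "\<dots> = (\<Sum>k. \<phi> (real k) * ennreal (exp (- lam u v A) * lam u v A ^ k / fact k))"
    by (simp add: nn_integral_cmult_indicator emeasure_eq_measure prob_mu_eq)
  finally show ?thesis .
qed

lemma nn_integral_N_1: "(\<integral>\<^sup>+\<omega>. ennreal (N u v A \<omega>) \<partial>M) = ennreal (lam u v A)"
  using nn_integral_N[of ennreal] suminf_poisson_first_moment lam_nonneg[of u v A] uv by simp

lemma nn_integral_N_power: "(\<integral>\<^sup>+\<omega>. ennreal (N u v A \<omega> ^ m) \<partial>M) < \<infinity>"
  using nn_integral_N[of "\<lambda>x. ennreal (x ^ m)"] suminf_poisson_moment_finite[of "lam u v A" m] lam_nonneg[of u v A] uv
  by simp

lemma nn_integral_N_tail: "lam u v A \<le> 1 \<Longrightarrow>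
  (\<integral>\<^sup>+\<omega>. ennreal (N u v A \<omega> ^ m * indicator {2..} (N u v A \<omega>)) \<partial>M) \<le> ennreal (fact m * exp (exp 1) * (lam u v A)\<^sup>2)"
  using nn_integral_N[of "\<lambda>x. ennreal (x ^ m * indicator {2..} x)"] suminf_poisson_tail_moment[of "lam u v A" m] lam_nonneg[of u v A] uv
  by simp

lemma integrable_N_power: "integrable M (\<lambda>\<omega>. N u v A \<omega> ^ m)"
proof -
  have [measurable]: "N u v A \<in> borel_measurable M" using uv A by measurable
  show ?thesis using nn_integral_N_power[of m] by (intro integrableI_nonneg) auto
qed

lemma expectation_N: "expectation (N u v A) = lam u v A"
  using nn_integral_N_1 lam_nonneg[of u v A] uv A
  by (subst integral_eq_nn_integral) auto

text \<open>The \<sigma>-algebra generated by \<open>X\<close> lies in \<open>F u\<close>, and that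
  of the count lies in the one generated by all counts on subsets of \<open>(u, T]\<close>. The
  passage from \<open>emeasure\<close> to the real count is a measurable map, so preimages under
  \<open>N\<close> are preimages under the extended count.\<close>

lemma indep_var_N:
  assumes X: "X \<in> measurable (F u) S" and Y: "h \<in> measurable borel S"
  shows "indep_var S X S (\<lambda>\<omega>. h (N u v A \<omega>))"
proof -
  have u: "0 \<le> u" "u \<le> T" using uv by auto
  have [measurable]: "N u v A \<in> borel_measurable M" using uv A by measurable
  let ?G = "{(\<lambda>\<omega>. emeasure (\<mu> \<omega>) A) -` B \<inter> space M |A B.
              A \<in> sets (intensity T \<nu>) \<and> A \<subseteq> {u<..T} \<times> space \<nu> \<and> B \<in> sets borel}"
  have ind: "indep_set (sets (F u)) (sigma_sets (space M) ?G)"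
    by (rule indep_mu) (use u in auto)
  let ?f = "\<lambda>\<omega>. emeasure (\<mu> \<omega>) ({u<..v} \<times> A)"
  have "{u<..v} \<times> A \<subseteq> {u<..T} \<times> space \<nu>" using uv sets.sets_into_space[OF A(1)] by auto
  then have G: "?f -` B \<inter> space M \<in> ?G" if "B \<in> sets borel" for B
    using sets_intensity[of u v A] uv A that by blast
  have "indep_set (sigma_sets (space M) {X -` A \<inter> space M |A. A \<in> sets S})
     (sigma_sets (space M) {(\<lambda>\<omega>. h (N u v A \<omega>)) -` B \<inter> space M |B. B \<in> sets S})"
    using ind unfolding indep_set_def
  proof (rule indep_sets_mono_sets)
    have "sigma_sets (space M) {X -` A \<inter> space M |A. A \<in> sets S} \<subseteq> sets (F u)"
    proof -
      have "{X -` A \<inter> space M |A. A \<in> sets S} \<subseteq> sets (F u)"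
        using measurable_sets[OF X] space_F[OF u] by auto
      then show ?thesis using sets.sigma_sets_subset[of _ "F u"] space_F[OF u] by simp
    qed
    moreover have "sigma_sets (space M) {(\<lambda>\<omega>. h (N u v A \<omega>)) -` B \<inter> space M |B. B \<in> sets S}
      \<subseteq> sigma_sets (space M) ?G"
    proof (rule sigma_sets_mono, safe)
      fix B assume B: "B \<in> sets S"
      have "(\<lambda>x. h (enn2real x)) -` B \<in> sets borel"
        using Y B measurable_sets[of "\<lambda>x. h (enn2real x)" borel S B] by simp
      then have "?f -` ((\<lambda>x. h (enn2real x)) -` B) \<inter> space M \<in> ?G" by (rule G)
      moreover have "(\<lambda>\<omega>. h (N u v A \<omega>)) -` B \<inter> space M = ?f -` ((\<lambda>x. h (enn2real x)) -` B) \<inter> space M"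
        by (auto simp: N_def measure_def)
      ultimately show "(\<lambda>\<omega>. h (N u v A \<omega>)) -` B \<inter> space M \<in> sigma_sets (space M) ?G"
        by (simp add: sigma_sets.Basic)
    qed
    ultimately show "(case i of True \<Rightarrow> sigma_sets (space M) {X -` A \<inter> space M |A. A \<in> sets S}
      | False \<Rightarrow> sigma_sets (space M) {(\<lambda>\<omega>. h (N u v A \<omega>)) -` B \<inter> space M |B. B \<in> sets S})
      \<subseteq> (case i of True \<Rightarrow> sets (F u) | False \<Rightarrow> sigma_sets (space M) ?G)" for i
      by (cases i) auto
  qed
  moreover have "X \<in> measurable M S" using F_measurable_M[OF u X] .
  moreover have "(\<lambda>\<omega>. h (N u v A \<omega>)) \<in> measurable M S" using Y by measurable
  ultimately show ?thesis unfolding indep_var_eq by simp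
qed

lemma nn_integral_mult_N:
  fixes X :: "'w \<Rightarrow> ennreal"
  assumes X: "X \<in> borel_measurable (F u)" and h: "h \<in> borel_measurable borel"
  shows "(\<integral>\<^sup>+\<omega>. X \<omega> * h (N u v A \<omega>) \<partial>M) = (\<integral>\<^sup>+\<omega>. X \<omega> \<partial>M) * (\<integral>\<^sup>+\<omega>. h (N u v A \<omega>) \<partial>M)"
proof -
  have "indep_vars (case_bool borel borel) (case_bool X (\<lambda>\<omega>. h (N u v A \<omega>))) UNIV"
    using indep_var_N[OF X h] unfolding indep_var_def .
  moreover have "case_bool borel borel = (\<lambda>_. borel :: ennreal measure)"
    by (auto simp: fun_eq_iff split: bool.split)
  ultimately have "indep_vars (\<lambda>_. borel) (case_bool X (\<lambda>\<omega>. h (N u v A \<omega>))) UNIV" by simp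
  from indep_vars_nn_integral[OF _ this] show ?thesis
    by (simp add: UNIV_bool mult.commute)
qed

text \<open>The martingale property in the form in which it enters: a factor known at time
  \<open>u\<close> splits off by independence, and the compensated count is centred.\<close>

lemma expectation_mult_compensated_N:
  fixes X :: "'w \<Rightarrow> real"
  assumes X: "X \<in> borel_measurable (F u)" and int: "integrable M X"
  shows "expectation (\<lambda>\<omega>. X \<omega> * (N u v A \<omega> - lam u v A)) = 0"
    and "integrable M (\<lambda>\<omega>. X \<omega> * (N u v A \<omega> - lam u v A))"
proof -
  have i: "indep_var borel X borel (\<lambda>\<omega>. N u v A \<omega> - lam u v A)"
    using X by (rule indep_var_N) simp
  have N: "integrable M (N u v A)" using integrable_N_power[of 1] by simp
  then have j: "integrable M (\<lambda>\<omega>. N u v A \<omega> - lam u v A)" by simp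
  show "integrable M (\<lambda>\<omega>. X \<omega> * (N u v A \<omega> - lam u v A))"
    using indep_var_integrable[OF i int j] .
  have "expectation (\<lambda>\<omega>. N u v A \<omega> - lam u v A) = 0"
    using N by (simp add: expectation_N prob_space)
  then show "expectation (\<lambda>\<omega>. X \<omega> * (N u v A \<omega> - lam u v A)) = 0"
    using indep_var_lebesgue_integral[OF i int j] by simp
qed

end

end

section \<open>Moments over one time step\<close>

text \<open>
  Unless two points fall into a time step, an event whose probability is quadratic in the length
  of the step, at most one of the counts \<open>n j\<close> is nonzero.
\<close>

lemma abs_sum_powr_le_of_nat:
  fixes c :: "'j \<Rightarrow> real" and n :: "'j \<Rightarrow> nat" and r C :: real
  assumes J: "finite J" and r: "1 \<le> r" and C: "\<And>j. j \<in> J \<Longrightarrow> \<bar>c j\<bar> \<le> C" and C0: "0 \<le> C"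
    and m: "r \<le> real m"
  shows "\<bar>\<Sum>j\<in>J. c j * real (n j)\<bar> powr r \<le>
    (\<Sum>j\<in>J. \<bar>c j\<bar> powr r * real (n j)) + C powr r * (real (\<Sum>j\<in>J. n j) ^ m * indicator {2..} (real (\<Sum>j\<in>J. n j)))"
proof (cases "2 \<le> (\<Sum>j\<in>J. n j)")
  case True
  define k where "k = (\<Sum>j\<in>J. n j)"
  have "\<bar>\<Sum>j\<in>J. c j * real (n j)\<bar> \<le> (\<Sum>j\<in>J. \<bar>c j * real (n j)\<bar>)" by (rule sum_abs)
  also have "\<dots> \<le> (\<Sum>j\<in>J. C * real (n j))"
    using C by (intro sum_mono) (auto simp: abs_mult intro!: mult_right_mono)
  also have "\<dots> = C * real k" by (simp add: k_def sum_distrib_left)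
  finally have "\<bar>\<Sum>j\<in>J. c j * real (n j)\<bar> powr r \<le> (C * real k) powr r"
    using r by (intro powr_mono2) auto
  also have "\<dots> \<le> C powr r * real k ^ m"
  proof -
    have "real k powr r \<le> real k powr real m"
      using True m by (intro powr_mono) (auto simp: k_def simp flip: of_nat_sum)
    also have "\<dots> = real k ^ m"
      using True by (intro powr_realpow) (auto simp: k_def simp flip: of_nat_sum)
    finally show ?thesis
      using C0 by (auto simp: powr_mult intro!: mult_left_mono)
  qed
  finally show ?thesis
    using True by (auto simp: k_def[symmetric] intro!: add_increasing sum_nonneg)
next
  case False
  show ?thesis
  proof (cases "\<exists>j\<in>J. n j \<noteq> 0")
    case True
    then obtain i where i: "i \<in> J" "n i \<noteq> 0" by auto
    have s: "(\<Sum>j\<in>J. n j) = n i + (\<Sum>j\<in>J - {i}. n j)" using J i by (simp add: sum.remove)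
    \<comment> \<open>A total below two together with \<open>n i \<noteq> 0\<close> leaves exactly
      one point, in piece \<open>i\<close>. Every sum over the pieces then has one nonzero term, so
      the power moves inside with constant one.\<close>
    then have ni: "n i = 1" and "(\<Sum>j\<in>J - {i}. n j) = 0" using False i by auto
    then have z: "\<And>j. j \<in> J \<Longrightarrow> j \<noteq> i \<Longrightarrow> n j = 0" using J by auto
    have 1: "(\<Sum>j\<in>J. f j * real (n j)) = f i" for f :: "'j \<Rightarrow> real"
    proof -
      have "(\<Sum>j\<in>J. f j * real (n j)) = f i * real (n i) + (\<Sum>j\<in>J - {i}. f j * real (n j))"
        using J i by (simp add: sum.remove)
      also have "(\<Sum>j\<in>J - {i}. f j * real (n j)) = 0" using z by (intro sum.neutral) auto
      finally show ?thesis using ni by simp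
    qed
    show ?thesis unfolding 1 using r C0
      by (auto intro!: mult_nonneg_nonneg zero_le_power sum_nonneg)
  next
    case False
    then show ?thesis using r by simp
  qed
qed

section \<open>Finiteness, additivity and polynomial domination of the counts\<close>

context poisson_basis
begin

text \<open>One null set for all rectangles at once: where the count on \<open>(0, T] x U\<close> is
  finite, every count on a smaller rectangle is finite too, and additivity of \<open>measure\<close>
  holds for all of them.\<close>

definition good :: "'z set \<Rightarrow> 'w \<Rightarrow> bool" where
  "good U \<omega> \<longleftrightarrow> \<omega> \<in> space M \<and> emeasure (\<mu> \<omega>) ({0<..T} \<times> U) < \<infinity>"

lemma AE_good: "U \<in> sets \<nu> \<Longrightarrow> emeasure \<nu> U < \<infinity> \<Longrightarrow> AE \<omega> in M. good U \<omega>"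
  using AE_mu_nat[of 0 T U] T_pos AE_space
  by (auto simp: good_def elim!: eventually_elim2) (auto simp: less_top[symmetric])

context
  fixes U \<omega> assumes U: "U \<in> sets \<nu>" and gd: "good U \<omega>"
begin

lemma sets_mu: "0 \<le> u \<Longrightarrow> v \<le> T \<Longrightarrow> A \<in> sets \<nu> \<Longrightarrow> {u<..v} \<times> A \<in> sets (\<mu> \<omega>)"
  using prm_conjs[THEN conjunct1] gd sets_intensity by (auto simp: good_def)

lemma emeasure_mu_finite:
  assumes "0 \<le> u" "v \<le> T" "A \<in> sets \<nu>" "A \<subseteq> U"
  shows "emeasure (\<mu> \<omega>) ({u<..v} \<times> A) \<noteq> \<infinity>"
proof -
  have "emeasure (\<mu> \<omega>) ({u<..v} \<times> A) \<le> emeasure (\<mu> \<omega>) ({0<..T} \<times> U)"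
    using assms sets_mu[of 0 T U] U by (intro emeasure_mono) auto
  then show ?thesis using gd by (auto simp: good_def top_unique)
qed

lemma N_mono:
  assumes "0 \<le> u" "v \<le> T" "A \<in> sets \<nu>" "A \<subseteq> U"
  shows "N u v A \<omega> \<le> N 0 T U \<omega>"
  unfolding N_def using assms U sets_mu[of u v A] sets_mu[of 0 T U] emeasure_mu_finite[of 0 T U]
  by (intro measure_mono_fmeasurable) (auto simp: fmeasurable_def less_top)

lemma N_add_time:
  assumes "0 \<le> u" "u \<le> v" "v \<le> w" "w \<le> T" "A \<in> sets \<nu>" "A \<subseteq> U"
  shows "N u w A \<omega> = N u v A \<omega> + N v w A \<omega>"
proof -
  have "{u<..w} \<times> A = {u<..v} \<times> A \<union> {v<..w} \<times> A" using assms by auto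
  then show ?thesis unfolding N_def
    using assms sets_mu emeasure_mu_finite by (auto intro!: measure_Union)
qed

lemma N_UN:
  assumes "0 \<le> u" "v \<le> T" "finite J" "\<And>j. j \<in> J \<Longrightarrow> B j \<in> sets \<nu>" "disjoint_family_on B J" "(\<Union>j\<in>J. B j) \<subseteq> U"
  shows "N u v (\<Union>j\<in>J. B j) \<omega> = (\<Sum>j\<in>J. N u v (B j) \<omega>)"
proof -
  have "{u<..v} \<times> (\<Union>j\<in>J. B j) = (\<Union>j\<in>J. {u<..v} \<times> B j)" by auto
  then show ?thesis unfolding N_def
  proof (simp only:, intro measure_finite_Union)
    show "disjoint_family_on (\<lambda>j. {u<..v} \<times> B j) J"
      using assms(5) unfolding disjoint_family_on_def by blast
    show "emeasure (\<mu> \<omega>) ({u<..v} \<times> B j) \<noteq> \<infinity>" if "j \<in> J" for j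
      using assms that by (intro emeasure_mu_finite) auto
  qed (use assms in \<open>auto intro: sets_mu\<close>)
qed

end

text \<open>
  All random variables that occur for elementary integrands are polynomially bounded by the number
  of points in a set of finite intensity, so that all their products are integrable.
\<close>

definition dominated :: "'z set \<Rightarrow> ('w \<Rightarrow> real) \<Rightarrow> bool" where
  "dominated U f \<longleftrightarrow> f \<in> borel_measurable M \<and> (\<exists>K m. AE \<omega> in M. \<bar>f \<omega>\<bar> \<le> K * (1 + N 0 T U \<omega>) ^ m)"

lemma dominatedE:
  assumes "dominated U f"
  obtains K m where "1 \<le> K" "AE \<omega> in M. \<bar>f \<omega>\<bar> \<le> K * (1 + N 0 T U \<omega>) ^ m"
proof -
  from assms obtain K m where K: "AE \<omega> in M. \<bar>f \<omega>\<bar> \<le> K * (1 + N 0 T U \<omega>) ^ m"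
    by (auto simp: dominated_def)
  show ?thesis
  proof (rule that[of "max 1 K" m])
    show "AE \<omega> in M. \<bar>f \<omega>\<bar> \<le> max 1 K * (1 + N 0 T U \<omega>) ^ m"
      using K
    proof eventually_elim
      case (elim \<omega>)
      also have "K * (1 + N 0 T U \<omega>) ^ m \<le> max 1 K * (1 + N 0 T U \<omega>) ^ m"
        by (intro mult_right_mono) auto
      finally show ?case .
    qed
  qed simp
qed

lemma dominated_bounded:
  assumes "f \<in> borel_measurable M" "AE \<omega> in M. \<bar>f \<omega>\<bar> \<le> K"
  shows "dominated U f"
  unfolding dominated_def using assms by (intro conjI exI[of _ K] exI[of _ 0]) simp_all

lemma dominated_add:
  assumes f: "dominated U f" and g: "dominated U g"
  shows "dominated U (\<lambda>\<omega>. f \<omega> + g \<omega>)"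
proof -
  obtain K m where K: "1 \<le> K" "AE \<omega> in M. \<bar>f \<omega>\<bar> \<le> K * (1 + N 0 T U \<omega>) ^ m"
    using f by (rule dominatedE)
  obtain L n where L: "1 \<le> L" "AE \<omega> in M. \<bar>g \<omega>\<bar> \<le> L * (1 + N 0 T U \<omega>) ^ n"
    using g by (rule dominatedE)
  have "AE \<omega> in M. \<bar>f \<omega> + g \<omega>\<bar> \<le> (K + L) * (1 + N 0 T U \<omega>) ^ (m + n)"
    using K(2) L(2)
  proof eventually_elim
    case (elim \<omega>)
    have "K * (1 + N 0 T U \<omega>) ^ m \<le> K * (1 + N 0 T U \<omega>) ^ (m + n)"
      "L * (1 + N 0 T U \<omega>) ^ n \<le> L * (1 + N 0 T U \<omega>) ^ (m + n)"
      using K L by (auto intro!: mult_left_mono power_increasing)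
    then show ?case using elim by (simp add: distrib_right)
  qed
  then show ?thesis using f g by (auto simp: dominated_def)
qed

lemma dominated_mult:
  assumes f: "dominated U f" and g: "dominated U g"
  shows "dominated U (\<lambda>\<omega>. f \<omega> * g \<omega>)"
proof -
  obtain K m where K: "1 \<le> K" "AE \<omega> in M. \<bar>f \<omega>\<bar> \<le> K * (1 + N 0 T U \<omega>) ^ m"
    using f by (rule dominatedE)
  obtain L n where L: "1 \<le> L" "AE \<omega> in M. \<bar>g \<omega>\<bar> \<le> L * (1 + N 0 T U \<omega>) ^ n"
    using g by (rule dominatedE)
  have "AE \<omega> in M. \<bar>f \<omega> * g \<omega>\<bar> \<le> (K * L) * (1 + N 0 T U \<omega>) ^ (m + n)"
    using K(2) L(2)
  proof eventually_elim
    case (elim \<omega>)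
    then have "\<bar>f \<omega>\<bar> * \<bar>g \<omega>\<bar> \<le> (K * (1 + N 0 T U \<omega>) ^ m) * (L * (1 + N 0 T U \<omega>) ^ n)"
      by (intro mult_mono) auto
    then show ?case by (simp add: abs_mult power_add mult_ac)
  qed
  then show ?thesis using f g by (auto simp: dominated_def)
qed

lemma dominated_const: "dominated U (\<lambda>_. c)"
  by (rule dominated_bounded[where K="\<bar>c\<bar>"]) auto

lemma dominated_minus: "dominated U f \<Longrightarrow> dominated U g \<Longrightarrow> dominated U (\<lambda>\<omega>. f \<omega> - g \<omega>)"
  using dominated_add[of U f "\<lambda>\<omega>. - 1 * g \<omega>"] dominated_mult[OF dominated_const[of U "- 1"], of g] by simp

lemma dominated_sum: "(\<And>i. i \<in> I \<Longrightarrow> dominated U (f i)) \<Longrightarrow> dominated U (\<lambda>\<omega>. \<Sum>i\<in>I. f i \<omega>)"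
  by (induction I rule: infinite_finite_induct) (auto intro: dominated_const dominated_add)

lemma dominated_abs_powr:
  assumes f: "dominated U f" and q: "0 \<le> q"
  shows "dominated U (\<lambda>\<omega>. \<bar>f \<omega>\<bar> powr q)"
proof -
  obtain K m where K: "1 \<le> K" "AE \<omega> in M. \<bar>f \<omega>\<bar> \<le> K * (1 + N 0 T U \<omega>) ^ m"
    using f by (rule dominatedE)
  define n where "n = nat \<lceil>q\<rceil>"
  have n: "q \<le> real n" by (simp add: n_def real_nat_ceiling_ge)
  have "AE \<omega> in M. \<bar>\<bar>f \<omega>\<bar> powr q\<bar> \<le> K ^ n * (1 + N 0 T U \<omega>) ^ (m * n)"
    using K(2)
  proof eventually_elim
    case (elim \<omega>)
    have g: "1 \<le> K * (1 + N 0 T U \<omega>) ^ m"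
      using mult_mono[of 1 K 1 "(1 + N 0 T U \<omega>) ^ m"] K by (simp add: one_le_power)
    have "\<bar>f \<omega>\<bar> powr q \<le> (K * (1 + N 0 T U \<omega>) ^ m) powr q"
      using elim q by (intro powr_mono2) auto
    also have "\<dots> \<le> (K * (1 + N 0 T U \<omega>) ^ m) powr real n"
      using g n by (intro powr_mono) auto
    also have "\<dots> = K ^ n * (1 + N 0 T U \<omega>) ^ (m * n)"
      using g by (subst powr_realpow) (auto simp: power_mult_distrib power_mult)
    finally show ?case by simp
  qed
  then show ?thesis using f by (auto simp: dominated_def)
qed

lemma dominated_N:
  assumes "U \<in> sets \<nu>" "emeasure \<nu> U < \<infinity>" "0 \<le> u" "v \<le> T" "A \<in> sets \<nu>" "A \<subseteq> U"
  shows "dominated U (N u v A)"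
  unfolding dominated_def
proof (intro conjI exI)
  show "N u v A \<in> borel_measurable M" using assms by measurable
  show "AE \<omega> in M. \<bar>N u v A \<omega>\<bar> \<le> 1 * (1 + N 0 T U \<omega>) ^ 1"
    using AE_good[OF assms(1,2)]
  proof eventually_elim
    case (elim \<omega>)
    then show ?case using N_mono[OF assms(1) elim assms(3-6)] by simp
  qed
qed

text \<open>The binomial expansion turns the dominating polynomial into powers of one Poisson count,
  all of which have finite expectation.\<close>

lemma dominated_integrable:
  assumes U: "U \<in> sets \<nu>" "emeasure \<nu> U < \<infinity>" and f: "dominated U f"
  shows "integrable M f"
proof -
  obtain K m where K: "1 \<le> K" "AE \<omega> in M. \<bar>f \<omega>\<bar> \<le> K * (1 + N 0 T U \<omega>) ^ m"
    using f by (rule dominatedE)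
  have "integrable M (\<lambda>\<omega>. K * (\<Sum>k\<le>m. of_nat (m choose k) * 1 ^ k * N 0 T U \<omega> ^ (m - k)))"
    using U T_pos integrable_N_power[of 0 T U]
    by (intro integrable_mult_right integrable_sum) auto
  then have "integrable M (\<lambda>\<omega>. K * (1 + N 0 T U \<omega>) ^ m)"
    by (simp add: binomial_ring)
  then show ?thesis
    by (rule Bochner_Integration.integrable_bound) (use f K in \<open>auto simp: dominated_def\<close>)
qed

section \<open>A single time step with disjoint mark sets and coefficients known at its
  start\<close>

context
  fixes u v :: real and J :: "'j set" and B :: "'j \<Rightarrow> 'z set" and c :: "'j \<Rightarrow> 'w \<Rightarrow> real" and C :: real
    and U :: "'z set"
  assumes uv: "0 \<le> u" "u \<le> v" "v \<le> T"
    and U: "U \<in> sets \<nu>" "emeasure \<nu> U < \<infinity>"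
    and J: "finite J" and B: "\<And>j. j \<in> J \<Longrightarrow> B j \<in> sets \<nu>" "disjoint_family_on B J" "(\<Union>j\<in>J. B j) = U"
    and c: "\<And>j. j \<in> J \<Longrightarrow> c j \<in> borel_measurable (F u)"
      "\<And>j \<omega>. j \<in> J \<Longrightarrow> \<omega> \<in> space M \<Longrightarrow> \<bar>c j \<omega>\<bar> \<le> C" and C: "0 \<le> C"
begin

lemma piece: "j \<in> J \<Longrightarrow> B j \<subseteq> U" "j \<in> J \<Longrightarrow> emeasure \<nu> (B j) < \<infinity>"
proof -
  show "j \<in> J \<Longrightarrow> B j \<subseteq> U" using B by auto
  then show "j \<in> J \<Longrightarrow> emeasure \<nu> (B j) < \<infinity>"
    using U by (meson emeasure_mono order_le_less_trans)
qed

lemma measure_U: "measure \<nu> U = (\<Sum>j\<in>J. measure \<nu> (B j))"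
  unfolding B(3)[symmetric] using J B piece by (intro measure_finite_Union) (auto simp: less_top)

text \<open>The compensated sum is split into the sum over points and the compensator. The latter is
  at most \<open>C * lam u v U\<close> in absolute value, and its power \<open>r\<close> is a
  quadratic error as well, because \<open>lam u v U <= 1\<close> and \<open>r >= 2\<close>.\<close>

lemma compensated_sum_powr_le:
  assumes r: "2 \<le> r" "r \<le> real m" and small: "lam u v U \<le> 1"
  shows "AE \<omega> in M. \<bar>\<Sum>j\<in>J. c j \<omega> * (N u v (B j) \<omega> - lam u v (B j))\<bar> powr r \<le>
    2 powr r * ((\<Sum>j\<in>J. \<bar>c j \<omega>\<bar> powr r * N u v (B j) \<omega>) +
      C powr r * (N u v U \<omega> ^ m * indicator {2..} (N u v U \<omega>)) + C powr r * (lam u v U)\<^sup>2)"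
proof -
  have "AE \<omega> in M. \<forall>j\<in>J. \<exists>k::nat. emeasure (\<mu> \<omega>) ({u<..v} \<times> B j) = of_nat k"
    using J B piece by (auto intro!: AE_finite_allI AE_mu_nat uv)
  then show ?thesis using AE_good[OF U] AE_space
  proof eventually_elim
    case (elim \<omega>)
    have "\<forall>j\<in>J. \<exists>k::nat. N u v (B j) \<omega> = real k"
      using elim(1) by (auto simp: N_def measure_def)
    then obtain n :: "'j \<Rightarrow> nat" where n: "\<And>j. j \<in> J \<Longrightarrow> N u v (B j) \<omega> = real (n j)"
      by metis
    have NU: "N u v U \<omega> = real (\<Sum>j\<in>J. n j)"
      using N_UN[OF U(1) elim(2), of u v J B] uv J B n by simp
    have 1: "\<bar>\<Sum>j\<in>J. c j \<omega> * real (n j)\<bar> powr r \<le>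
      (\<Sum>j\<in>J. \<bar>c j \<omega>\<bar> powr r * real (n j)) + C powr r * (real (\<Sum>j\<in>J. n j) ^ m * indicator {2..} (real (\<Sum>j\<in>J. n j)))"
      using J r c C elim by (intro abs_sum_powr_le_of_nat) auto
    have 2: "\<bar>- (\<Sum>j\<in>J. c j \<omega> * lam u v (B j))\<bar> powr r \<le> C powr r * (lam u v U)\<^sup>2"
    proof -
      have "\<bar>\<Sum>j\<in>J. c j \<omega> * lam u v (B j)\<bar> \<le> (\<Sum>j\<in>J. C * lam u v (B j))"
        using c elim lam_nonneg[OF uv(2)]
        by (intro order_trans[OF sum_abs] sum_mono) (auto simp: abs_mult intro!: mult_right_mono)
      also have "\<dots> = C * lam u v U"
        by (simp add: lam_def measure_U sum_distrib_left mult_ac)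
      finally have "\<bar>\<Sum>j\<in>J. c j \<omega> * lam u v (B j)\<bar> powr r \<le> (C * lam u v U) powr r"
        using r by (intro powr_mono2) auto
      also have "\<dots> = C powr r * (lam u v U powr r)"
        by (simp add: powr_mult)
      also have "\<dots> \<le> C powr r * (lam u v U powr 2)"
        using r small lam_nonneg[OF uv(2), of U] by (intro mult_left_mono powr_mono') auto
      also have "lam u v U powr 2 = (lam u v U)\<^sup>2"
        using lam_nonneg[OF uv(2), of U] by (simp add: powr_numeral)
      finally show ?thesis by simp
    qed
    have "(\<Sum>j\<in>J. c j \<omega> * (N u v (B j) \<omega> - lam u v (B j))) =
      (\<Sum>j\<in>J. c j \<omega> * real (n j)) + (- (\<Sum>j\<in>J. c j \<omega> * lam u v (B j)))"
      using n by (simp add: algebra_simps sum_subtractf)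
    also have "\<bar>\<dots>\<bar> powr r \<le> 2 powr r * (\<bar>\<Sum>j\<in>J. c j \<omega> * real (n j)\<bar> powr r + \<bar>- (\<Sum>j\<in>J. c j \<omega> * lam u v (B j))\<bar> powr r)"
      using r by (intro abs_add_powr_le_two_powr) auto
    also have "\<dots> \<le> 2 powr r * ((\<Sum>j\<in>J. \<bar>c j \<omega>\<bar> powr r * real (n j)) + C powr r * (real (\<Sum>j\<in>J. n j) ^ m * indicator {2..} (real (\<Sum>j\<in>J. n j))) + C powr r * (lam u v U)\<^sup>2)"
      using 1 2 by (intro mult_left_mono add_mono) auto
    finally show ?case unfolding NU using n by simp
  qed
qed

text \<open>The weight and the coefficients are known at time \<open>u\<close>, so the counts factor
  out. The one-point term then yields the compensator, linear in \<open>v - u\<close>; everything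
  else carries \<open>(lam u v U)\<^sup>2\<close>. The lemma is applied with \<open>r = 2\<close>
  and weight \<open>|X| powr (p - 2)\<close>, and with \<open>r = p\<close> and weight 1.\<close>

lemma nn_integral_compensated_sum_le:
  assumes r: "2 \<le> r" "r \<le> real m" and small: "lam u v U \<le> 1"
    and W: "W \<in> borel_measurable (F u)"
  shows "(\<integral>\<^sup>+\<omega>. W \<omega> * ennreal (\<bar>\<Sum>j\<in>J. c j \<omega> * (N u v (B j) \<omega> - lam u v (B j))\<bar> powr r) \<partial>M) \<le>
    ennreal (2 powr r) * (ennreal (v - u) * (\<integral>\<^sup>+\<omega>. W \<omega> * ennreal (\<Sum>j\<in>J. \<bar>c j \<omega>\<bar> powr r * measure \<nu> (B j)) \<partial>M) +
      ennreal (C powr r * (fact m * exp (exp 1) + 1) * (lam u v U)\<^sup>2) * (\<integral>\<^sup>+\<omega>. W \<omega> \<partial>M))"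
proof -
  have u: "0 \<le> u" "u \<le> T" using uv by auto
  note [measurable] = F_measurable_M[OF u W] F_measurable_M[OF u c(1)]
  have [measurable]: "j \<in> J \<Longrightarrow> N u v (B j) \<in> borel_measurable M" for j using uv B by measurable
  have [measurable]: "N u v U \<in> borel_measurable M" using uv U by measurable
  let ?t = "\<lambda>\<omega>. ennreal (N u v U \<omega> ^ m * indicator {2..} (N u v U \<omega>))"
  have "(\<integral>\<^sup>+\<omega>. W \<omega> * ennreal (\<bar>\<Sum>j\<in>J. c j \<omega> * (N u v (B j) \<omega> - lam u v (B j))\<bar> powr r) \<partial>M) \<le>
    (\<integral>\<^sup>+\<omega>. ennreal (2 powr r) * ((\<Sum>j\<in>J. (W \<omega> * ennreal (\<bar>c j \<omega>\<bar> powr r)) * ennreal (N u v (B j) \<omega>)) +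
      ennreal (C powr r) * (W \<omega> * ?t \<omega>) + ennreal (C powr r * (lam u v U)\<^sup>2) * W \<omega>) \<partial>M)"
  proof (rule nn_integral_mono_AE)
    show "AE \<omega> in M. W \<omega> * ennreal (\<bar>\<Sum>j\<in>J. c j \<omega> * (N u v (B j) \<omega> - lam u v (B j))\<bar> powr r) \<le>
       ennreal (2 powr r) * ((\<Sum>j\<in>J. (W \<omega> * ennreal (\<bar>c j \<omega>\<bar> powr r)) * ennreal (N u v (B j) \<omega>)) +
      ennreal (C powr r) * (W \<omega> * ?t \<omega>) + ennreal (C powr r * (lam u v U)\<^sup>2) * W \<omega>)"
      using compensated_sum_powr_le[OF r small]
    proof eventually_elim
      case (elim \<omega>)
      let ?s = "\<Sum>j\<in>J. \<bar>c j \<omega>\<bar> powr r * N u v (B j) \<omega>"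
      have "W \<omega> * ennreal (\<bar>\<Sum>j\<in>J. c j \<omega> * (N u v (B j) \<omega> - lam u v (B j))\<bar> powr r) \<le>
        W \<omega> * ennreal (2 powr r * (?s + C powr r * (N u v U \<omega> ^ m * indicator {2..} (N u v U \<omega>)) + C powr r * (lam u v U)\<^sup>2))"
        using elim by (intro mult_left_mono ennreal_leI) auto
      also have "\<dots> = ennreal (2 powr r) * (W \<omega> * ennreal ?s +
        ennreal (C powr r) * (W \<omega> * ?t \<omega>) + ennreal (C powr r * (lam u v U)\<^sup>2) * W \<omega>)"
        by (simp add: ennreal_mult' ennreal_plus sum_nonneg distrib_left mult_ac)
      also have "ennreal ?s = (\<Sum>j\<in>J. ennreal (\<bar>c j \<omega>\<bar> powr r) * ennreal (N u v (B j) \<omega>))"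
        by (simp add: ennreal_mult' flip: sum_ennreal)
      finally show ?case by (simp add: sum_distrib_left mult_ac)
    qed
  qed
  also have "\<dots> = ennreal (2 powr r) * ((\<Sum>j\<in>J. \<integral>\<^sup>+\<omega>. (W \<omega> * ennreal (\<bar>c j \<omega>\<bar> powr r)) * ennreal (N u v (B j) \<omega>) \<partial>M) +
      ennreal (C powr r) * (\<integral>\<^sup>+\<omega>. W \<omega> * ?t \<omega> \<partial>M) + ennreal (C powr r * (lam u v U)\<^sup>2) * (\<integral>\<^sup>+\<omega>. W \<omega> \<partial>M))"
    by (simp add: nn_integral_cmult nn_integral_add nn_integral_sum)
  also have "(\<Sum>j\<in>J. \<integral>\<^sup>+\<omega>. (W \<omega> * ennreal (\<bar>c j \<omega>\<bar> powr r)) * ennreal (N u v (B j) \<omega>) \<partial>M) =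
    (\<Sum>j\<in>J. (\<integral>\<^sup>+\<omega>. W \<omega> * ennreal (\<bar>c j \<omega>\<bar> powr r) \<partial>M) * ennreal (lam u v (B j)))"
  proof (rule sum.cong)
    fix j assume j: "j \<in> J"
    note [measurable] = W c(1)[OF j]
    have "(\<lambda>\<omega>. W \<omega> * ennreal (\<bar>c j \<omega>\<bar> powr r)) \<in> borel_measurable (F u)" by measurable
    from nn_integral_mult_N[OF uv B(1)[OF j] piece(2)[OF j] this, of ennreal]
    show "(\<integral>\<^sup>+\<omega>. (W \<omega> * ennreal (\<bar>c j \<omega>\<bar> powr r)) * ennreal (N u v (B j) \<omega>) \<partial>M) =
     (\<integral>\<^sup>+\<omega>. W \<omega> * ennreal (\<bar>c j \<omega>\<bar> powr r) \<partial>M) * ennreal (lam u v (B j))"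
      by (simp add: nn_integral_N_1[OF uv B(1)[OF j] piece(2)[OF j]])
  qed simp
  also have "\<dots> = ennreal (v - u) * (\<integral>\<^sup>+\<omega>. W \<omega> * ennreal (\<Sum>j\<in>J. \<bar>c j \<omega>\<bar> powr r * measure \<nu> (B j)) \<partial>M)"
  proof -
    have "(\<integral>\<^sup>+\<omega>. W \<omega> * ennreal (\<Sum>j\<in>J. \<bar>c j \<omega>\<bar> powr r * measure \<nu> (B j)) \<partial>M) =
      (\<integral>\<^sup>+\<omega>. (\<Sum>j\<in>J. (W \<omega> * ennreal (\<bar>c j \<omega>\<bar> powr r)) * ennreal (measure \<nu> (B j))) \<partial>M)"
      by (simp add: ennreal_mult' sum_distrib_left mult_ac flip: sum_ennreal)
    also have "\<dots> = (\<Sum>j\<in>J. (\<integral>\<^sup>+\<omega>. W \<omega> * ennreal (\<bar>c j \<omega>\<bar> powr r) \<partial>M) * ennreal (measure \<nu> (B j)))"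
      by (simp add: nn_integral_sum nn_integral_multc)
    finally show ?thesis
      using uv by (simp add: lam_def ennreal_mult' sum_distrib_left mult_ac)
  qed
  also have "(\<integral>\<^sup>+\<omega>. W \<omega> * ?t \<omega> \<partial>M) = (\<integral>\<^sup>+\<omega>. W \<omega> \<partial>M) * (\<integral>\<^sup>+\<omega>. ?t \<omega> \<partial>M)"
    by (rule nn_integral_mult_N[OF uv U W]) measurable
  also have "ennreal (C powr r) * \<dots> \<le> ennreal (C powr r) * ((\<integral>\<^sup>+\<omega>. W \<omega> \<partial>M) * ennreal (fact m * exp (exp 1) * (lam u v U)\<^sup>2))"
    using nn_integral_N_tail[OF uv U small] by (intro mult_left_mono) auto
  finally have "(\<integral>\<^sup>+\<omega>. W \<omega> * ennreal (\<bar>\<Sum>j\<in>J. c j \<omega> * (N u v (B j) \<omega> - lam u v (B j))\<bar> powr r) \<partial>M) \<le>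
    ennreal (2 powr r) * (ennreal (v - u) * (\<integral>\<^sup>+\<omega>. W \<omega> * ennreal (\<Sum>j\<in>J. \<bar>c j \<omega>\<bar> powr r * measure \<nu> (B j)) \<partial>M) +
     ennreal (C powr r) * ((\<integral>\<^sup>+\<omega>. W \<omega> \<partial>M) * ennreal (fact m * exp (exp 1) * (lam u v U)\<^sup>2)) +
     ennreal (C powr r * (lam u v U)\<^sup>2) * (\<integral>\<^sup>+\<omega>. W \<omega> \<partial>M))"
    by (simp add: mult_left_mono add_mono)
  also have "ennreal (C powr r * (lam u v U)\<^sup>2) = ennreal (C powr r) * ennreal ((lam u v U)\<^sup>2)"
    by (simp add: ennreal_mult')
  finally show ?thesis
    by (simp add: ennreal_mult' ennreal_plus distrib_left distrib_right mult_ac add_ac)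
qed


text \<open>The pointwise second-order expansion is integrated. Its linear term is
  \<open>G * b\<close> with \<open>G = X * |X| powr (p - 2)\<close>; since each
  \<open>G * c j\<close> is known at time \<open>u\<close>, it has expectation zero. Domination
  makes all terms integrable, so that real expectations may be used. \<open>U'\<close> is larger
  than \<open>U\<close> because \<open>X\<close> depends on points that fell earlier into other mark
  sets.\<close>

lemma one_step_powr_le:
  fixes X :: "'w \<Rightarrow> real"
  assumes p: "2 \<le> p" "p \<le> real m" and small: "lam u v U \<le> 1"
    and X: "X \<in> borel_measurable (F u)" "dominated U' X"
    and U': "U' \<in> sets \<nu>" "emeasure \<nu> U' < \<infinity>" "U \<subseteq> U'"
    and Cp: "0 \<le> Cp" "\<And>a b::real. \<bar>a + b\<bar> powr p \<le>
      \<bar>a\<bar> powr p + p * (a * \<bar>a\<bar> powr (p - 2)) * b + Cp * (\<bar>a\<bar> powr (p - 2) * b\<^sup>2 + \<bar>b\<bar> powr p)"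
  defines "b \<equiv> \<lambda>\<omega>. \<Sum>j\<in>J. c j \<omega> * (N u v (B j) \<omega> - lam u v (B j))"
  shows "(\<integral>\<^sup>+\<omega>. ennreal (\<bar>X \<omega> + b \<omega>\<bar> powr p) \<partial>M) \<le> (\<integral>\<^sup>+\<omega>. ennreal (\<bar>X \<omega>\<bar> powr p) \<partial>M) +
    ennreal Cp * ((\<integral>\<^sup>+\<omega>. ennreal (\<bar>X \<omega>\<bar> powr (p - 2)) * ennreal (\<bar>b \<omega>\<bar> powr 2) \<partial>M) + (\<integral>\<^sup>+\<omega>. ennreal (\<bar>b \<omega>\<bar> powr p) \<partial>M))"
proof -
  have u: "0 \<le> u" "u \<le> T" using uv by auto
  have cd: "dominated U' (c j)" if "j \<in> J" for j
    using c[OF that] F_measurable_M[OF u c(1)[OF that]] by (intro dominated_bounded[where K=C]) auto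
  have Nd: "dominated U' (\<lambda>\<omega>. N u v (B j) \<omega> - lam u v (B j))" if "j \<in> J" for j
    using that B piece U' uv by (intro dominated_minus dominated_const dominated_N) auto
  have bd: "dominated U' b"
    unfolding b_def by (intro dominated_sum dominated_mult cd Nd)
  define G where "G \<omega> = X \<omega> * \<bar>X \<omega>\<bar> powr (p - 2)" for \<omega>
  have Gd: "dominated U' G"
    unfolding G_def using p by (intro dominated_mult X dominated_abs_powr) auto
  note int = dominated_integrable[OF U'(1,2)]
  have "expectation (\<lambda>\<omega>. G \<omega> * b \<omega>) = (\<Sum>j\<in>J. expectation (\<lambda>\<omega>. (G \<omega> * c j \<omega>) * (N u v (B j) \<omega> - lam u v (B j))))"
    unfolding b_def sum_distrib_left mult.assoc
    by (intro Bochner_Integration.integral_sum int dominated_mult Gd cd Nd)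
  also have "\<dots> = 0"
  proof (intro sum.neutral ballI)
    fix j assume j: "j \<in> J"
    note [measurable] = X(1) c(1)[OF j]
    have "(\<lambda>\<omega>. G \<omega> * c j \<omega>) \<in> borel_measurable (F u)" unfolding G_def by measurable
    then show "expectation (\<lambda>\<omega>. (G \<omega> * c j \<omega>) * (N u v (B j) \<omega> - lam u v (B j))) = 0"
      using int[OF dominated_mult[OF Gd cd[OF j]]]
      by (rule expectation_mult_compensated_N[OF uv B(1)[OF j] piece(2)[OF j]])
  qed
  finally have zero: "expectation (\<lambda>\<omega>. G \<omega> * b \<omega>) = 0" .
  have i0: "integrable M (\<lambda>\<omega>. \<bar>X \<omega> + b \<omega>\<bar> powr p)"
    using p by (intro int dominated_abs_powr dominated_add X bd) auto
  have i1: "integrable M (\<lambda>\<omega>. \<bar>X \<omega>\<bar> powr p)" "integrable M (\<lambda>\<omega>. \<bar>b \<omega>\<bar> powr p)"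
    using p by (auto intro!: int dominated_abs_powr X bd)
  have i2: "integrable M (\<lambda>\<omega>. G \<omega> * b \<omega>)" by (intro int dominated_mult Gd bd)
  have i3: "integrable M (\<lambda>\<omega>. \<bar>X \<omega>\<bar> powr (p - 2) * (b \<omega>)\<^sup>2)"
    unfolding power2_eq_square using p by (intro int dominated_abs_powr dominated_mult X bd) auto
  have "expectation (\<lambda>\<omega>. \<bar>X \<omega> + b \<omega>\<bar> powr p) \<le>
    expectation (\<lambda>\<omega>. \<bar>X \<omega>\<bar> powr p + p * (G \<omega> * b \<omega>) + Cp * (\<bar>X \<omega>\<bar> powr (p - 2) * (b \<omega>)\<^sup>2 + \<bar>b \<omega>\<bar> powr p))"
    using Cp(2) by (intro integral_mono i0 i1 i2 i3 Bochner_Integration.integrable_add integrable_mult_right) (simp add: G_def mult.assoc)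
  also have "\<dots> = expectation (\<lambda>\<omega>. \<bar>X \<omega>\<bar> powr p) + Cp * (expectation (\<lambda>\<omega>. \<bar>X \<omega>\<bar> powr (p - 2) * (b \<omega>)\<^sup>2) + expectation (\<lambda>\<omega>. \<bar>b \<omega>\<bar> powr p))"
    using i1 i2 i3 zero by simp
  finally have *: "expectation (\<lambda>\<omega>. \<bar>X \<omega> + b \<omega>\<bar> powr p) \<le> \<dots>" .
  have "(\<integral>\<^sup>+\<omega>. ennreal (\<bar>X \<omega>\<bar> powr (p - 2)) * ennreal (\<bar>b \<omega>\<bar> powr 2) \<partial>M) =
    (\<integral>\<^sup>+\<omega>. ennreal (\<bar>X \<omega>\<bar> powr (p - 2) * (b \<omega>)\<^sup>2) \<partial>M)"
    by (intro nn_integral_cong) (simp add: ennreal_mult')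
  then show ?thesis
    using * Cp(1)
    by (simp add: nn_integral_eq_integral i0 i1 i3 ennreal_leI integral_nonneg_AE flip: ennreal_plus ennreal_mult)
qed

text \<open>The weighted quadratic term is separated by \<open>powr_mult_le_add_powr\<close>, and
  the same inequality with \<open>q = 1\<close> bounds the expectation of
  \<open>|X| powr (p - 2)\<close> by \<open>Y + 1\<close>. What matters is which constant multiplies
  what: the coefficients linear in \<open>v - u\<close> involve only \<open>p\<close> and
  \<open>Cp\<close>, while \<open>K\<close>, which depends on the bound \<open>C\<close> and on the
  mass of \<open>U\<close>, multiplies only the square.\<close>

lemma one_step_le:
  fixes X :: "'w \<Rightarrow> real"
  assumes p: "2 \<le> p" "p \<le> real m" and small: "lam u v U \<le> 1"
    and X: "X \<in> borel_measurable (F u)" "dominated U' X"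
    and U': "U' \<in> sets \<nu>" "emeasure \<nu> U' < \<infinity>" "U \<subseteq> U'"
    and Cp: "0 \<le> Cp" "\<And>a b::real. \<bar>a + b\<bar> powr p \<le>
      \<bar>a\<bar> powr p + p * (a * \<bar>a\<bar> powr (p - 2)) * b + Cp * (\<bar>a\<bar> powr (p - 2) * b\<^sup>2 + \<bar>b\<bar> powr p)"
  defines "K \<equiv> Cp * 2 powr p * (C powr 2 + C powr p) * (fact m * exp (exp 1) + 1) * (measure \<nu> U)\<^sup>2"
  defines "V \<equiv> \<integral>\<^sup>+\<omega>. ennreal ((\<Sum>j\<in>J. \<bar>c j \<omega>\<bar> powr 2 * measure \<nu> (B j)) powr (p / 2) + (\<Sum>j\<in>J. \<bar>c j \<omega>\<bar> powr p * measure \<nu> (B j))) \<partial>M"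
  defines "Y \<equiv> \<integral>\<^sup>+\<omega>. ennreal (\<bar>X \<omega>\<bar> powr p) \<partial>M"
  shows "(\<integral>\<^sup>+\<omega>. ennreal (\<bar>X \<omega> + (\<Sum>j\<in>J. c j \<omega> * (N u v (B j) \<omega> - lam u v (B j)))\<bar> powr p) \<partial>M) \<le>
    ennreal (1 + Cp * 2 powr p * (v - u) + K * (v - u)\<^sup>2) * Y + ennreal (Cp * 2 powr p * (v - u)) * V + ennreal (K * (v - u)\<^sup>2)"
proof -
  have u: "0 \<le> u" "u \<le> T" using uv by auto
  note [measurable] = X(1) F_measurable_M[OF u X(1)] F_measurable_M[OF u c(1)]
  define b where "b = (\<lambda>\<omega>. \<Sum>j\<in>J. c j \<omega> * (N u v (B j) \<omega> - lam u v (B j)))"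
  define h where "h = v - u"
  have h: "0 \<le> h" using uv by (simp add: h_def)
  define D where "D = 2 powr p"
  have D: "0 \<le> D" "2 powr 2 \<le> D" unfolding D_def using p by (simp, intro powr_mono) auto
  define E where "E r = C powr r * (fact m * exp (exp 1) + 1) * (measure \<nu> U)\<^sup>2" for r
  have E: "0 \<le> E r" for r unfolding E_def by (intro mult_nonneg_nonneg add_nonneg_nonneg) auto
  have El: "C powr r * (fact m * exp (exp 1) + 1) * (lam u v U)\<^sup>2 = E r * h\<^sup>2" for r
    by (simp add: E_def lam_def h_def power_mult_distrib)
  have K: "K = Cp * D * (E 2 + E p)" by (simp add: K_def D_def E_def algebra_simps)
  let ?q = "\<lambda>\<omega>. \<Sum>j\<in>J. \<bar>c j \<omega>\<bar> powr 2 * measure \<nu> (B j)"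
  let ?s = "\<lambda>\<omega>. \<Sum>j\<in>J. \<bar>c j \<omega>\<bar> powr p * measure \<nu> (B j)"
  let ?W = "\<lambda>\<omega>. ennreal (\<bar>X \<omega>\<bar> powr (p - 2))"
  have q0: "0 \<le> ?q \<omega>" "0 \<le> ?s \<omega>" for \<omega> by (auto intro!: sum_nonneg)
  have V: "V = (\<integral>\<^sup>+\<omega>. ennreal (?q \<omega> powr (p / 2)) \<partial>M) + (\<integral>\<^sup>+\<omega>. ennreal (?s \<omega>) \<partial>M)"
    unfolding V_def using q0 by (simp add: nn_integral_add)
  have "(\<integral>\<^sup>+\<omega>. ?W \<omega> * ennreal (?q \<omega>) \<partial>M) \<le> (\<integral>\<^sup>+\<omega>. ennreal (\<bar>X \<omega>\<bar> powr p) + ennreal (?q \<omega> powr (p / 2)) \<partial>M)"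
    using powr_mult_le_add_powr[OF p(1) abs_ge_zero q0(1)] q0
    by (intro nn_integral_mono) (simp add: ennreal_leI flip: ennreal_mult ennreal_plus)
  also have "\<dots> = Y + (\<integral>\<^sup>+\<omega>. ennreal (?q \<omega> powr (p / 2)) \<partial>M)"
    unfolding Y_def by (simp add: nn_integral_add)
  finally have 1: "(\<integral>\<^sup>+\<omega>. ?W \<omega> * ennreal (?q \<omega>) \<partial>M) \<le> \<dots>" .
  have "(\<integral>\<^sup>+\<omega>. ?W \<omega> \<partial>M) \<le> (\<integral>\<^sup>+\<omega>. ennreal (\<bar>X \<omega>\<bar> powr p) + 1 \<partial>M)"
    using powr_mult_le_add_powr[OF p(1) abs_ge_zero, of 1] by (intro nn_integral_mono) (simp add: ennreal_leI flip: ennreal_plus ennreal_1)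
  also have "\<dots> = Y + 1" unfolding Y_def by (simp add: nn_integral_add emeasure_space_1)
  finally have 2: "(\<integral>\<^sup>+\<omega>. ?W \<omega> \<partial>M) \<le> Y + 1" .
  have "(\<integral>\<^sup>+\<omega>. ?W \<omega> * ennreal (\<bar>b \<omega>\<bar> powr 2) \<partial>M) \<le> ennreal (2 powr 2) * (ennreal h * (\<integral>\<^sup>+\<omega>. ?W \<omega> * ennreal (?q \<omega>) \<partial>M) +
      ennreal (E 2 * h\<^sup>2) * (\<integral>\<^sup>+\<omega>. ?W \<omega> \<partial>M))"
    using nn_integral_compensated_sum_le[of 2 m ?W] p small unfolding b_def El h_def by simp
  also have "\<dots> \<le> ennreal D * (ennreal h * (Y + (\<integral>\<^sup>+\<omega>. ennreal (?q \<omega> powr (p / 2)) \<partial>M)) + ennreal (E 2 * h\<^sup>2) * (Y + 1))"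
    using 1 2 D E by (intro mult_mono add_mono ennreal_leI order_refl) auto
  finally have 3: "(\<integral>\<^sup>+\<omega>. ?W \<omega> * ennreal (\<bar>b \<omega>\<bar> powr 2) \<partial>M) \<le> \<dots>" .
  have 4: "(\<integral>\<^sup>+\<omega>. ennreal (\<bar>b \<omega>\<bar> powr p) \<partial>M) \<le> ennreal D * (ennreal h * (\<integral>\<^sup>+\<omega>. ennreal (?s \<omega>) \<partial>M) + ennreal (E p * h\<^sup>2))"
    using nn_integral_compensated_sum_le[of p m "\<lambda>_. 1"] p small unfolding b_def El h_def D_def by (simp add: emeasure_space_1)
  have "(\<integral>\<^sup>+\<omega>. ennreal (\<bar>X \<omega> + b \<omega>\<bar> powr p) \<partial>M) \<le> Y + ennreal Cp * ((\<integral>\<^sup>+\<omega>. ?W \<omega> * ennreal (\<bar>b \<omega>\<bar> powr 2) \<partial>M) + (\<integral>\<^sup>+\<omega>. ennreal (\<bar>b \<omega>\<bar> powr p) \<partial>M))"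
    unfolding Y_def b_def by (rule one_step_powr_le[OF p small X U' Cp])
  also have "\<dots> \<le> Y + ennreal Cp * (ennreal D * (ennreal h * (Y + (\<integral>\<^sup>+\<omega>. ennreal (?q \<omega> powr (p / 2)) \<partial>M)) + ennreal (E 2 * h\<^sup>2) * (Y + 1))
      + ennreal D * (ennreal h * (\<integral>\<^sup>+\<omega>. ennreal (?s \<omega>) \<partial>M) + ennreal (E p * h\<^sup>2)))"
    using 3 4 by (intro add_left_mono mult_left_mono add_mono) auto
  also have "\<dots> = Y + ennreal Cp * (ennreal D * (ennreal h * Y + ennreal h * V + ennreal (E 2 * h\<^sup>2) * Y + (ennreal (E 2 * h\<^sup>2) + ennreal (E p * h\<^sup>2))))"
    unfolding V by (simp add: distrib_left algebra_simps)
  also have "\<dots> \<le> Y + ennreal Cp * (ennreal D * (ennreal h * Y + ennreal h * V + (ennreal (E 2 * h\<^sup>2) + ennreal (E p * h\<^sup>2)) * Y + (ennreal (E 2 * h\<^sup>2) + ennreal (E p * h\<^sup>2))))"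
    by (intro add_left_mono mult_left_mono add_right_mono mult_right_mono) auto
  also have "\<dots> = ennreal (1 + Cp * D * h + K * h\<^sup>2) * Y + ennreal (Cp * D * h) * V + ennreal (K * h\<^sup>2)"
    using h D(1) E[of 2] E[of p] Cp(1) unfolding K
    by (simp add: ennreal_mult ennreal_plus distrib_left distrib_right mult_ac add_ac)
  finally show ?thesis by (simp add: b_def h_def D_def)
qed

end

end

section \<open>Moments of elementary integrals\<close>

text \<open>The quadratic error terms disappear when the partition of \<open>{u..v}\<close> is refined.\<close>

lemma gronwall_quadratic_error:
  fixes Y :: "real \<Rightarrow> ennreal" and V :: ennreal and C K d u v :: real
  assumes uv: "u \<le> v" and C: "0 \<le> C" and K: "0 \<le> K" and d: "0 < d"
    and step: "\<And>s t. u \<le> s \<Longrightarrow> s < t \<Longrightarrow> t \<le> v \<Longrightarrow> t - s \<le> d \<Longrightarrow>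
      Y t \<le> ennreal (1 + C * (t - s) + K * (t - s)\<^sup>2) * Y s + ennreal (C * (t - s)) * V + ennreal (K * (t - s)\<^sup>2)"
  shows "Y v \<le> ennreal (exp ((C + 1) * (v - u))) * (Y u + ennreal (C * (v - u)) * V)"
proof (cases "u = v")
  case True
  then show ?thesis by simp
next
  case False
  then have uv: "u < v" using uv by simp
  define k where "k = C + 1"
  have k: "0 \<le> k" using C by (simp add: k_def)
  show ?thesis
  proof (rule ennreal_le_epsilon)
    fix e :: real assume e: "0 < e"
    \<comment> \<open>The accumulated additive error is at most
      \<open>exp (k * (v - u)) * (v - u) * \<epsilon>\<close>, which is \<open>e\<close>. The step
      bound \<open>h0\<close> ensures that steps are admissible, that \<open>K * h <= 1\<close>, so
      the quadratic factor is absorbed by raising the rate from \<open>C\<close> to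
      \<open>C + 1\<close>, and that \<open>K * h <= \<epsilon>\<close>. Writing
      \<open>K + 1\<close> avoids division by zero.\<close>
    define \<epsilon> where "\<epsilon> = e / (exp (k * (v - u)) * (v - u))"
    have \<epsilon>: "0 < \<epsilon>" using e uv by (simp add: \<epsilon>_def)
    define h0 where "h0 = Min {d, 1 / (K + 1), \<epsilon> / (K + 1)}"
    have h0: "0 < h0" using d \<epsilon> K by (simp add: h0_def)
    have "h0 \<le> 1 / (K + 1)" "h0 \<le> \<epsilon> / (K + 1)" by (auto simp: h0_def)
    then have Kh0: "(K + 1) * h0 \<le> 1" "(K + 1) * h0 \<le> \<epsilon>" using K by (auto simp: field_simps)
    obtain n :: nat where n: "(v - u) / h0 < real n" using reals_Archimedean2 by blast
    have n0: "0 < n" using n uv h0 by (auto intro!: gr0I simp: field_simps)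
    define h where "h = (v - u) / real n"
    have h: "0 < h" "h \<le> h0" using n n0 uv h0 by (auto simp: h_def field_simps)
    have "K * h \<le> (K + 1) * h0" using h K by (intro mult_mono) auto
    then have Kh: "K * h \<le> 1" "K * h \<le> \<epsilon>" using Kh0 by auto
    have nh: "real n * h = v - u" using n0 by (simp add: h_def)
    have hd: "h \<le> d" using h by (auto simp: h0_def)
    define R where "R = ennreal C * V + ennreal \<epsilon>"
    have "Y (u + real i * h) \<le> ennreal (exp (k * (real i * h))) * (Y u + ennreal (real i * h) * R)" if "i \<le> n" for i
      using that
    proof (induction i)
      case (Suc i)
      define s where "s = u + real i * h"
      have su: "u + real (Suc i) * h = s + h" by (simp add: s_def algebra_simps)
      have "real (Suc i) * h \<le> real n * h" using Suc h by (intro mult_right_mono) auto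
      then have st: "u \<le> s" "s < s + h" "s + h \<le> v" using h nh su by (auto simp: s_def)
      have "Y (s + h) \<le> ennreal (1 + C * h + K * h\<^sup>2) * Y s + ennreal (C * h) * V + ennreal (K * h\<^sup>2)"
        using step[OF st] hd by simp
      also have "\<dots> \<le> ennreal (1 + k * h) * Y s + ennreal (C * h) * V + ennreal (\<epsilon> * h)"
      proof -
        have "K * h\<^sup>2 \<le> 1 * h" "K * h\<^sup>2 \<le> \<epsilon> * h"
          using mult_right_mono[OF Kh(1), of h] mult_right_mono[OF Kh(2), of h] h
          by (auto simp: power2_eq_square mult_ac)
        then have "1 + C * h + K * h\<^sup>2 \<le> 1 + k * h" by (simp add: k_def algebra_simps)
        from add_mono[OF add_mono[OF mult_right_mono[OF ennreal_leI[OF this]] order_refl]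
            ennreal_leI[OF \<open>K * h\<^sup>2 \<le> \<epsilon> * h\<close>]]
        show ?thesis by simp
      qed
      also have "\<dots> = ennreal (1 + k * h) * Y s + ennreal h * R"
        using h C \<epsilon> by (simp add: R_def ennreal_mult distrib_left mult_ac add_ac)
      also have "\<dots> \<le> ennreal (exp (k * h)) * Y s + ennreal (exp (k * h)) * (ennreal h * R)"
      proof -
        have "1 * (ennreal h * R) \<le> ennreal (exp (k * h)) * (ennreal h * R)"
          using k h by (intro mult_right_mono) (auto simp flip: ennreal_1 intro!: ennreal_leI)
        then show ?thesis
          by (intro add_mono mult_right_mono ennreal_leI) auto
      qed
      also have "\<dots> = ennreal (exp (k * h)) * (Y s + ennreal h * R)" by (simp add: distrib_left)
      also have "\<dots> \<le> ennreal (exp (k * h)) * (ennreal (exp (k * (real i * h))) * (Y u + ennreal (real i * h) * R) + ennreal (exp (k * (real i * h))) * (ennreal h * R))"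
      proof -
        have "1 * (ennreal h * R) \<le> ennreal (exp (k * (real i * h))) * (ennreal h * R)"
          using k h by (intro mult_right_mono) (auto simp flip: ennreal_1 intro!: ennreal_leI)
        then show ?thesis
          using Suc by (intro mult_left_mono add_mono) (auto simp: s_def)
      qed
      also have "\<dots> = ennreal (exp (k * h) * exp (k * (real i * h))) * (Y u + (ennreal (real i * h) + ennreal h) * R)"
        by (simp add: ennreal_mult distrib_left distrib_right mult_ac add_ac)
      also have "exp (k * h) * exp (k * (real i * h)) = exp (k * (real (Suc i) * h))"
        by (simp add: algebra_simps flip: exp_add)
      also have "ennreal (real i * h) + ennreal h = ennreal (real (Suc i) * h)"
        using h by (simp add: algebra_simps flip: ennreal_plus)
      finally show ?case unfolding su .
    qed simp
    from this[of n] have "Y v \<le> ennreal (exp (k * (v - u))) * (Y u + ennreal (v - u) * R)"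
      by (simp add: nh)
    also have "\<dots> = ennreal (exp (k * (v - u))) * (Y u + ennreal (C * (v - u)) * V) + ennreal (exp (k * (v - u)) * ((v - u) * \<epsilon>))"
      using uv C \<epsilon> by (simp add: R_def ennreal_mult distrib_left mult_ac add_ac)
    also have "exp (k * (v - u)) * ((v - u) * \<epsilon>) = e"
      using uv by (simp add: \<epsilon>_def)
    finally show "Y v \<le> ennreal (exp ((C + 1) * (v - u))) * (Y u + ennreal (C * (v - u)) * V) + ennreal e"
      by (simp add: k_def)
  qed
qed

text \<open>Induction on a finite superset \<open>P\<close> of the breakpoints strictly inside the
  interval. At a breakpoint \<open>w\<close> the bounds on the two halves are concatenated: the
  exponentials multiply and the integrals over the half-open intervals add up.\<close>

lemma gronwall_breakpoints:
  fixes Y V :: "real \<Rightarrow> ennreal" and C k :: real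
  assumes P: "finite P" and k: "0 \<le> k" and V: "V \<in> borel_measurable borel"
    and base: "\<And>u v. 0 \<le> u \<Longrightarrow> u \<le> v \<Longrightarrow> v \<le> T \<Longrightarrow> P0 \<inter> {u<..<v} = {} \<Longrightarrow>
      Y v \<le> ennreal (exp (k * (v - u))) * (Y u + ennreal C * (\<integral>\<^sup>+s\<in>{u<..v}. V s \<partial>lborel))"
  shows "0 \<le> u \<Longrightarrow> u \<le> v \<Longrightarrow> v \<le> T \<Longrightarrow> P0 \<inter> {u<..<v} \<subseteq> P \<Longrightarrow>
      Y v \<le> ennreal (exp (k * (v - u))) * (Y u + ennreal C * (\<integral>\<^sup>+s\<in>{u<..v}. V s \<partial>lborel))"
  using P
proof (induction P arbitrary: u v rule: finite_induct)
  case empty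
  then show ?case by (intro base) auto
next
  case (insert w P)
  note [measurable] = V
  show ?case
  proof (cases "w \<in> {u<..<v}")
    case False
    then show ?thesis using insert.prems by (intro insert.IH) auto
  next
    case True
    then have w: "u < w" "w < v" by auto
    let ?I = "\<lambda>a b. \<integral>\<^sup>+s\<in>{a<..b}. V s \<partial>lborel"
    have split: "?I u v = ?I u w + ?I w v"
    proof -
      have "?I u v = (\<integral>\<^sup>+s. V s * indicator {u<..w} s + V s * indicator {w<..v} s \<partial>lborel)"
        using w by (intro nn_integral_cong) (auto split: split_indicator)
      then show ?thesis by (simp add: nn_integral_add)
    qed
    have 1: "Y w \<le> ennreal (exp (k * (w - u))) * (Y u + ennreal C * ?I u w)"
      using insert.prems w by (intro insert.IH) auto
    have "Y v \<le> ennreal (exp (k * (v - w))) * (Y w + ennreal C * ?I w v)"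
      using insert.prems w by (intro insert.IH) auto
    also have "\<dots> \<le> ennreal (exp (k * (v - w))) * (ennreal (exp (k * (w - u))) * (Y u + ennreal C * ?I u w)
      + ennreal (exp (k * (w - u))) * (ennreal C * ?I w v))"
    proof -
      have "1 * (ennreal C * ?I w v) \<le> ennreal (exp (k * (w - u))) * (ennreal C * ?I w v)"
        using k w by (intro mult_right_mono) (auto simp flip: ennreal_1 intro!: ennreal_leI)
      then show ?thesis using 1 by (intro mult_left_mono add_mono) auto
    qed
    also have "\<dots> = ennreal (exp (k * (v - w)) * exp (k * (w - u))) * (Y u + ennreal C * ?I u v)"
      by (simp add: split ennreal_mult distrib_left mult_ac add_ac)
    also have "exp (k * (v - w)) * exp (k * (w - u)) = exp (k * (v - u))"
      by (simp add: algebra_simps flip: exp_add)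
    finally show ?thesis .
  qed
qed

section \<open>Cutting overlapping mark sets into disjoint cells\<close>

definition atom :: "(nat \<Rightarrow> 'z set) \<Rightarrow> nat \<Rightarrow> nat set \<Rightarrow> 'z set" where
  "atom A n S = {z. {i. i < n \<and> z \<in> A i} = S}"

lemma atom_eq: "S \<subseteq> {..<n} \<Longrightarrow> S \<noteq> {} \<Longrightarrow> atom A n S = (\<Inter>i\<in>S. A i) - (\<Union>i\<in>{..<n} - S. A i)"
  by (auto simp: atom_def)

lemma disjoint_atoms: "disjoint_family_on (atom A n) J"
  by (auto simp: atom_def disjoint_family_on_def)

lemma UN_atoms: "(\<Union>S\<in>Pow {..<n} - {{}}. atom A n S) = (\<Union>i<n. A i)"
  by (auto simp: atom_def)

lemma UN_atoms_containing: "i < n \<Longrightarrow> (\<Union>S\<in>{S \<in> Pow {..<n} - {{}}. i \<in> S}. atom A n S) = A i"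
  by (auto simp: atom_def)

text \<open>\<open>atom A n S\<close> is the cell of the Venn diagram of points lying in exactly the
  sets \<open>A i\<close> with \<open>i \<in> S\<close>, and \<open>A i\<close> is the union of the
  cells with \<open>i \<in> S\<close>. Exchanging the sums collects the coefficients of each cell.
  The set function is kept abstract because it is instantiated both by an indicator at a point and
  by a compensated count.\<close>

lemma sum_via_atoms:
  fixes \<xi> :: "nat \<Rightarrow> real" and G :: "'z set \<Rightarrow> real"
  assumes add: "\<And>J. J \<subseteq> Pow {..<n} - {{}} \<Longrightarrow> G (\<Union>S\<in>J. atom A n S) = (\<Sum>S\<in>J. G (atom A n S))"
  shows "(\<Sum>i<n. \<xi> i * G (A i)) = (\<Sum>S\<in>Pow {..<n} - {{}}. (\<Sum>i\<in>S. \<xi> i) * G (atom A n S))"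
proof -
  let ?J = "Pow {..<n} - {{}}"
  have "(\<Sum>i<n. \<xi> i * G (A i)) = (\<Sum>i<n. \<Sum>S\<in>?J. if i \<in> S then \<xi> i * G (atom A n S) else 0)"
  proof (rule sum.cong)
    fix i assume i: "i \<in> {..<n}"
    have "\<xi> i * G (A i) = \<xi> i * (\<Sum>S\<in>{S\<in>?J. i \<in> S}. G (atom A n S))"
      using i UN_atoms_containing[of i n A] add[of "{S\<in>?J. i \<in> S}"] by auto
    also have "\<dots> = (\<Sum>S\<in>?J. if i \<in> S then \<xi> i * G (atom A n S) else 0)"
      unfolding sum_distrib_left by (rule sum.inter_filter) simp
    finally show "\<xi> i * G (A i) = \<dots>" .
  qed simp
  also have "\<dots> = (\<Sum>S\<in>?J. \<Sum>i<n. if i \<in> S then \<xi> i * G (atom A n S) else 0)"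
    by (rule sum.swap)
  also have "\<dots> = (\<Sum>S\<in>?J. (\<Sum>i\<in>S. \<xi> i) * G (atom A n S))"
  proof (rule sum.cong)
    fix S assume S: "S \<in> ?J"
    have "(\<Sum>i<n. if i \<in> S then \<xi> i * G (atom A n S) else 0) = (\<Sum>i\<in>{i\<in>{..<n}. i \<in> S}. \<xi> i * G (atom A n S))"
      by (rule sum.inter_filter[symmetric]) simp
    also have "{i\<in>{..<n}. i \<in> S} = S" using S by auto
    finally show "(\<Sum>i<n. if i \<in> S then \<xi> i * G (atom A n S) else 0) = (\<Sum>i\<in>S. \<xi> i) * G (atom A n S)"
      by (simp add: sum_distrib_right)
  qed simp
  finally show ?thesis .
qed

lemma indicator_additive:
  assumes "disjoint_family_on B J" "finite J"
  shows "indicator (\<Union>S\<in>J. B S) z = (\<Sum>S\<in>J. indicator (B S) z :: real)"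
  using assms indicator_UN_disjoint[of J B z] by simp

text \<open>At each point at most one indicator is nonzero, so \<open>h\<close> passes inside the
  sum; \<open>h 0 = 0\<close> takes care of the points outside all pieces.\<close>

lemma nn_integral_disjoint_simple:
  fixes c :: "'j \<Rightarrow> real" and h :: "real \<Rightarrow> real"
  assumes J: "finite J" and B: "\<And>j. j \<in> J \<Longrightarrow> B j \<in> sets M" "\<And>j. j \<in> J \<Longrightarrow> emeasure M (B j) < \<infinity>"
    and dis: "disjoint_family_on B J" and h: "h 0 = 0" "\<And>x. 0 \<le> h x"
  shows "(\<integral>\<^sup>+z. ennreal (h (\<Sum>j\<in>J. c j * indicator (B j) z)) \<partial>M) = ennreal (\<Sum>j\<in>J. h (c j) * measure M (B j))"
proof -
  have "h (\<Sum>j\<in>J. c j * indicator (B j) z) = (\<Sum>j\<in>J. h (c j) * indicator (B j) z)" for z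
  proof (cases "\<exists>i\<in>J. z \<in> B i")
    case True
    then obtain i where i: "i \<in> J" "z \<in> B i" by auto
    then have "\<And>j. j \<in> J \<Longrightarrow> (indicator (B j) z :: real) = (if j = i then 1 else 0)"
      using dis by (auto simp: disjoint_family_on_def split: split_indicator)
    then have "(\<Sum>j\<in>J. f j * indicator (B j) z) = (\<Sum>j\<in>J. if j = i then f j else 0)" for f :: "'j \<Rightarrow> real"
      by (intro sum.cong) auto
    then show ?thesis using i J by simp
  next
    case False
    then show ?thesis using h by simp
  qed
  then have "(\<integral>\<^sup>+z. ennreal (h (\<Sum>j\<in>J. c j * indicator (B j) z)) \<partial>M) =
    (\<integral>\<^sup>+z. (\<Sum>j\<in>J. ennreal (h (c j)) * indicator (B j) z) \<partial>M)"
    using h by (intro nn_integral_cong) (auto simp flip: sum_ennreal simp: ennreal_mult' ennreal_indicator intro!: sum.cong)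
  also have "\<dots> = (\<Sum>j\<in>J. ennreal (h (c j)) * emeasure M (B j))"
    using B by (simp add: nn_integral_sum nn_integral_cmult_indicator)
  also have "\<dots> = (\<Sum>j\<in>J. ennreal (h (c j) * measure M (B j)))"
    using B h by (intro sum.cong) (auto simp: ennreal_mult' emeasure_eq_ennreal_measure less_top)
  also have "\<dots> = ennreal (\<Sum>j\<in>J. h (c j) * measure M (B j))"
    using h by (intro sum_ennreal) auto
  finally show ?thesis .
qed

text \<open>
  The exponent \<open>p / 2\<close> is applied at each time separately, before integrating over time. Compared
  with the usual \<open>p\<close>-th moment inequality this costs a constant depending on \<open>T\<close>, but a Gronwall
  argument then replaces Doob's maximal inequality.
\<close>

definition moment :: "'w measure \<Rightarrow> 'z measure \<Rightarrow> real \<Rightarrow> (real \<Rightarrow> 'z \<Rightarrow> 'w \<Rightarrow> real) \<Rightarrow> real \<Rightarrow> ennreal" where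
  "moment M \<nu> p f s = (\<integral>\<^sup>+\<omega>. epowr (\<integral>\<^sup>+z. ennreal ((f s z \<omega>)\<^sup>2) \<partial>\<nu>) (p / 2) + (\<integral>\<^sup>+z. ennreal (\<bar>f s z \<omega>\<bar> powr p) \<partial>\<nu>) \<partial>M)"

section \<open>Elementary integrals as processes in time\<close>

context poisson_basis
begin

text \<open>
  The guard \<open>a < t\<close> makes the summand \<open>F t\<close>-measurable: \<open>\<xi>\<close> is only known to be
  \<open>F a\<close>-measurable.
\<close>

definition truncated_integral :: "('z, 'w) elem \<Rightarrow> real \<Rightarrow> 'w \<Rightarrow> real" where
  "truncated_integral L t \<omega> =
     (\<Sum>(a, b, A, \<xi>)\<leftarrow>L. if a < t then \<xi> \<omega> * (N a (min b t) A \<omega> - lam a (min b t) A) else 0)"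

definition carrier_set :: "('z, 'w) elem \<Rightarrow> 'z set" where
  "carrier_set L = (\<Union>(a, b, A, \<xi>)\<in>set L. A)"

lemma elementary_Cons:
  "elementary T F \<nu> ((a, b, A, \<xi>) # L) \<longleftrightarrow>
    (0 \<le> a \<and> a \<le> b \<and> b \<le> T \<and> A \<in> sets \<nu> \<and> emeasure \<nu> A < \<infinity> \<and>
     \<xi> \<in> borel_measurable (F a) \<and> (\<exists>C. \<forall>\<omega>\<in>space (F a). \<bar>\<xi> \<omega>\<bar> \<le> C)) \<and> elementary T F \<nu> L"
  by (auto simp: elementary_def)

lemma elementaryD:
  assumes "elementary T F \<nu> L" "(a, b, A, \<xi>) \<in> set L"
  shows "0 \<le> a" "a \<le> b" "b \<le> T" "A \<in> sets \<nu>" "emeasure \<nu> A < \<infinity>" "\<xi> \<in> borel_measurable (F a)"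
    "\<xi> \<in> borel_measurable M" "\<exists>C. \<forall>\<omega>\<in>space M. \<bar>\<xi> \<omega>\<bar> \<le> C"
proof -
  show *: "0 \<le> a" "a \<le> b" "b \<le> T" "A \<in> sets \<nu>" "emeasure \<nu> A < \<infinity>" "\<xi> \<in> borel_measurable (F a)"
    using assms by (auto simp: elementary_def)
  then show "\<xi> \<in> borel_measurable M" by (intro F_measurable_M[of a]) auto
  show "\<exists>C. \<forall>\<omega>\<in>space M. \<bar>\<xi> \<omega>\<bar> \<le> C"
    using assms(1)[unfolded elementary_def, rule_format, OF assms(2)] * space_F[of a] by auto
qed

lemma carrier_set:
  assumes "elementary T F \<nu> L"
  shows "carrier_set L \<in> sets \<nu>" "emeasure \<nu> (carrier_set L) < \<infinity>"
proof -
  show s: "carrier_set L \<in> sets \<nu>"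
    unfolding carrier_set_def using elementaryD[OF assms] by (intro sets.finite_UN) auto
  have "emeasure \<nu> (carrier_set L) \<le> (\<Sum>e\<in>set L. emeasure \<nu> (case e of (a, b, A, \<xi>) \<Rightarrow> A))"
    unfolding carrier_set_def using elementaryD[OF assms] by (intro emeasure_subadditive_finite) auto
  also have "\<dots> < \<infinity>" using elementaryD[OF assms] by (auto split: prod.split)
  finally show "emeasure \<nu> (carrier_set L) < \<infinity>" .
qed

lemma truncated_integral_T:
  assumes "elementary T F \<nu> L"
  shows "truncated_integral L T \<omega> = elem_integral \<nu> \<mu> L \<omega>"
  unfolding truncated_integral_def elem_integral_def
proof (intro arg_cong[where f=sum_list] map_cong refl, safe)
  fix a b A \<xi> assume "(a, b, A, \<xi>) \<in> set L"
  from elementaryD[OF assms this]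
  show "(if a < T then \<xi> \<omega> * (N a (min b T) A \<omega> - lam a (min b T) A) else 0) =
    \<xi> \<omega> * (measure (\<mu> \<omega>) ({a<..b} \<times> A) - (b - a) * measure \<nu> A)"
    by (auto simp: N_def lam_def min_def)
qed

lemma truncated_integral_0:
  assumes "elementary T F \<nu> L" shows "truncated_integral L 0 \<omega> = 0"
  using assms by (induction L) (auto simp: truncated_integral_def elementary_Cons)

lemma truncated_integral_measurable:
  assumes "elementary T F \<nu> L" "0 \<le> t" "t \<le> T"
  shows "truncated_integral L t \<in> borel_measurable (F t)"
  using assms(1)
proof (induction L)
  case Nil
  then show ?case by (simp add: truncated_integral_def)
next
  case (Cons e L)
  obtain a b A \<xi> where e: "e = (a, b, A, \<xi>)" by (cases e)
  have L: "elementary T F \<nu> L" using Cons.prems by (auto simp: elementary_def)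
  note D = elementaryD[OF Cons.prems, of a b A \<xi>, unfolded e, simplified]
  have "(\<lambda>\<omega>. if a < t then \<xi> \<omega> * (N a (min b t) A \<omega> - lam a (min b t) A) else 0) \<in> borel_measurable (F t)"
  proof (cases "a < t")
    case True
    have [measurable]: "\<xi> \<in> borel_measurable (F t)"
      using D True assms by (intro F_mono[of a t]) auto
    have [measurable]: "N a (min b t) A \<in> borel_measurable (F t)"
      using D assms by (intro N_measurable_F) auto
    show ?thesis using True by simp
  qed simp
  with Cons.IH[OF L] show ?case
    by (simp add: truncated_integral_def e)
qed

lemma truncated_integral_dominated:
  assumes "elementary T F \<nu> L" "0 \<le> t" "t \<le> T"
    "U \<in> sets \<nu>" "emeasure \<nu> U < \<infinity>" "carrier_set L \<subseteq> U"
  shows "dominated U (truncated_integral L t)"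
  using assms(1,6)
proof (induction L)
  case Nil
  then show ?case using dominated_const[of U 0] by (simp add: truncated_integral_def[abs_def])
next
  case (Cons e L)
  obtain a b A \<xi> where e: "e = (a, b, A, \<xi>)" by (cases e)
  have L: "elementary T F \<nu> L" using Cons.prems by (auto simp: elementary_def)
  note D = elementaryD[OF Cons.prems(1), of a b A \<xi>, unfolded e, simplified]
  obtain C where C: "\<And>\<omega>. \<omega> \<in> space M \<Longrightarrow> \<bar>\<xi> \<omega>\<bar> \<le> C" using D(8) by auto
  have U: "A \<subseteq> U" "carrier_set L \<subseteq> U" using Cons.prems by (auto simp: carrier_set_def e)
  have "dominated U (\<lambda>\<omega>. if a < t then \<xi> \<omega> * (N a (min b t) A \<omega> - lam a (min b t) A) else 0)"
  proof (cases "a < t")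
    case True
    have "dominated U \<xi>" using D C by (intro dominated_bounded[where K=C]) auto
    moreover have "dominated U (N a (min b t) A)" using D assms U by (intro dominated_N) auto
    ultimately have "dominated U (\<lambda>\<omega>. \<xi> \<omega> * (N a (min b t) A \<omega> - lam a (min b t) A))"
      by (intro dominated_mult dominated_minus dominated_const) auto
    then show ?thesis using True by simp
  qed (simp add: dominated_const)
  with Cons.IH[OF L U(2)] show ?case
    unfolding truncated_integral_def[abs_def] e by (simp add: dominated_add)
qed

text \<open>The mark sets and coefficients of the summands whose time interval covers
  \<open>(u, v]\<close>. When no breakpoint lies strictly between \<open>u\<close> and
  \<open>v\<close>, these are the only summands that change during that period.\<close>

definition active :: "('z, 'w) elem \<Rightarrow> real \<Rightarrow> real \<Rightarrow> ('z set \<times> ('w \<Rightarrow> real)) list" where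
  "active L u v = map (\<lambda>(a, b, A, \<xi>). (A, \<xi>)) (filter (\<lambda>(a, b, A, \<xi>). a \<le> u \<and> v \<le> b) L)"

definition breakpoints :: "('z, 'w) elem \<Rightarrow> real set" where
  "breakpoints L = (\<Union>(a, b, A, \<xi>)\<in>set L. {a, b})"

text \<open>Without a breakpoint strictly inside, a time interval either covers
  \<open>(u, v]\<close> or misses it. A covering summand grows by the count on
  \<open>(s, t]\<close>, by additivity in time, which needs the finite counts supplied by
  \<open>good\<close>; a missing one is either finished or has not begun.\<close>

lemma truncated_integral_increment:
  assumes "elementary T F \<nu> L" "carrier_set L \<subseteq> U" "U \<in> sets \<nu>" "good U \<omega>"
    and st: "0 \<le> u" "u \<le> s" "s < t" "t \<le> v" "v \<le> T" and "breakpoints L \<inter> {u<..<v} = {}"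
  shows "truncated_integral L t \<omega> = truncated_integral L s \<omega> + (\<Sum>(A, \<xi>)\<leftarrow>active L u v. \<xi> \<omega> * (N s t A \<omega> - lam s t A))"
  using assms(1,2,10)
proof (induction L)
  case Nil
  then show ?case by (simp add: truncated_integral_def active_def)
next
  case (Cons e L)
  obtain a b A \<xi> where e: "e = (a, b, A, \<xi>)" by (cases e)
  have L: "elementary T F \<nu> L" using Cons.prems by (auto simp: elementary_def)
  note D = elementaryD[OF Cons.prems(1), of a b A \<xi>, unfolded e, simplified]
  have U: "A \<subseteq> U" "carrier_set L \<subseteq> U" using Cons.prems by (auto simp: carrier_set_def e)
  have bp: "breakpoints L \<inter> {u<..<v} = {}" "a \<notin> {u<..<v}" "b \<notin> {u<..<v}"
    using Cons.prems by (auto simp: breakpoints_def e)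
  have N0: "N x x A \<omega> = 0" "lam x x A = 0" for x by (auto simp: N_def lam_def)
  let ?f = "\<lambda>t. if a < t then \<xi> \<omega> * (N a (min b t) A \<omega> - lam a (min b t) A) else 0"
  have "?f t = ?f s + (if a \<le> u \<and> v \<le> b then \<xi> \<omega> * (N s t A \<omega> - lam s t A) else 0)"
  proof (cases "a \<le> u \<and> v \<le> b")
    case True
    then have *: "a \<le> s" "a < t" "min b t = t" "min b s = s" using st by auto
    have "N a t A \<omega> = N a s A \<omega> + N s t A \<omega>"
      using D * st U by (intro N_add_time[OF assms(3,4)]) auto
    moreover have "lam a t A = lam a s A + lam s t A" by (simp add: lam_def algebra_simps)
    ultimately show ?thesis
      using True * N0[of s] by (cases "a = s") (auto simp: algebra_simps)
  next
    case False
    then have "b \<le> u \<or> v \<le> a" using bp by auto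
    then show ?thesis
    proof
      assume "b \<le> u"
      then have "min b t = b" "min b s = b" using st by auto
      \<comment> \<open>The guard can fail at \<open>s\<close> for a finished summand only if
        \<open>a = b = s\<close>. That summand then lives on an empty interval and is 0 at
        \<open>t\<close> as well.\<close>
      moreover have "a < s \<or> a = b" using D \<open>b \<le> u\<close> st by auto
      ultimately show ?thesis using False N0 st by auto
    next
      assume "v \<le> a"
      then show ?thesis using False st by auto
    qed
  qed
  note inc = this
  have trunc: "truncated_integral (e # L) x \<omega> = ?f x + truncated_integral L x \<omega>" for x
    by (simp add: truncated_integral_def e)
  have "(\<Sum>(A, \<xi>)\<leftarrow>active (e # L) u v. \<xi> \<omega> * (N s t A \<omega> - lam s t A)) =
    (if a \<le> u \<and> v \<le> b then \<xi> \<omega> * (N s t A \<omega> - lam s t A) else 0) + (\<Sum>(A, \<xi>)\<leftarrow>active L u v. \<xi> \<omega> * (N s t A \<omega> - lam s t A))"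
    by (simp add: active_def e)
  with inc Cons.IH[OF L U(2) bp(1)] show ?case unfolding trunc[of t] trunc[of s] by linarith
qed

lemma elem_fun_active:
  assumes "breakpoints L \<inter> {u<..<v} = {}" "s \<in> {u<..v}"
  shows "elem_fun L s z \<omega> = (\<Sum>(A, \<xi>)\<leftarrow>active L u v. \<xi> \<omega> * indicator A z)"
  using assms(1)
proof (induction L)
  case Nil
  then show ?case by (simp add: elem_fun_def active_def)
next
  case (Cons e L)
  obtain a b A \<xi> where e: "e = (a, b, A, \<xi>)" by (cases e)
  have bp: "breakpoints L \<inter> {u<..<v} = {}" "a \<notin> {u<..<v}" "b \<notin> {u<..<v}"
    using Cons.prems by (auto simp: breakpoints_def e)
  have "indicator {a<..b} s = (if a \<le> u \<and> v \<le> b then 1 else 0 :: real)"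
    using bp assms(2) by (auto split: split_indicator)
  with Cons.IH[OF bp(1)] show ?case
    by (auto simp: elem_fun_def active_def e)
qed

lemma elem_fun_measurable [measurable]:
  assumes "elementary T F \<nu> L"
  shows "(\<lambda>((s, \<omega>), z). elem_fun L s z \<omega>) \<in> borel_measurable ((borel \<Otimes>\<^sub>M M) \<Otimes>\<^sub>M \<nu>)"
  using assms
proof (induction L)
  case Nil
  then show ?case by (simp add: elem_fun_def)
next
  case (Cons e L)
  obtain a b A \<xi> where e: "e = (a, b, A, \<xi>)" by (cases e)
  have L: "elementary T F \<nu> L" using Cons.prems by (auto simp: elementary_def)
  note D = elementaryD[OF Cons.prems, of a b A \<xi>, unfolded e, simplified]
  note [measurable] = D(4,7) Cons.IH[OF L, unfolded split_beta']
  have "(\<lambda>x. \<xi> (snd (fst x)) * indicator {a<..b} (fst (fst x)) * indicator A (snd x) + elem_fun L (fst (fst x)) (snd x) (snd (fst x)))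
    \<in> borel_measurable ((borel \<Otimes>\<^sub>M M) \<Otimes>\<^sub>M \<nu>)"
    by measurable
  then show ?case by (simp add: elem_fun_def e split_beta')
qed

lemma moment_measurable:
  assumes f: "(\<lambda>((s, \<omega>), z). f s z \<omega>) \<in> borel_measurable ((S \<Otimes>\<^sub>M M) \<Otimes>\<^sub>M \<nu>)"
  shows "moment M \<nu> p f \<in> borel_measurable S"
proof -
  note [measurable] = f[unfolded split_beta']
  have [measurable]: "(\<lambda>((s, \<omega>), z). ennreal ((f s z \<omega>)\<^sup>2)) \<in> borel_measurable ((S \<Otimes>\<^sub>M M) \<Otimes>\<^sub>M \<nu>)"
    "(\<lambda>((s, \<omega>), z). ennreal (\<bar>f s z \<omega>\<bar> powr p)) \<in> borel_measurable ((S \<Otimes>\<^sub>M M) \<Otimes>\<^sub>M \<nu>)"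
    unfolding split_beta' by measurable
  have [measurable]: "(\<lambda>(s, \<omega>). \<integral>\<^sup>+z. ennreal ((f s z \<omega>)\<^sup>2) \<partial>\<nu>) \<in> borel_measurable (S \<Otimes>\<^sub>M M)"
    "(\<lambda>(s, \<omega>). \<integral>\<^sup>+z. ennreal (\<bar>f s z \<omega>\<bar> powr p) \<partial>\<nu>) \<in> borel_measurable (S \<Otimes>\<^sub>M M)"
    using nu.borel_measurable_nn_integral_fst[of "\<lambda>((s, \<omega>), z). ennreal ((f s z \<omega>)\<^sup>2)" "S \<Otimes>\<^sub>M M"]
      nu.borel_measurable_nn_integral_fst[of "\<lambda>((s, \<omega>), z). ennreal (\<bar>f s z \<omega>\<bar> powr p)" "S \<Otimes>\<^sub>M M"]
    by (simp_all add: split_beta')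
  show ?thesis unfolding moment_def[abs_def] by measurable
qed

text \<open>Between two breakpoints the integrand is a fixed combination of mark sets with
  coefficients known at \<open>u\<close>; cut into atoms, it fits the estimate for disjoint pieces.
  \<open>K\<close> and \<open>d\<close> may depend on \<open>L\<close>, but the coefficients linear
  in \<open>t - s\<close> do not, which is what \<open>gronwall_quadratic_error\<close>
  requires.\<close>

lemma elementary_interval_step:
  assumes L: "elementary T F \<nu> L" and p: "2 \<le> p"
    and Cp: "0 \<le> Cp" "\<And>a b::real. \<bar>a + b\<bar> powr p \<le>
      \<bar>a\<bar> powr p + p * (a * \<bar>a\<bar> powr (p - 2)) * b + Cp * (\<bar>a\<bar> powr (p - 2) * b\<^sup>2 + \<bar>b\<bar> powr p)"
    and uv: "0 \<le> u" "u < v" "v \<le> T" and bp: "breakpoints L \<inter> {u<..<v} = {}"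
  shows "\<exists>K d. 0 \<le> K \<and> 0 < d \<and> (\<forall>s t. u \<le> s \<longrightarrow> s < t \<longrightarrow> t \<le> v \<longrightarrow> t - s \<le> d \<longrightarrow>
    (\<integral>\<^sup>+\<omega>. ennreal (\<bar>truncated_integral L t \<omega>\<bar> powr p) \<partial>M) \<le>
      ennreal (1 + Cp * 2 powr p * (t - s) + K * (t - s)\<^sup>2) * (\<integral>\<^sup>+\<omega>. ennreal (\<bar>truncated_integral L s \<omega>\<bar> powr p) \<partial>M)
      + ennreal (Cp * 2 powr p * (t - s)) * moment M \<nu> p (elem_fun L) v + ennreal (K * (t - s)\<^sup>2))"
proof -
  define U' where "U' = carrier_set L"
  have U': "U' \<in> sets \<nu>" "emeasure \<nu> U' < \<infinity>" using carrier_set[OF L] by (auto simp: U'_def)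
  define L' where "L' = active L u v"
  define n where "n = length L'"
  define A where "A i = fst (L' ! i)" for i
  define \<xi> where "\<xi> i = snd (L' ! i)" for i
  have nth: "\<exists>a b. (a, b, A i, \<xi> i) \<in> set L \<and> a \<le> u \<and> v \<le> b" if "i < n" for i
  proof -
    have "L' ! i \<in> set (active L u v)" using that by (simp add: n_def L'_def)
    then show ?thesis unfolding active_def A_def \<xi>_def by fastforce
  qed
  have A: "A i \<in> sets \<nu>" "A i \<subseteq> U'" if "i < n" for i
    using nth[OF that] elementaryD[OF L] by (auto simp: U'_def carrier_set_def)
  have \<xi>m: "\<xi> i \<in> borel_measurable (F s)" if "i < n" "u \<le> s" "s \<le> T" for i s
  proof -
    from nth[OF that(1)] obtain a b where ab: "(a, b, A i, \<xi> i) \<in> set L" "a \<le> u" by blast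
    from elementaryD[OF L ab(1)] show ?thesis using ab that by (intro F_mono[of a s]) auto
  qed
  have "\<exists>C. \<forall>i<n. \<forall>\<omega>\<in>space M. \<bar>\<xi> i \<omega>\<bar> \<le> C"
  proof -
    have "\<forall>i\<in>{..<n}. \<exists>C. \<forall>\<omega>\<in>space M. \<bar>\<xi> i \<omega>\<bar> \<le> C"
      using nth elementaryD(8)[OF L] by blast
    then obtain C where C: "\<forall>i\<in>{..<n}. \<forall>\<omega>\<in>space M. \<bar>\<xi> i \<omega>\<bar> \<le> C i" by metis
    have "\<bar>\<xi> i \<omega>\<bar> \<le> (\<Sum>i<n. \<bar>C i\<bar>)" if "i < n" "\<omega> \<in> space M" for i \<omega>
    proof -
      have "\<bar>\<xi> i \<omega>\<bar> \<le> \<bar>C i\<bar>" using C that by force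
      also have "\<dots> \<le> (\<Sum>i<n. \<bar>C i\<bar>)" using that by (intro member_le_sum) auto
      finally show ?thesis .
    qed
    then show ?thesis by blast
  qed
  then obtain C0 where C0: "\<And>i \<omega>. i < n \<Longrightarrow> \<omega> \<in> space M \<Longrightarrow> \<bar>\<xi> i \<omega>\<bar> \<le> C0" by blast
  define J where "J = Pow {..<n} - {{}}"
  define B where "B = atom A n"
  define c where "c S \<omega> = (\<Sum>i\<in>S. \<xi> i \<omega>)" for S \<omega>
  \<comment> \<open>The coefficient of an atom is a sum of at most \<open>n\<close> of the original
    coefficients.\<close>
  define C where "C = real n * \<bar>C0\<bar>"
  define U where "U = (\<Union>i<n. A i)"
  have U: "U \<in> sets \<nu>" "U \<subseteq> U'" using A by (auto simp: U_def)
  have Uf: "emeasure \<nu> U < \<infinity>" using U U' by (meson emeasure_mono order_le_less_trans)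
  have J: "finite J" by (simp add: J_def)
  have B: "S \<in> J \<Longrightarrow> B S \<in> sets \<nu>" "disjoint_family_on B J" "(\<Union>S\<in>J. B S) = U" for S
  proof -
    show "S \<in> J \<Longrightarrow> B S \<in> sets \<nu>"
      unfolding B_def using A by (subst atom_eq) (auto simp: J_def intro!: sets.Diff sets.finite_INT finite_subset[of S])
  qed (auto simp: B_def J_def U_def disjoint_atoms UN_atoms)
  have Bf: "emeasure \<nu> (B S) < \<infinity>" if "S \<in> J" for S
    using B(3) that Uf U by (meson UN_upper emeasure_mono order_le_less_trans)
  have c: "S \<in> J \<Longrightarrow> \<omega> \<in> space M \<Longrightarrow> \<bar>c S \<omega>\<bar> \<le> C" for S \<omega>
  proof -
    assume S: "S \<in> J" "\<omega> \<in> space M"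
    have "\<bar>c S \<omega>\<bar> \<le> (\<Sum>i\<in>S. \<bar>C0\<bar>)" unfolding c_def
      using S by (intro order_trans[OF sum_abs] sum_mono) (auto simp: J_def intro!: order_trans[OF C0])
    also have "\<dots> \<le> (\<Sum>i<n. \<bar>C0\<bar>)" using S by (intro sum_mono2) (auto simp: J_def)
    finally show ?thesis by (simp add: C_def)
  qed
  have cm: "c S \<in> borel_measurable (F s)" if "S \<in> J" "u \<le> s" "s \<le> T" for S s
    unfolding c_def using \<xi>m that by (intro borel_measurable_sum) (auto simp: J_def)
  have C: "0 \<le> C" by (simp add: C_def)
  have via: "(\<Sum>(A, \<xi>)\<leftarrow>active L u v. \<xi> \<omega> * G A) = (\<Sum>S\<in>J. c S \<omega> * G (B S))"
    if "\<And>J'. J' \<subseteq> J \<Longrightarrow> G (\<Union>S\<in>J'. B S) = (\<Sum>S\<in>J'. G (B S))" for G :: "'z set \<Rightarrow> real" and \<omega>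
  proof -
    have "(\<Sum>(A, \<xi>)\<leftarrow>active L u v. \<xi> \<omega> * G A) = (\<Sum>i<n. \<xi> i \<omega> * G (A i))"
      unfolding L'_def[symmetric] by (simp add: sum_list_sum_nth n_def A_def \<xi>_def split_beta atLeast0LessThan)
    also have "\<dots> = (\<Sum>S\<in>J. c S \<omega> * G (B S))"
      using sum_via_atoms[of n G A "\<lambda>i. \<xi> i \<omega>"] that by (simp add: J_def B_def c_def)
    finally show ?thesis .
  qed
  \<comment> \<open>Time intervals are left-open, so the constant value of the integrand on
    \<open>(u, v]\<close> is attained at \<open>v\<close>, but not necessarily at
    \<open>u\<close>.\<close>
  have mom: "moment M \<nu> p (elem_fun L) v = (\<integral>\<^sup>+\<omega>. ennreal ((\<Sum>j\<in>J. \<bar>c j \<omega>\<bar> powr 2 * measure \<nu> (B j)) powr (p / 2)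
    + (\<Sum>j\<in>J. \<bar>c j \<omega>\<bar> powr p * measure \<nu> (B j))) \<partial>M)"
    unfolding moment_def
  proof (rule nn_integral_cong)
    fix \<omega>
    have "elem_fun L v z \<omega> = (\<Sum>S\<in>J. c S \<omega> * indicator (B S) z)" for z
      using elem_fun_active[OF bp, of v] uv B J
      by (subst via[symmetric]) (auto intro!: indicator_additive intro: finite_subset disjoint_family_on_mono simp del: indicator_UN_disjoint)
    then have "(\<integral>\<^sup>+z. ennreal ((elem_fun L v z \<omega>)\<^sup>2) \<partial>\<nu>) = ennreal (\<Sum>j\<in>J. \<bar>c j \<omega>\<bar> powr 2 * measure \<nu> (B j))"
      "(\<integral>\<^sup>+z. ennreal (\<bar>elem_fun L v z \<omega>\<bar> powr p) \<partial>\<nu>) = ennreal (\<Sum>j\<in>J. \<bar>c j \<omega>\<bar> powr p * measure \<nu> (B j))"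
      using nn_integral_disjoint_simple[of J B \<nu> "\<lambda>x. x\<^sup>2" "\<lambda>S. c S \<omega>"]
        nn_integral_disjoint_simple[of J B \<nu> "\<lambda>x. \<bar>x\<bar> powr p" "\<lambda>S. c S \<omega>"] J B Bf p by auto
    then show "epowr (\<integral>\<^sup>+z. ennreal ((elem_fun L v z \<omega>)\<^sup>2) \<partial>\<nu>) (p / 2) + (\<integral>\<^sup>+z. ennreal (\<bar>elem_fun L v z \<omega>\<bar> powr p) \<partial>\<nu>) =
      ennreal ((\<Sum>j\<in>J. \<bar>c j \<omega>\<bar> powr 2 * measure \<nu> (B j)) powr (p / 2) + (\<Sum>j\<in>J. \<bar>c j \<omega>\<bar> powr p * measure \<nu> (B j)))"
      by (simp add: epowr_ennreal sum_nonneg ennreal_plus)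
  qed
  define m where "m = nat \<lceil>p\<rceil>"
  have m: "p \<le> real m" by (simp add: m_def real_nat_ceiling_ge)
  define K where "K = Cp * 2 powr p * (C powr 2 + C powr p) * (fact m * exp (exp 1) + 1) * (measure \<nu> U)\<^sup>2"
  \<comment> \<open>This makes the intensity of a step of length at most \<open>d\<close> at most
    one, the smallness condition of the one-step estimate; the added 1 covers a \<open>U\<close> of
    mass zero.\<close>
  define d where "d = 1 / (measure \<nu> U + 1)"
  have d: "0 < d" by (simp add: d_def add_nonneg_pos)
  have "0 \<le> K" unfolding K_def using Cp by (intro mult_nonneg_nonneg add_nonneg_nonneg) auto
  moreover have "(\<integral>\<^sup>+\<omega>. ennreal (\<bar>truncated_integral L t \<omega>\<bar> powr p) \<partial>M) \<le>
      ennreal (1 + Cp * 2 powr p * (t - s) + K * (t - s)\<^sup>2) * (\<integral>\<^sup>+\<omega>. ennreal (\<bar>truncated_integral L s \<omega>\<bar> powr p) \<partial>M)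
      + ennreal (Cp * 2 powr p * (t - s)) * moment M \<nu> p (elem_fun L) v + ennreal (K * (t - s)\<^sup>2)"
    if st: "u \<le> s" "s < t" "t \<le> v" "t - s \<le> d" for s t
  proof -
    have st': "0 \<le> s" "s \<le> t" "t \<le> T" "s \<le> T" using st uv by auto
    have "(t - s) * measure \<nu> U \<le> d * (measure \<nu> U + 1)"
      using st d by (intro mult_mono) auto
    also have "\<dots> = 1" using add_nonneg_pos[OF measure_nonneg[of \<nu> U] zero_less_one] by (simp add: d_def)
    finally have small: "lam s t U \<le> 1" by (simp add: lam_def)
    have "(\<integral>\<^sup>+\<omega>. ennreal (\<bar>truncated_integral L t \<omega>\<bar> powr p) \<partial>M) =
      (\<integral>\<^sup>+\<omega>. ennreal (\<bar>truncated_integral L s \<omega> + (\<Sum>j\<in>J. c j \<omega> * (N s t (B j) \<omega> - lam s t (B j)))\<bar> powr p) \<partial>M)"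
    proof (rule nn_integral_cong_AE)
      show "AE \<omega> in M. ennreal (\<bar>truncated_integral L t \<omega>\<bar> powr p) =
        ennreal (\<bar>truncated_integral L s \<omega> + (\<Sum>j\<in>J. c j \<omega> * (N s t (B j) \<omega> - lam s t (B j)))\<bar> powr p)"
        using AE_good[OF U']
      proof eventually_elim
        case (elim \<omega>)
        have "truncated_integral L t \<omega> = truncated_integral L s \<omega> + (\<Sum>(A, \<xi>)\<leftarrow>active L u v. \<xi> \<omega> * (N s t A \<omega> - lam s t A))"
          using st st' uv U' bp elim L by (intro truncated_integral_increment[where U=U']) (auto simp: U'_def)
        also have "(\<Sum>(A, \<xi>)\<leftarrow>active L u v. \<xi> \<omega> * (N s t A \<omega> - lam s t A)) = (\<Sum>j\<in>J. c j \<omega> * (N s t (B j) \<omega> - lam s t (B j)))"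
        proof (rule via)
          fix J' assume J': "J' \<subseteq> J"
          then have f: "finite J'" and di: "disjoint_family_on B J'" and su: "(\<Union>S\<in>J'. B S) \<subseteq> U'" and se: "\<And>S. S \<in> J' \<Longrightarrow> B S \<in> sets \<nu>"
            using J B U by (auto intro: finite_subset disjoint_family_on_mono)
          have "N s t (\<Union>S\<in>J'. B S) \<omega> = (\<Sum>S\<in>J'. N s t (B S) \<omega>)"
            by (rule N_UN[OF U'(1) elim st'(1,3) f se di su])
          moreover have "measure \<nu> (\<Union>S\<in>J'. B S) = (\<Sum>S\<in>J'. measure \<nu> (B S))"
            using f se di Bf J' by (intro measure_finite_Union) (auto simp: less_top)
          ultimately show "N s t (\<Union>S\<in>J'. B S) \<omega> - lam s t (\<Union>S\<in>J'. B S) = (\<Sum>S\<in>J'. N s t (B S) \<omega> - lam s t (B S))"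
            by (simp add: lam_def sum_subtractf sum_distrib_left)
        qed
        finally show ?case by simp
      qed
    qed
    also have "\<dots> \<le> ennreal (1 + Cp * 2 powr p * (t - s) + K * (t - s)\<^sup>2) * (\<integral>\<^sup>+\<omega>. ennreal (\<bar>truncated_integral L s \<omega>\<bar> powr p) \<partial>M)
      + ennreal (Cp * 2 powr p * (t - s)) * moment M \<nu> p (elem_fun L) v + ennreal (K * (t - s)\<^sup>2)"
      unfolding mom K_def
      using J B c C st st' uv U' U Uf L
      by (intro one_step_le[where U'=U'] p m small Cp cm truncated_integral_measurable truncated_integral_dominated)
         (auto simp: U'_def)
    finally show ?thesis .
  qed
  ultimately show ?thesis using d by blast
qed

text \<open>Between breakpoints the moment is constant in time, so its value at the right end times
  the length is its integral over the half-open interval. The integral starts from 0, so the initial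
  term disappears, and the constant is free of \<open>L\<close>.\<close>

lemma elementary_moment_le:
  assumes L: "elementary T F \<nu> L" and p: "2 \<le> p"
    and Cp: "0 \<le> Cp" "\<And>a b::real. \<bar>a + b\<bar> powr p \<le>
      \<bar>a\<bar> powr p + p * (a * \<bar>a\<bar> powr (p - 2)) * b + Cp * (\<bar>a\<bar> powr (p - 2) * b\<^sup>2 + \<bar>b\<bar> powr p)"
  shows "(\<integral>\<^sup>+\<omega>. ennreal (\<bar>elem_integral \<nu> \<mu> L \<omega>\<bar> powr p) \<partial>M) \<le>
    ennreal (exp ((Cp * 2 powr p + 1) * T) * (Cp * 2 powr p)) * (\<integral>\<^sup>+s\<in>{0..T}. moment M \<nu> p (elem_fun L) s \<partial>lborel)"
proof -
  define k where "k = Cp * 2 powr p + 1"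
  define Y where "Y t = (\<integral>\<^sup>+\<omega>. ennreal (\<bar>truncated_integral L t \<omega>\<bar> powr p) \<partial>M)" for t
  define V where "V = moment M \<nu> p (elem_fun L)"
  have k: "0 \<le> k" using Cp by (simp add: k_def)
  have [measurable]: "V \<in> borel_measurable borel"
    unfolding V_def by (intro moment_measurable elem_fun_measurable L)
  have fin: "finite (breakpoints L)" by (auto simp: breakpoints_def)
  have base: "Y v \<le> ennreal (exp (k * (v - u))) * (Y u + ennreal (Cp * 2 powr p) * (\<integral>\<^sup>+s\<in>{u<..v}. V s \<partial>lborel))"
    if uv: "0 \<le> u" "u \<le> v" "v \<le> T" and bp: "breakpoints L \<inter> {u<..<v} = {}" for u v
  proof (cases "u = v")
    case True
    then show ?thesis by simp
  next
    case False
    then have uv': "u < v" using uv by simp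
    obtain K d where K: "0 \<le> K" "0 < d" and st: "\<And>s t. u \<le> s \<Longrightarrow> s < t \<Longrightarrow> t \<le> v \<Longrightarrow> t - s \<le> d \<Longrightarrow>
      Y t \<le> ennreal (1 + Cp * 2 powr p * (t - s) + K * (t - s)\<^sup>2) * Y s
      + ennreal (Cp * 2 powr p * (t - s)) * V v + ennreal (K * (t - s)\<^sup>2)"
      using elementary_interval_step[OF L p Cp uv(1) uv' uv(3) bp] unfolding Y_def V_def by blast
    have "Y v \<le> ennreal (exp (k * (v - u))) * (Y u + ennreal (Cp * 2 powr p * (v - u)) * V v)"
      unfolding k_def using Cp K st uv by (intro gronwall_quadratic_error[where K=K and d=d]) auto
    also have "ennreal (Cp * 2 powr p * (v - u)) * V v = ennreal (Cp * 2 powr p) * (\<integral>\<^sup>+s\<in>{u<..v}. V s \<partial>lborel)"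
    proof -
      have const: "V s = V v" if "s \<in> {u<..v}" for s
        using elem_fun_active[OF bp that] elem_fun_active[OF bp, of v] uv'
        by (simp add: V_def moment_def)
      have "(\<integral>\<^sup>+s\<in>{u<..v}. V s \<partial>lborel) = (\<integral>\<^sup>+s. V v * indicator {u<..v} s \<partial>lborel)"
      proof (rule nn_integral_cong)
        fix s
        show "V s * indicator {u<..v} s = V v * indicator {u<..v} s"
        proof (cases "s \<in> {u<..v}")
          case True
          show ?thesis by (rule arg_cong2[OF const[OF True] refl])
        qed simp
      qed
      also have "\<dots> = V v * ennreal (v - u)" using uv by (simp add: nn_integral_cmult_indicator)
      finally show ?thesis using Cp uv by (simp add: ennreal_mult mult_ac)
    qed
    finally show ?thesis .
  qed
  have "Y T \<le> ennreal (exp (k * (T - 0))) * (Y 0 + ennreal (Cp * 2 powr p) * (\<integral>\<^sup>+s\<in>{0<..T}. V s \<partial>lborel))"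
    by (rule gronwall_breakpoints[OF fin k _ base]) (use T_pos in auto)
  also have "\<dots> \<le> ennreal (exp (k * T)) * (ennreal (Cp * 2 powr p) * (\<integral>\<^sup>+s\<in>{0..T}. V s \<partial>lborel))"
  proof -
    have "Y 0 = 0" using truncated_integral_0[OF L] by (simp add: Y_def)
    moreover have "(\<integral>\<^sup>+s\<in>{0<..T}. V s \<partial>lborel) \<le> (\<integral>\<^sup>+s\<in>{0..T}. V s \<partial>lborel)"
      by (intro nn_integral_mono) (auto split: split_indicator)
    ultimately show ?thesis by (simp add: mult_left_mono)
  qed
  finally show ?thesis
    using Cp k by (simp add: Y_def V_def k_def truncated_integral_T[OF L] ennreal_mult mult.assoc)
qed

lemma elementary_moment_bound:
  assumes p: "2 \<le> p"
  shows "\<exists>C\<ge>0. \<forall>L. elementary T F \<nu> L \<longrightarrow>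
    (\<integral>\<^sup>+\<omega>. ennreal (\<bar>elem_integral \<nu> \<mu> L \<omega>\<bar> powr p) \<partial>M) \<le> ennreal C * (\<integral>\<^sup>+s\<in>{0..T}. moment M \<nu> p (elem_fun L) s \<partial>lborel)"
proof -
  obtain Cp where Cp: "0 \<le> Cp" "\<And>a b::real. \<bar>a + b\<bar> powr p \<le>
      \<bar>a\<bar> powr p + p * (a * \<bar>a\<bar> powr (p - 2)) * b + Cp * (\<bar>a\<bar> powr (p - 2) * b\<^sup>2 + \<bar>b\<bar> powr p)"
    using abs_add_powr_le[OF p] by blast
  show ?thesis
    by (intro exI[of _ "exp ((Cp * 2 powr p + 1) * T) * (Cp * 2 powr p)"] conjI allI impI elementary_moment_le p Cp) (use Cp in auto)
qed

end

section \<open>Density of the elementary integrands\<close>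

definition elem_scale :: "real \<Rightarrow> ('z, 'w) elem \<Rightarrow> ('z, 'w) elem" where
  "elem_scale c L = map (\<lambda>(a, b, A, \<xi>). (a, b, A, \<lambda>\<omega>. c * \<xi> \<omega>)) L"

text \<open>The outer maximum keeps the interval bounds ordered when the two intervals are disjoint.\<close>

definition elem_times1 :: "real \<times> real \<times> 'z set \<times> ('w \<Rightarrow> real) \<Rightarrow> ('z, 'w) elem \<Rightarrow> ('z, 'w) elem" where
  "elem_times1 e L = map (\<lambda>(a', b', A', \<xi>'). case e of (a, b, A, \<xi>) \<Rightarrow>
     (max a a', max (max a a') (min b b'), A \<inter> A', \<lambda>\<omega>. \<xi> \<omega> * \<xi>' \<omega>)) L"

text \<open>Products are needed for inclusion and exclusion: if two elementary integrands take only
  the values 0 and 1, so does their sum minus their product, which stands for a union.\<close>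

definition elem_times :: "('z, 'w) elem \<Rightarrow> ('z, 'w) elem \<Rightarrow> ('z, 'w) elem" where
  "elem_times L L' = concat (map (\<lambda>e. elem_times1 e L') L)"

lemma elem_fun_append: "elem_fun (L @ L') s z \<omega> = elem_fun L s z \<omega> + elem_fun L' s z \<omega>"
  by (simp add: elem_fun_def)

lemma elem_integral_append: "elem_integral \<nu> \<mu> (L @ L') \<omega> = elem_integral \<nu> \<mu> L \<omega> + elem_integral \<nu> \<mu> L' \<omega>"
  by (simp add: elem_integral_def)

lemma elem_fun_scale: "elem_fun (elem_scale c L) s z \<omega> = c * elem_fun L s z \<omega>"
  by (induction L) (auto simp: elem_fun_def elem_scale_def algebra_simps)

lemma elem_integral_scale: "elem_integral \<nu> \<mu> (elem_scale c L) \<omega> = c * elem_integral \<nu> \<mu> L \<omega>"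
  by (induction L) (auto simp: elem_integral_def elem_scale_def algebra_simps)

lemma elem_fun_times1:
  "elem_fun (elem_times1 (a, b, A, \<xi>) L) s z \<omega> = (\<xi> \<omega> * indicator {a<..b} s * indicator A z) * elem_fun L s z \<omega>"
proof (induction L)
  case (Cons e L)
  obtain a' b' A' \<xi>' where e: "e = (a', b', A', \<xi>')" by (cases e)
  have "indicator {max a a'<..max (max a a') (min b b')} s = indicator {a<..b} s * (indicator {a'<..b'} s :: real)"
    by (auto split: split_indicator)
  moreover have "elem_fun (elem_times1 (a, b, A, \<xi>) (e # L)) s z \<omega> =
    \<xi> \<omega> * \<xi>' \<omega> * indicator {max a a'<..max (max a a') (min b b')} s * indicator (A \<inter> A') z
      + elem_fun (elem_times1 (a, b, A, \<xi>) L) s z \<omega>"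
    by (simp add: elem_fun_def elem_times1_def e)
  moreover have "elem_fun (e # L) s z \<omega> = \<xi>' \<omega> * indicator {a'<..b'} s * indicator A' z + elem_fun L s z \<omega>"
    by (simp add: elem_fun_def e)
  ultimately show ?case using Cons by (simp add: algebra_simps indicator_inter_arith)
qed (simp add: elem_fun_def elem_times1_def)

lemma elem_fun_times: "elem_fun (elem_times L L') s z \<omega> = elem_fun L s z \<omega> * elem_fun L' s z \<omega>"
proof (induction L)
  case (Cons e L)
  obtain a b A \<xi> where e: "e = (a, b, A, \<xi>)" by (cases e)
  have "elem_fun (elem_times (e # L) L') s z \<omega> = elem_fun (elem_times1 e L') s z \<omega> + elem_fun (elem_times L L') s z \<omega>"
    by (simp add: elem_times_def elem_fun_append)
  moreover have "elem_fun (e # L) s z \<omega> = \<xi> \<omega> * indicator {a<..b} s * indicator A z + elem_fun L s z \<omega>"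
    by (simp add: elem_fun_def e)
  ultimately show ?case using Cons by (simp add: e elem_fun_times1 algebra_simps)
qed (simp add: elem_fun_def elem_times_def)

text \<open>The argument order groups time with chance, as in the product of the predictable
  \<sigma>-algebra with the marks.\<close>

definition uncurried :: "(real \<Rightarrow> 'z \<Rightarrow> 'w \<Rightarrow> real) \<Rightarrow> (real \<times> 'w) \<times> 'z \<Rightarrow> real" where
  "uncurried f x = f (fst (fst x)) (snd x) (snd (fst x))"

lemma uncurried_conv: "(\<lambda>((s, \<omega>), z). f s z \<omega>) = uncurried f"
  by (auto simp: uncurried_def)

context poisson_basis
begin

lemma elementary_append: "elementary T F \<nu> (L @ L') \<longleftrightarrow> elementary T F \<nu> L \<and> elementary T F \<nu> L'"
  by (simp add: elementary_def ball_Un)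

lemma elementary_scale:
  assumes "elementary T F \<nu> L" shows "elementary T F \<nu> (elem_scale c L)"
  unfolding elementary_def
proof safe
  fix a b A \<xi>' assume "(a, b, A, \<xi>') \<in> set (elem_scale c L)"
  then obtain \<xi> where \<xi>: "(a, b, A, \<xi>) \<in> set L" "\<xi>' = (\<lambda>\<omega>. c * \<xi> \<omega>)"
    by (auto simp: elem_scale_def)
  note D = elementaryD[OF assms \<xi>(1)]
  show "0 \<le> a" "a \<le> b" "b \<le> T" "A \<in> sets \<nu>" "emeasure \<nu> A < \<infinity>" by fact+
  show "\<xi>' \<in> borel_measurable (F a)" unfolding \<xi> using D by simp
  obtain C where C: "\<forall>\<omega>\<in>space M. \<bar>\<xi> \<omega>\<bar> \<le> C" using D by auto
  have "\<forall>\<omega>\<in>space (F a). \<bar>\<xi>' \<omega>\<bar> \<le> \<bar>c\<bar> * C"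
    using C D unfolding \<xi> by (auto simp: space_F abs_mult intro!: mult_left_mono)
  then show "\<exists>C. \<forall>\<omega>\<in>space (F a). \<bar>\<xi>' \<omega>\<bar> \<le> C" by blast
qed

lemma elementary_times:
  assumes L: "elementary T F \<nu> L" and L': "elementary T F \<nu> L'" shows "elementary T F \<nu> (elem_times L L')"
  unfolding elementary_def
proof safe
  fix a b A \<xi> assume "(a, b, A, \<xi>) \<in> set (elem_times L L')"
  then obtain a1 b1 A1 \<xi>1 a2 b2 A2 \<xi>2 where e1: "(a1, b1, A1, \<xi>1) \<in> set L" and e2: "(a2, b2, A2, \<xi>2) \<in> set L'"
    and eq: "a = max a1 a2" "b = max (max a1 a2) (min b1 b2)" "A = A1 \<inter> A2" "\<xi> = (\<lambda>\<omega>. \<xi>1 \<omega> * \<xi>2 \<omega>)"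
    unfolding elem_times_def elem_times1_def by fastforce
  note D1 = elementaryD[OF L e1] and D2 = elementaryD[OF L' e2]
  show "0 \<le> a" "a \<le> b" "b \<le> T" "A \<in> sets \<nu>" using D1 D2 by (auto simp: eq)
  have "emeasure \<nu> A \<le> emeasure \<nu> A1" using D1 by (intro emeasure_mono) (auto simp: eq)
  then show "emeasure \<nu> A < \<infinity>" using D1 by simp
  have "\<xi>1 \<in> borel_measurable (F a)" using D1 D2 by (intro F_mono[OF _ _ _ D1(6)]) (auto simp: eq)
  moreover have "\<xi>2 \<in> borel_measurable (F a)" using D1 D2 by (intro F_mono[OF _ _ _ D2(6)]) (auto simp: eq)
  ultimately show "\<xi> \<in> borel_measurable (F a)" unfolding eq(4) by simp
  obtain C1 where C1: "\<forall>\<omega>\<in>space M. \<bar>\<xi>1 \<omega>\<bar> \<le> C1" using D1 by auto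
  obtain C2 where C2: "\<forall>\<omega>\<in>space M. \<bar>\<xi>2 \<omega>\<bar> \<le> C2" using D2 by auto
  have "\<forall>\<omega>\<in>space M. \<bar>\<xi> \<omega>\<bar> \<le> C1 * C2"
    using C1 C2 unfolding eq(4) by (auto simp: abs_mult intro!: mult_mono intro: order_trans[OF abs_ge_zero])
  moreover have "space (F a) = space M" using D1 D2 by (intro space_F) (auto simp: eq)
  ultimately show "\<exists>C. \<forall>\<omega>\<in>space (F a). \<bar>\<xi> \<omega>\<bar> \<le> C" by auto
qed

lemma elem_fun_outside:
  assumes "elementary T F \<nu> L" "s \<notin> {0<..T}" shows "elem_fun L s z \<omega> = 0"
  using assms by (induction L) (auto simp: elem_fun_def elementary_Cons split: split_indicator)

section \<open>The product of time, chance and marks, and its predictable part\<close>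

abbreviation Tm :: "real measure" where "Tm \<equiv> restrict_space lborel {0..T}"
abbreviation Pred :: "(real \<times> 'w) measure" where "Pred \<equiv> predictable_sigma M T F"
abbreviation Prod :: "((real \<times> 'w) \<times> 'z) measure" where "Prod \<equiv> (Tm \<Otimes>\<^sub>M M) \<Otimes>\<^sub>M \<nu>"

lemma sets_Tm: "A \<in> sets borel \<Longrightarrow> A \<subseteq> {0..T} \<Longrightarrow> A \<in> sets Tm"
  by (auto simp: sets_restrict_space intro!: image_eqI[where x=A])

sublocale Tm: finite_measure Tm
proof (rule finite_measureI)
  have "emeasure Tm (space Tm) = emeasure lborel {0..T}"
    unfolding space_restrict_space by (subst emeasure_restrict_space) auto
  then show "emeasure Tm (space Tm) \<noteq> \<infinity>" using T_pos by simp
qed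

sublocale TmM: finite_measure "Tm \<Otimes>\<^sub>M M"
proof (rule finite_measureI)
  have "emeasure (Tm \<Otimes>\<^sub>M M) (space Tm \<times> space M) = emeasure Tm (space Tm) * emeasure M (space M)"
    by (intro emeasure_pair_measure_Times sets.top)
  then show "emeasure (Tm \<Otimes>\<^sub>M M) (space (Tm \<Otimes>\<^sub>M M)) \<noteq> \<infinity>"
    using Tm.emeasure_finite[of "space Tm"] by (simp add: space_pair_measure emeasure_space_1)
qed

lemma predictable_rectangles:
  "{{0} \<times> A |A. A \<in> sets (F 0)} \<union>
    {{s<..t} \<times> A |s t A. 0 \<le> s \<and> s < t \<and> t \<le> T \<and> A \<in> sets (F s)} \<subseteq> Pow ({0..T} \<times> space M)"
proof -
  have "A \<subseteq> space M" if "A \<in> sets (F s)" "0 \<le> s" "s \<le> T" for A s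
    using sets.sets_into_space[OF that(1)] space_F[of s] that by simp
  then show ?thesis using T_pos by (auto, fastforce+)
qed

lemma space_Pred: "space Pred = {0..T} \<times> space M"
  unfolding predictable_sigma_def by (rule space_measure_of[OF predictable_rectangles])

lemma sets_Pred:
  "sets Pred = sigma_sets ({0..T} \<times> space M) ({{0} \<times> A |A. A \<in> sets (F 0)} \<union>
    {{s<..t} \<times> A |s t A. 0 \<le> s \<and> s < t \<and> t \<le> T \<and> A \<in> sets (F s)})"
  unfolding predictable_sigma_def by (rule sets_measure_of[OF predictable_rectangles])

lemma sets_Pred_le: "sets Pred \<subseteq> sets (Tm \<Otimes>\<^sub>M M)"
proof -
  have *: "A \<in> sets M" if "A \<in> sets (F s)" "0 \<le> s" "s \<le> T" for A s
    using subalg[of s] that by (auto simp: subalgebra_def)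
  have "sigma_sets ({0..T} \<times> space M) ({{0} \<times> A |A. A \<in> sets (F 0)} \<union>
      {{s<..t} \<times> A |s t A. 0 \<le> s \<and> s < t \<and> t \<le> T \<and> A \<in> sets (F s)}) \<subseteq> sets (Tm \<Otimes>\<^sub>M M)"
  proof -
    have "{0..T} \<times> space M = space (Tm \<Otimes>\<^sub>M M)" by (simp add: space_pair_measure)
    then show ?thesis
      using * T_pos by (simp only:, intro sets.sigma_sets_subset) (auto intro!: pair_measureI sets_Tm)
  qed
  then show ?thesis by (simp only: sets_Pred)
qed

text \<open>Predictable integrands are thereby jointly measurable, so that Tonelli's theorem and
  convergence theorems are available on \<open>Prod\<close>, while elementary approximation still
  works with the smaller \<sigma>-algebra.\<close>

lemma subalgebra_Prod: "subalgebra Prod (Pred \<Otimes>\<^sub>M \<nu>)"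
proof -
  have sp: "space (Pred \<Otimes>\<^sub>M \<nu>) = space Prod" by (simp add: space_pair_measure space_Pred)
  have "(\<lambda>x. x) \<in> measurable (Tm \<Otimes>\<^sub>M M) Pred"
  proof (rule measurableI)
    fix A assume A: "A \<in> sets Pred"
    then have "A \<subseteq> space (Tm \<Otimes>\<^sub>M M)"
      using sets.sets_into_space[OF A] by (simp add: space_pair_measure space_Pred)
    then have "(\<lambda>x. x) -` A \<inter> space (Tm \<Otimes>\<^sub>M M) = A" by auto
    then show "(\<lambda>x. x) -` A \<inter> space (Tm \<Otimes>\<^sub>M M) \<in> sets (Tm \<Otimes>\<^sub>M M)"
      using A sets_Pred_le by auto
  qed (simp add: space_pair_measure space_Pred)
  then have "(\<lambda>x. (fst x, snd x)) \<in> measurable Prod (Pred \<Otimes>\<^sub>M \<nu>)"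
    by (intro measurable_Pair measurable_compose[OF measurable_fst]) auto
  then have "(\<lambda>x. x) \<in> measurable Prod (Pred \<Otimes>\<^sub>M \<nu>)" by simp
  from measurable_sets[OF this] have "S \<inter> space Prod \<in> sets Prod" if "S \<in> sets (Pred \<Otimes>\<^sub>M \<nu>)" for S
    using that by (simp add: vimage_def)
  moreover have "S \<inter> space Prod = S" if "S \<in> sets (Pred \<Otimes>\<^sub>M \<nu>)" for S
    using sets.sets_into_space[OF that] sp by auto
  ultimately show ?thesis using sp by (auto simp: subalgebra_def)
qed

lemma Pred_measurable: "h \<in> measurable (Pred \<Otimes>\<^sub>M \<nu>) S \<Longrightarrow> h \<in> measurable Prod S"
  by (rule measurable_from_subalg[OF subalgebra_Prod])

lemma Pred_sets: "S \<in> sets (Pred \<Otimes>\<^sub>M \<nu>) \<Longrightarrow> S \<in> sets Prod"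
  using subalgebra_Prod by (auto simp: subalgebra_def)

lemma elem_fun_Prod_measurable:
  assumes "elementary T F \<nu> L"
  shows "uncurried (elem_fun L) \<in> borel_measurable Prod"
proof -
  have "(\<lambda>x. ((fst (fst x), snd (fst x)), snd x)) \<in> measurable Prod ((borel \<Otimes>\<^sub>M M) \<Otimes>\<^sub>M \<nu>)"
    by (intro measurable_Pair measurable_compose[OF measurable_fst] measurable_snd
      measurable_compose[OF measurable_fst measurable_restrict_space1] measurable_ident) auto
  from measurable_compose[OF this elem_fun_measurable[OF assms]]
  show ?thesis by (simp add: uncurried_def[abs_def] split_beta')
qed

lemma nn_integral_Prod:
  assumes [measurable]: "h \<in> borel_measurable Prod"
  shows "(\<integral>\<^sup>+x. h x \<partial>Prod) = (\<integral>\<^sup>+\<omega>. (\<integral>\<^sup>+s\<in>{0..T}. (\<integral>\<^sup>+z. h ((s, \<omega>), z) \<partial>\<nu>) \<partial>lborel) \<partial>M)"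
    and "(\<integral>\<^sup>+x. h x \<partial>Prod) = (\<integral>\<^sup>+s\<in>{0..T}. (\<integral>\<^sup>+\<omega>. (\<integral>\<^sup>+z. h ((s, \<omega>), z) \<partial>\<nu>) \<partial>M) \<partial>lborel)"
proof -
  interpret P: pair_sigma_finite Tm M ..
  have 1: "(\<integral>\<^sup>+x. h x \<partial>Prod) = (\<integral>\<^sup>+y. (\<integral>\<^sup>+z. h (y, z) \<partial>\<nu>) \<partial>(Tm \<Otimes>\<^sub>M M))"
    by (rule nu.nn_integral_fst[symmetric]) fact
  have m: "(\<lambda>y. \<integral>\<^sup>+z. h (y, z) \<partial>\<nu>) \<in> borel_measurable (Tm \<Otimes>\<^sub>M M)"
    by (rule nu.borel_measurable_nn_integral_fst) fact
  have r: "(\<integral>\<^sup>+s. k s \<partial>Tm) = (\<integral>\<^sup>+s\<in>{0..T}. k s \<partial>lborel)" for k :: "real \<Rightarrow> ennreal"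
    by (rule nn_integral_restrict_space) simp
  show "(\<integral>\<^sup>+x. h x \<partial>Prod) = (\<integral>\<^sup>+\<omega>. (\<integral>\<^sup>+s\<in>{0..T}. (\<integral>\<^sup>+z. h ((s, \<omega>), z) \<partial>\<nu>) \<partial>lborel) \<partial>M)"
    unfolding 1 P.nn_integral_snd[OF m, symmetric] r ..
  show "(\<integral>\<^sup>+x. h x \<partial>Prod) = (\<integral>\<^sup>+s\<in>{0..T}. (\<integral>\<^sup>+\<omega>. (\<integral>\<^sup>+z. h ((s, \<omega>), z) \<partial>\<nu>) \<partial>M) \<partial>lborel)"
    unfolding 1 nn_integral_fst[OF m, symmetric] r ..
qed


text \<open>The squared \<open>L\<^sup>2\<close> norm, with values in
  \<open>[0, \<infinity>]\<close> so that estimates carry no integrability conditions. Without the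
  root, the triangle inequality costs a factor 2, which explains the quarters in the approximations
  below.\<close>

definition sqn :: "((real \<times> 'w) \<times> 'z \<Rightarrow> real) \<Rightarrow> ennreal" where
  "sqn h = (\<integral>\<^sup>+x. ennreal ((h x)\<^sup>2) \<partial>Prod)"

lemma sqn_add:
  assumes [measurable]: "h \<in> borel_measurable Prod" "k \<in> borel_measurable Prod"
  shows "sqn (\<lambda>x. h x + k x) \<le> 2 * sqn h + 2 * sqn k"
proof -
  have "(h x + k x)\<^sup>2 \<le> 2 * (h x)\<^sup>2 + 2 * (k x)\<^sup>2" for x
    using sum_squares_bound[of "h x" "k x"] by (simp add: power2_sum)
  then have "sqn (\<lambda>x. h x + k x) \<le> (\<integral>\<^sup>+x. ennreal (2 * (h x)\<^sup>2 + 2 * (k x)\<^sup>2) \<partial>Prod)"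
    unfolding sqn_def by (intro nn_integral_mono ennreal_leI)
  also have "\<dots> = (\<integral>\<^sup>+x. 2 * ennreal ((h x)\<^sup>2) + 2 * ennreal ((k x)\<^sup>2) \<partial>Prod)"
    by (simp add: ennreal_mult)
  also have "\<dots> = 2 * sqn h + 2 * sqn k"
    unfolding sqn_def by (simp add: nn_integral_add nn_integral_cmult)
  finally show ?thesis .
qed

lemma sqn_uminus: "sqn (\<lambda>x. - h x) = sqn h"
  by (simp add: sqn_def)

lemma sqn_minus_commute: "sqn (\<lambda>x. h x - k x) = sqn (\<lambda>x. k x - h x)"
  by (simp add: sqn_def power2_commute)

lemma sqn_scale: "h \<in> borel_measurable Prod \<Longrightarrow> sqn (\<lambda>x. c * h x) = ennreal (c\<^sup>2) * sqn h"
  by (simp add: sqn_def power_mult_distrib ennreal_mult nn_integral_cmult)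

lemma sqn_triangle:
  assumes "h \<in> borel_measurable Prod" "k \<in> borel_measurable Prod" "l \<in> borel_measurable Prod"
  shows "sqn (\<lambda>x. h x - l x) \<le> 2 * sqn (\<lambda>x. h x - k x) + 2 * sqn (\<lambda>x. k x - l x)"
  using sqn_add[of "\<lambda>x. h x - k x" "\<lambda>x. k x - l x"] assms by simp

text \<open>Elementary integrands vanish at time 0, as their intervals are left-open, whereas the
  predictable \<sigma>-algebra has generators of the form \<open>{0} x A\<close>. That slice is null
  and may be ignored.\<close>

lemma AE_time_pos: "AE x in Prod. 0 < fst (fst x)"
proof -
  have 0: "{0} \<in> sets Tm" using T_pos by (intro sets_Tm) auto
  have "emeasure Tm {0} = 0" using T_pos by (subst emeasure_restrict_space) auto
  then have "emeasure (Tm \<Otimes>\<^sub>M M) ({0} \<times> space M) = 0"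
    using 0 by (subst emeasure_pair_measure_Times) auto
  then have "emeasure Prod (({0} \<times> space M) \<times> space \<nu>) = 0"
    using 0 by (subst nu.emeasure_pair_measure_Times) auto
  then have "({0} \<times> space M) \<times> space \<nu> \<in> null_sets Prod"
    using 0 by (intro null_setsI) auto
  from AE_not_in[OF this] AE_space[of Prod] show ?thesis
    by eventually_elim (auto simp: space_pair_measure)
qed

text \<open>
  Approximating by elementary integrands with values \<open>0\<close> and \<open>1\<close> keeps the approximants uniformly
  bounded, so that \<open>L\<^sup>2\<close> convergence controls the higher moments as well.
\<close>

definition is_ind :: "'z set \<Rightarrow> ('z, 'w) elem \<Rightarrow> bool" where
  "is_ind A L \<longleftrightarrow> elementary T F \<nu> L \<and>
     (\<forall>x\<in>space Prod. uncurried (elem_fun L) x \<in> {0, 1} \<and> (snd x \<notin> A \<longrightarrow> uncurried (elem_fun L) x = 0))"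

definition ind_on :: "'z set \<Rightarrow> ((real \<times> 'w) \<times> 'z) set \<Rightarrow> (real \<times> 'w) \<times> 'z \<Rightarrow> real" where
  "ind_on A S x = indicator S x * indicator A (snd x)"

definition approximable :: "'z set \<Rightarrow> ((real \<times> 'w) \<times> 'z) set \<Rightarrow> bool" where
  "approximable A S \<longleftrightarrow> S \<in> sets (Pred \<Otimes>\<^sub>M \<nu>) \<and>
     (\<forall>e>0. \<exists>L. is_ind A L \<and> sqn (\<lambda>x. ind_on A S x - uncurried (elem_fun L) x) \<le> ennreal e)"

lemma uncurried_measurable_elementary: "is_ind A L \<Longrightarrow> uncurried (elem_fun L) \<in> borel_measurable Prod"
  by (simp add: is_ind_def elem_fun_Prod_measurable)

section \<open>Predictable sets approximated by elementary integrands with values 0 and 1\<close>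

context
  fixes A assumes A: "A \<in> sets \<nu>" "emeasure \<nu> A < \<infinity>"
begin

lemma ind_on_measurable [measurable]: "S \<in> sets Prod \<Longrightarrow> ind_on A S \<in> borel_measurable Prod"
  using A unfolding ind_on_def[abs_def]
  by (intro borel_measurable_times borel_measurable_indicator
      measurable_compose[OF measurable_snd borel_measurable_indicator])

definition full :: "('z, 'w) elem" where "full = [(0, T, A, \<lambda>_. 1)]"

lemma full: "elementary T F \<nu> full" "uncurried (elem_fun full) x = indicator {0<..T} (fst (fst x)) * indicator A (snd x)"
  using A T_pos by (auto simp: full_def elementary_def elem_fun_def uncurried_def)

lemma space_Prod_time: "x \<in> space Prod \<Longrightarrow> fst (fst x) \<in> {0..T}"
  by (auto simp: space_pair_measure)

lemma approximableI_exact: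
  assumes "S \<in> sets (Pred \<Otimes>\<^sub>M \<nu>)" "is_ind A L"
    "\<And>x. x \<in> space Prod \<Longrightarrow> 0 < fst (fst x) \<Longrightarrow> ind_on A S x = uncurried (elem_fun L) x"
  shows "approximable A S"
proof -
  have "sqn (\<lambda>x. ind_on A S x - uncurried (elem_fun L) x) = (\<integral>\<^sup>+x. 0 \<partial>Prod)"
    unfolding sqn_def
  proof (rule nn_integral_cong_AE)
    show "AE x in Prod. ennreal ((ind_on A S x - uncurried (elem_fun L) x)\<^sup>2) = 0"
      using AE_time_pos AE_space[of Prod] by eventually_elim (simp add: assms(3))
  qed
  then show ?thesis using assms by (auto simp: approximable_def)
qed

text \<open>\<open>full\<close> is the indicator of \<open>A\<close> outside the null slice at time
  0. Subtracting \<open>L\<close> from it keeps the values in \<open>{0, 1}\<close>, because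
  \<open>L\<close> vanishes off \<open>A\<close> and off \<open>(0, T]\<close>, and it changes only
  the sign of the error.\<close>

lemma approximable_compl:
  assumes "approximable A S" shows "approximable A (space Prod - S)"
  unfolding approximable_def
proof (intro conjI allI impI)
  have S: "S \<in> sets (Pred \<Otimes>\<^sub>M \<nu>)" using assms by (simp add: approximable_def)
  have "space Prod = space (Pred \<Otimes>\<^sub>M \<nu>)" by (simp add: space_pair_measure space_Pred)
  then show "space Prod - S \<in> sets (Pred \<Otimes>\<^sub>M \<nu>)" using S by auto
  fix e :: real assume "0 < e"
  then obtain L where L: "is_ind A L" "sqn (\<lambda>x. ind_on A S x - uncurried (elem_fun L) x) \<le> ennreal e"
    using assms by (auto simp: approximable_def)
  define L' where "L' = full @ elem_scale (- 1) L"
  have eq: "uncurried (elem_fun L') x = indicator {0<..T} (fst (fst x)) * indicator A (snd x) - uncurried (elem_fun L) x" for x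
    using full(2)[of x] by (simp add: L'_def uncurried_def elem_fun_append elem_fun_scale)
  have Ls: "uncurried (elem_fun L) x = 0" if "fst (fst x) \<notin> {0<..T}" for x
    using that L(1) elem_fun_outside unfolding is_ind_def uncurried_def by blast
  have "is_ind A L'"
    unfolding is_ind_def
  proof (intro conjI ballI)
    show "elementary T F \<nu> L'" using L full by (simp add: L'_def elementary_append elementary_scale is_ind_def)
    fix x assume x: "x \<in> space Prod"
    have "uncurried (elem_fun L) x \<in> {0, 1}" "snd x \<notin> A \<longrightarrow> uncurried (elem_fun L) x = 0"
      using L x by (auto simp: is_ind_def)
    then show "uncurried (elem_fun L') x \<in> {0, 1}" "snd x \<notin> A \<longrightarrow> uncurried (elem_fun L') x = 0"
      using Ls[of x] unfolding eq by (auto split: split_indicator)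
  qed
  moreover have "sqn (\<lambda>x. ind_on A (space Prod - S) x - uncurried (elem_fun L') x) \<le> ennreal e"
  proof -
    have "sqn (\<lambda>x. ind_on A (space Prod - S) x - uncurried (elem_fun L') x) = sqn (\<lambda>x. ind_on A S x - uncurried (elem_fun L) x)"
      unfolding sqn_def
    proof (rule nn_integral_cong_AE)
      show "AE x in Prod. ennreal ((ind_on A (space Prod - S) x - uncurried (elem_fun L') x)\<^sup>2)
        = ennreal ((ind_on A S x - uncurried (elem_fun L) x)\<^sup>2)"
        using AE_time_pos AE_space[of Prod]
      proof eventually_elim
        case (elim x)
        then have "ind_on A (space Prod - S) x - uncurried (elem_fun L') x = - (ind_on A S x - uncurried (elem_fun L) x)"
          using space_Prod_time[of x] unfolding eq by (auto simp: ind_on_def split: split_indicator)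
        then show ?case by (simp only: power2_minus)
      qed
    qed
    then show ?thesis using L by simp
  qed
  ultimately show "\<exists>L. is_ind A L \<and> sqn (\<lambda>x. ind_on A (space Prod - S) x - uncurried (elem_fun L) x) \<le> ennreal e"
    by blast
qed

text \<open>Inclusion and exclusion: for values in \<open>{0, 1}\<close> the error of
  \<open>f + g - f * g\<close> is at most the sum of the errors of \<open>f\<close> and
  \<open>g\<close>. By \<open>sqn_add\<close>, an accuracy of \<open>e / 4\<close> for each gives
  \<open>e\<close>.\<close>

lemma approximable_Un:
  assumes S1: "approximable A S1" and S2: "approximable A S2" shows "approximable A (S1 \<union> S2)"
  unfolding approximable_def
proof (intro conjI allI impI)
  show "S1 \<union> S2 \<in> sets (Pred \<Otimes>\<^sub>M \<nu>)" using S1 S2 by (auto simp: approximable_def)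
  have m [measurable]: "S1 \<in> sets Prod" "S2 \<in> sets Prod" using S1 S2 by (auto simp: approximable_def Pred_sets)
  fix e :: real assume e: "0 < e"
  obtain L1 where L1: "is_ind A L1" "sqn (\<lambda>x. ind_on A S1 x - uncurried (elem_fun L1) x) \<le> ennreal (e / 4)"
    using S1 e unfolding approximable_def by (metis divide_pos_pos zero_less_numeral)
  obtain L2 where L2: "is_ind A L2" "sqn (\<lambda>x. ind_on A S2 x - uncurried (elem_fun L2) x) \<le> ennreal (e / 4)"
    using S2 e unfolding approximable_def by (metis divide_pos_pos zero_less_numeral)
  note [measurable] = uncurried_measurable_elementary[OF L1(1)] uncurried_measurable_elementary[OF L2(1)]
  define L where "L = L1 @ L2 @ elem_scale (- 1) (elem_times L1 L2)"
  have eq: "uncurried (elem_fun L) x = uncurried (elem_fun L1) x + uncurried (elem_fun L2) x - uncurried (elem_fun L1) x * uncurried (elem_fun L2) x" for x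
    by (simp add: L_def uncurried_def elem_fun_append elem_fun_scale elem_fun_times)
  have "is_ind A L"
    unfolding is_ind_def
  proof (intro conjI ballI)
    show "elementary T F \<nu> L" using L1 L2 by (simp add: L_def elementary_append elementary_scale elementary_times is_ind_def)
    fix x assume x: "x \<in> space Prod"
    then have "uncurried (elem_fun L1) x \<in> {0, 1}" "snd x \<notin> A \<longrightarrow> uncurried (elem_fun L1) x = 0"
      "uncurried (elem_fun L2) x \<in> {0, 1}" "snd x \<notin> A \<longrightarrow> uncurried (elem_fun L2) x = 0"
      using L1 L2 by (auto simp: is_ind_def)
    then show "uncurried (elem_fun L) x \<in> {0, 1}" "snd x \<notin> A \<longrightarrow> uncurried (elem_fun L) x = 0"
      unfolding eq by auto
  qed
  moreover have "sqn (\<lambda>x. ind_on A (S1 \<union> S2) x - uncurried (elem_fun L) x) \<le> ennreal e"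
  proof -
    let ?d1 = "\<lambda>x. ind_on A S1 x - uncurried (elem_fun L1) x"
    let ?d2 = "\<lambda>x. ind_on A S2 x - uncurried (elem_fun L2) x"
    have "sqn (\<lambda>x. ind_on A (S1 \<union> S2) x - uncurried (elem_fun L) x) \<le> sqn (\<lambda>x. \<bar>?d1 x\<bar> + \<bar>?d2 x\<bar>)"
      unfolding sqn_def
    proof (intro nn_integral_mono ennreal_leI)
      fix x assume x: "x \<in> space Prod"
      have a: "uncurried (elem_fun L1) x \<in> {0, 1}" "uncurried (elem_fun L2) x \<in> {0, 1}"
        "snd x \<notin> A \<Longrightarrow> uncurried (elem_fun L1) x = 0" "snd x \<notin> A \<Longrightarrow> uncurried (elem_fun L2) x = 0"
        using L1 L2 x by (auto simp: is_ind_def)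
      have "\<bar>ind_on A (S1 \<union> S2) x - uncurried (elem_fun L) x\<bar> \<le> \<bar>?d1 x\<bar> + \<bar>?d2 x\<bar>"
        using a unfolding eq ind_on_def by (auto split: split_indicator)
      then show "(ind_on A (S1 \<union> S2) x - uncurried (elem_fun L) x)\<^sup>2 \<le> (\<bar>?d1 x\<bar> + \<bar>?d2 x\<bar>)\<^sup>2"
        using abs_le_square_iff by fastforce
    qed
    also have "\<dots> \<le> 2 * sqn (\<lambda>x. \<bar>?d1 x\<bar>) + 2 * sqn (\<lambda>x. \<bar>?d2 x\<bar>)"
      by (intro sqn_add) measurable
    also have "\<dots> = 2 * sqn ?d1 + 2 * sqn ?d2" by (simp add: sqn_def)
    also have "\<dots> \<le> 2 * ennreal (e / 4) + 2 * ennreal (e / 4)"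
      using L1 L2 by (intro add_mono mult_left_mono) auto
    also have "\<dots> = ennreal (2 * (e / 4) + 2 * (e / 4))" using e by (simp add: ennreal_mult' flip: ennreal_numeral ennreal_plus ennreal_mult)
    finally show ?thesis by simp
  qed
  ultimately show "\<exists>L. is_ind A L \<and> sqn (\<lambda>x. ind_on A (S1 \<union> S2) x - uncurried (elem_fun L) x) \<le> ennreal e"
    by blast
qed

lemma emeasure_Prod_A_finite: "emeasure Prod (S \<inter> space (Tm \<Otimes>\<^sub>M M) \<times> A) < \<infinity>"
proof -
  have "emeasure Prod (S \<inter> space (Tm \<Otimes>\<^sub>M M) \<times> A) \<le> emeasure Prod (space (Tm \<Otimes>\<^sub>M M) \<times> A)"
    using A by (intro emeasure_mono pair_measureI) auto
  also have "\<dots> = emeasure (Tm \<Otimes>\<^sub>M M) (space (Tm \<Otimes>\<^sub>M M)) * emeasure \<nu> A"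
    using A by (subst nu.emeasure_pair_measure_Times) auto
  also have "\<dots> < \<infinity>" using A TmM.emeasure_finite[of "space (Tm \<Otimes>\<^sub>M M)"]
    by (auto simp: ennreal_mult_eq_top_iff less_top[symmetric])
  finally show ?thesis .
qed

text \<open>Finite unions are approximable, and the remainders \<open>R n\<close> decrease to the
  empty set. Their measure tends to 0 because it is finite, the mark set \<open>A\<close> having
  finite mass; this is why approximation takes place relative to a fixed \<open>A\<close>.\<close>

lemma approximable_UN:
  assumes S: "\<And>i::nat. approximable A (S i)" shows "approximable A (\<Union>i. S i)"
  unfolding approximable_def
proof (intro conjI allI impI)
  show "(\<Union>i. S i) \<in> sets (Pred \<Otimes>\<^sub>M \<nu>)" using S by (auto simp: approximable_def)
  have m: "S i \<in> sets Prod" for i using S by (auto simp: approximable_def Pred_sets)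
  fix e :: real assume e: "0 < e"
  define U where "U n = (\<Union>i\<le>n. S i)" for n
  have U: "approximable A (U n)" for n
  proof (induction n)
    case (Suc n)
    have "U (Suc n) = U n \<union> S (Suc n)" by (auto simp: U_def le_Suc_eq)
    then show ?case using approximable_Un[OF Suc S] by simp
  qed (simp add: U_def S)
  have mU: "U n \<in> sets Prod" for n using U by (auto simp: approximable_def Pred_sets)
  let ?S = "\<Union>i. S i"
  have mS: "?S \<in> sets Prod" using m by auto
  let ?A = "space (Tm \<Otimes>\<^sub>M M) \<times> A"
  define R where "R n = (?S - U n) \<inter> ?A" for n
  have mA: "?A \<in> sets Prod" using A by (intro pair_measureI) auto
  have mR: "R n \<in> sets Prod" for n using mU mS mA by (auto simp: R_def)
  have "(\<lambda>n. emeasure Prod (R n)) \<longlonglongrightarrow> emeasure Prod (\<Inter>n. R n)"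
  proof (rule Lim_emeasure_decseq)
    show "range R \<subseteq> sets Prod" using mR by auto
    show "decseq R" by (auto simp: decseq_def R_def U_def; force)
    show "emeasure Prod (R n) \<noteq> \<infinity>" for n unfolding R_def using emeasure_Prod_A_finite[of "?S - U n"] by simp
  qed
  moreover have "(\<Inter>n. R n) = {}" by (auto simp: R_def U_def)
  ultimately have "(\<lambda>n. emeasure Prod (R n)) \<longlonglongrightarrow> 0" by simp
  then have "eventually (\<lambda>n. emeasure Prod (R n) < ennreal (e / 4)) sequentially"
    by (rule order_tendstoD) (use e in simp)
  then obtain n where n: "emeasure Prod (R n) < ennreal (e / 4)" by (auto simp: eventually_sequentially)
  obtain L where L: "is_ind A L" "sqn (\<lambda>x. ind_on A (U n) x - uncurried (elem_fun L) x) \<le> ennreal (e / 4)"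
    using U[of n] e unfolding approximable_def by (metis divide_pos_pos zero_less_numeral)
  have d: "sqn (\<lambda>x. ind_on A ?S x - ind_on A (U n) x) \<le> ennreal (e / 4)"
  proof -
    have "sqn (\<lambda>x. ind_on A ?S x - ind_on A (U n) x) = (\<integral>\<^sup>+x. indicator (R n) x \<partial>Prod)"
      unfolding sqn_def by (intro nn_integral_cong) (auto simp: R_def ind_on_def U_def space_pair_measure split: split_indicator)
    then show ?thesis using n mR by simp
  qed
  have "sqn (\<lambda>x. ind_on A ?S x - uncurried (elem_fun L) x) \<le> 2 * sqn (\<lambda>x. ind_on A ?S x - ind_on A (U n) x) + 2 * sqn (\<lambda>x. ind_on A (U n) x - uncurried (elem_fun L) x)"
    by (intro sqn_triangle ind_on_measurable mS mU uncurried_measurable_elementary[OF L(1)])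
  also have "\<dots> \<le> 2 * ennreal (e / 4) + 2 * ennreal (e / 4)"
    using L d by (intro add_mono mult_left_mono) auto
  also have "\<dots> = ennreal (2 * (e / 4) + 2 * (e / 4))" using e by (simp add: ennreal_mult' flip: ennreal_numeral ennreal_plus ennreal_mult)
  finally have "sqn (\<lambda>x. ind_on A ?S x - uncurried (elem_fun L) x) \<le> ennreal e" by simp
  then show "\<exists>L. is_ind A L \<and> sqn (\<lambda>x. ind_on A ?S x - uncurried (elem_fun L) x) \<le> ennreal e"
    using L by blast
qed

lemma approximable_empty: "approximable A {}"
proof (rule approximableI_exact[where L="[]"])
  show "is_ind A []" by (simp add: is_ind_def elementary_def uncurried_def elem_fun_def)
qed (auto simp: ind_on_def uncurried_def elem_fun_def)

lemma approximable_Int: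
  assumes "approximable A S1" "approximable A S2" shows "approximable A (S1 \<inter> S2)"
proof -
  have "S1 \<inter> S2 = space Prod - ((space Prod - S1) \<union> (space Prod - S2))"
    using assms sets.sets_into_space[OF Pred_sets] by (auto simp: approximable_def)
  then show ?thesis using approximable_compl[OF approximable_Un[OF approximable_compl approximable_compl]] assms by simp
qed

text \<open>A generator \<open>(s, t] x B\<close> is represented exactly by one elementary summand
  with coefficient \<open>indicator B\<close>, and a generator at time 0 by the empty list, up to a
  null set. The closure properties do the rest.\<close>

lemma approximable_Pred:
  assumes "a \<in> sets Pred" shows "approximable A (a \<times> space \<nu>)"
proof -
  let ?G = "{{0} \<times> B |B. B \<in> sets (F 0)} \<union> {{s<..t} \<times> B |s t B. 0 \<le> s \<and> s < t \<and> t \<le> T \<and> B \<in> sets (F s)}"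
  have "a \<in> sigma_sets ({0..T} \<times> space M) ?G" using assms sets_Pred by simp
  then show ?thesis
  proof (induction a rule: sigma_sets.induct)
    case (Basic a)
    then have aP: "a \<in> sets Pred" unfolding sets_Pred by (rule sigma_sets.Basic)
    then have a: "a \<times> space \<nu> \<in> sets (Pred \<Otimes>\<^sub>M \<nu>)" by auto
    from Basic show ?case
    proof
      assume "a \<in> {{0} \<times> B |B. B \<in> sets (F 0)}"
      then show ?thesis
        by (intro approximableI_exact[OF a, where L="[]"])
           (auto simp: is_ind_def elementary_def uncurried_def elem_fun_def ind_on_def)
    next
      assume "a \<in> {{s<..t} \<times> B |s t B. 0 \<le> s \<and> s < t \<and> t \<le> T \<and> B \<in> sets (F s)}"
      then obtain s t B where B: "a = {s<..t} \<times> B" "0 \<le> s" "s < t" "t \<le> T" "B \<in> sets (F s)" by auto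
      show ?thesis
      proof (rule approximableI_exact[OF a, where L="[(s, t, A, indicator B)]"])
        have "elementary T F \<nu> [(s, t, A, indicator B)]"
          using B A by (auto simp: elementary_def intro!: exI[of _ 1])
        then show "is_ind A [(s, t, A, indicator B)]"
          by (auto simp: is_ind_def uncurried_def elem_fun_def split: split_indicator)
      qed (auto simp: ind_on_def uncurried_def elem_fun_def B space_pair_measure split: split_indicator)
    qed
  next
    case Empty
    then show ?case using approximable_empty by simp
  next
    case (Compl a)
    have "({0..T} \<times> space M - a) \<times> space \<nu> = space Prod - a \<times> space \<nu>"
      by (auto simp: space_pair_measure)
    then show ?case using approximable_compl[OF Compl.IH] by simp
  next
    case (Union a)
    have "(\<Union>i. a i) \<times> space \<nu> = (\<Union>i. a i \<times> space \<nu>)" by auto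
    then show ?case using approximable_UN[OF Union.IH] by simp
  qed
qed

lemma approximable_nu:
  assumes "b \<in> sets \<nu>" shows "approximable A (space Pred \<times> b)"
proof (rule approximableI_exact[where L="[(0, T, A \<inter> b, \<lambda>_. 1)]"])
  have "emeasure \<nu> (A \<inter> b) < \<infinity>"
    using A assms by (meson emeasure_mono inf_le1 order_le_less_trans)
  then show "is_ind A [(0, T, A \<inter> b, \<lambda>_. 1)]"
    using A assms T_pos by (auto simp: is_ind_def elementary_def uncurried_def elem_fun_def split: split_indicator)
  show "space Pred \<times> b \<in> sets (Pred \<Otimes>\<^sub>M \<nu>)" using assms by auto
qed (auto simp: ind_on_def uncurried_def elem_fun_def space_Pred space_pair_measure split: split_indicator)

text \<open>A measurable rectangle is the intersection of two cylinders that are already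
  approximable; complements and countable unions then reach the whole product
  \<sigma>-algebra.\<close>

lemma approximable_all:
  assumes "S \<in> sets (Pred \<Otimes>\<^sub>M \<nu>)" shows "approximable A S"
proof -
  have "S \<in> sigma_sets (space Pred \<times> space \<nu>) {a \<times> b |a b. a \<in> sets Pred \<and> b \<in> sets \<nu>}"
    using assms by (simp add: sets_pair_measure)
  then show ?thesis
  proof (induction S rule: sigma_sets.induct)
    case (Basic S)
    then obtain a b where ab: "S = a \<times> b" "a \<in> sets Pred" "b \<in> sets \<nu>" by auto
    have "S = (a \<times> space \<nu>) \<inter> (space Pred \<times> b)"
      using ab sets.sets_into_space[of a Pred] sets.sets_into_space[of b \<nu>] by auto
    then show ?case using approximable_Int[OF approximable_Pred approximable_nu] ab by simp
  next
    case Empty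
    then show ?case by (rule approximable_empty)
  next
    case (Compl S)
    have "space Pred \<times> space \<nu> - S = space Prod - S" by (simp add: space_pair_measure space_Pred)
    then show ?case using approximable_compl[OF Compl.IH] by simp
  next
    case (Union S)
    then show ?case by (intro approximable_UN)
  qed
qed

text \<open>The uniform bound by the sum of the values and the support in \<open>A\<close> do not
  depend on the accuracy \<open>e\<close>. This allows \<open>mixed_moment_bounded\<close> to fix
  its constant before \<open>e\<close> is chosen.\<close>

lemma approximate_simple:
  assumes V: "finite V" and S: "\<And>y. y \<in> V \<Longrightarrow> S y \<in> sets (Pred \<Otimes>\<^sub>M \<nu>)" and e: "0 < e"
  shows "\<exists>L. elementary T F \<nu> L \<and>
    (\<forall>x\<in>space Prod. \<bar>uncurried (elem_fun L) x\<bar> \<le> (\<Sum>y\<in>V. \<bar>y\<bar>) \<and> (snd x \<notin> A \<longrightarrow> uncurried (elem_fun L) x = 0)) \<and>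
    sqn (\<lambda>x. (\<Sum>y\<in>V. y * ind_on A (S y) x) - uncurried (elem_fun L) x) \<le> ennreal e"
  using V S e
proof (induction V arbitrary: e rule: finite_induct)
  case empty
  then show ?case
    by (intro exI[of _ "[]"]) (auto simp: elementary_def uncurried_def elem_fun_def sqn_def)
next
  case (insert y V)
  have Sm: "S w \<in> sets Prod" if "w \<in> insert y V" for w using insert.prems that by (auto simp: Pred_sets)
  obtain L1 where L1: "elementary T F \<nu> L1"
      "\<And>x. x \<in> space Prod \<Longrightarrow> \<bar>uncurried (elem_fun L1) x\<bar> \<le> (\<Sum>y\<in>V. \<bar>y\<bar>)"
      "\<And>x. x \<in> space Prod \<Longrightarrow> snd x \<notin> A \<longrightarrow> uncurried (elem_fun L1) x = 0"
    and L1e: "sqn (\<lambda>x. (\<Sum>y\<in>V. y * ind_on A (S y) x) - uncurried (elem_fun L1) x) \<le> ennreal (e / 4)"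
    using insert.IH[of "e / 4"] insert.prems by force
  \<comment> \<open>Scaling by \<open>y\<close> multiplies the squared norm by
    \<open>y\<^sup>2\<close>; the added 1 avoids division by zero.\<close>
  have ey: "0 < e / (4 * (y\<^sup>2 + 1))" using insert.prems by (simp add: add_nonneg_pos)
  from approximable_all[OF insert.prems(1)[of y]]
  obtain L2 where L2: "is_ind A L2" "sqn (\<lambda>x. ind_on A (S y) x - uncurried (elem_fun L2) x) \<le> ennreal (e / (4 * (y\<^sup>2 + 1)))"
    unfolding approximable_def using ey by blast
  define L where "L = L1 @ elem_scale y L2"
  have eq: "uncurried (elem_fun L) x = uncurried (elem_fun L1) x + y * uncurried (elem_fun L2) x" for x
    by (simp add: L_def uncurried_def elem_fun_append elem_fun_scale)
  have el: "elementary T F \<nu> L" using L1 L2 by (simp add: L_def elementary_append elementary_scale is_ind_def)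
  note [measurable] = elem_fun_Prod_measurable[OF L1(1)] uncurried_measurable_elementary[OF L2(1)]
  have [measurable]: "ind_on A (S w) \<in> borel_measurable Prod" if "w \<in> insert y V" for w
    using Sm[OF that] by measurable
  have [measurable]: "ind_on A (S y) \<in> borel_measurable Prod" by simp
  have [measurable]: "(\<lambda>x. \<Sum>y\<in>V. y * ind_on A (S y) x) \<in> borel_measurable Prod"
    by (intro borel_measurable_sum borel_measurable_times) auto
  have "\<bar>uncurried (elem_fun L) x\<bar> \<le> (\<Sum>y\<in>insert y V. \<bar>y\<bar>) \<and> (snd x \<notin> A \<longrightarrow> uncurried (elem_fun L) x = 0)"
    if x: "x \<in> space Prod" for x
  proof -
    have "uncurried (elem_fun L2) x \<in> {0, 1}" "snd x \<notin> A \<longrightarrow> uncurried (elem_fun L2) x = 0"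
      using L2 x by (auto simp: is_ind_def)
    then show ?thesis using L1(2,3)[OF x] insert.hyps unfolding eq by auto
  qed
  moreover have "sqn (\<lambda>x. (\<Sum>y\<in>insert y V. y * ind_on A (S y) x) - uncurried (elem_fun L) x) \<le> ennreal e"
  proof -
    have "(\<lambda>x. (\<Sum>y\<in>insert y V. y * ind_on A (S y) x) - uncurried (elem_fun L) x) =
      (\<lambda>x. ((\<Sum>y\<in>V. y * ind_on A (S y) x) - uncurried (elem_fun L1) x) + y * (ind_on A (S y) x - uncurried (elem_fun L2) x))"
      using insert.hyps unfolding eq by (simp add: algebra_simps)
    then have "sqn (\<lambda>x. (\<Sum>y\<in>insert y V. y * ind_on A (S y) x) - uncurried (elem_fun L) x) \<le>
      2 * sqn (\<lambda>x. (\<Sum>y\<in>V. y * ind_on A (S y) x) - uncurried (elem_fun L1) x) + 2 * sqn (\<lambda>x. y * (ind_on A (S y) x - uncurried (elem_fun L2) x))"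
      using sqn_add[of "\<lambda>x. (\<Sum>y\<in>V. y * ind_on A (S y) x) - uncurried (elem_fun L1) x" "\<lambda>x. y * (ind_on A (S y) x - uncurried (elem_fun L2) x)"]
      by simp
    also have "sqn (\<lambda>x. y * (ind_on A (S y) x - uncurried (elem_fun L2) x)) = ennreal (y\<^sup>2) * sqn (\<lambda>x. ind_on A (S y) x - uncurried (elem_fun L2) x)"
      by (rule sqn_scale) measurable
    also have "2 * sqn (\<lambda>x. (\<Sum>y\<in>V. y * ind_on A (S y) x) - uncurried (elem_fun L1) x) + 2 * (ennreal (y\<^sup>2) * sqn (\<lambda>x. ind_on A (S y) x - uncurried (elem_fun L2) x))
      \<le> 2 * ennreal (e / 4) + 2 * (ennreal (y\<^sup>2) * ennreal (e / (4 * (y\<^sup>2 + 1))))"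
      using L1e L2 by (intro add_mono mult_left_mono) auto
    also have "\<dots> = ennreal (2 * (e / 4) + 2 * (y\<^sup>2 * (e / (4 * (y\<^sup>2 + 1)))))"
      using insert.prems by (simp add: ennreal_mult' flip: ennreal_numeral ennreal_plus ennreal_mult)
    also have "\<dots> \<le> ennreal e"
    proof (rule ennreal_leI)
      have "y\<^sup>2 * (e / (4 * (y\<^sup>2 + 1))) \<le> e / 4"
      proof -
        define w where "w = y\<^sup>2 + 1"
        have w: "0 < w" "y\<^sup>2 \<le> w" unfolding w_def by (auto intro: add_nonneg_pos)
        have "y\<^sup>2 * (e / (4 * w)) \<le> w * (e / (4 * w))"
          using w insert.prems by (intro mult_right_mono) auto
        also have "\<dots> = e / 4" using w by simp
        finally show ?thesis by (simp add: w_def)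
      qed
      then show "2 * (e / 4) + 2 * (y\<^sup>2 * (e / (4 * (y\<^sup>2 + 1)))) \<le> e" by linarith
    qed
    finally show ?thesis .
  qed
  ultimately show ?case using el by blast
qed

end

end

text \<open>The sum of the series has finite integral and is therefore almost everywhere finite. In
  this way geometric decay of integrals gives almost sure convergence along the whole
  sequence.\<close>

lemma AE_summable_of_nn_integral:
  fixes a :: "nat \<Rightarrow> 'a \<Rightarrow> real"
  assumes [measurable]: "\<And>k. a k \<in> borel_measurable M" and nn: "\<And>k x. 0 \<le> a k x"
    and le: "\<And>k. (\<integral>\<^sup>+x. ennreal (a k x) \<partial>M) \<le> ennreal (c * (1/2) ^ k)" and c: "0 \<le> c"
  shows "AE x in M. summable (\<lambda>k. a k x)"
proof -
  have "(\<integral>\<^sup>+x. (\<Sum>k. ennreal (a k x)) \<partial>M) = (\<Sum>k. \<integral>\<^sup>+x. ennreal (a k x) \<partial>M)"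
    by (intro nn_integral_suminf) measurable
  also have "\<dots> \<le> (\<Sum>k. ennreal (c * (1/2) ^ k))"
    using le by (intro suminf_le summableI) auto
  also have "\<dots> = ennreal (c * 2)"
    using c by (intro suminf_ennreal_eq) (auto intro!: sums_mult geometric_sums[of "1/2::real", simplified])
  finally have "(\<integral>\<^sup>+x. (\<Sum>k. ennreal (a k x)) \<partial>M) \<noteq> \<infinity>" by (auto simp: top_unique)
  then have "AE x in M. (\<Sum>k. ennreal (a k x)) \<noteq> \<infinity>"
    by (intro nn_integral_PInf_AE) auto
  then show ?thesis
    by eventually_elim (intro summable_suminf_not_top nn, simp)
qed

section \<open>Mixed moments and approximation that controls them\<close>

context poisson_basis
begin

text \<open>The time integral of \<open>moment\<close>, restated for functions on
  \<open>Prod\<close>, where it can be compared with \<open>sqn\<close>; for \<open>p = 2\<close> it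
  is twice \<open>sqn\<close>.\<close>

definition mixed_moment :: "real \<Rightarrow> ((real \<times> 'w) \<times> 'z \<Rightarrow> real) \<Rightarrow> ennreal" where
  "mixed_moment p h = (\<integral>\<^sup>+y. epowr (\<integral>\<^sup>+z. ennreal ((h (y, z))\<^sup>2) \<partial>\<nu>) (p / 2) + (\<integral>\<^sup>+z. ennreal (\<bar>h (y, z)\<bar> powr p) \<partial>\<nu>) \<partial>(Tm \<Otimes>\<^sub>M M))"

lemma inner_measurable [measurable]:
  assumes [measurable]: "h \<in> borel_measurable Prod"
  shows "(\<lambda>y. \<integral>\<^sup>+z. ennreal ((h (y, z))\<^sup>2) \<partial>\<nu>) \<in> borel_measurable (Tm \<Otimes>\<^sub>M M)"
    "(\<lambda>y. \<integral>\<^sup>+z. ennreal (\<bar>h (y, z)\<bar> powr p) \<partial>\<nu>) \<in> borel_measurable (Tm \<Otimes>\<^sub>M M)"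
  using nu.borel_measurable_nn_integral_fst[of "\<lambda>x. ennreal ((h x)\<^sup>2)" "Tm \<Otimes>\<^sub>M M"]
    nu.borel_measurable_nn_integral_fst[of "\<lambda>x. ennreal (\<bar>h x\<bar> powr p)" "Tm \<Otimes>\<^sub>M M"] by simp_all

lemma section_measurable:
  "h \<in> borel_measurable Prod \<Longrightarrow> y \<in> space (Tm \<Otimes>\<^sub>M M) \<Longrightarrow> (\<lambda>z. h (y, z)) \<in> borel_measurable \<nu>"
  by (rule measurable_compose[OF measurable_Pair1'])

lemma integral_moment_eq_mixed_moment:
  assumes h [measurable]: "uncurried f \<in> borel_measurable Prod"
  shows "(\<integral>\<^sup>+s\<in>{0..T}. moment M \<nu> p f s \<partial>lborel) = mixed_moment p (uncurried f)"
proof -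
  let ?k = "\<lambda>y. epowr (\<integral>\<^sup>+z. ennreal ((uncurried f (y, z))\<^sup>2) \<partial>\<nu>) (p / 2) + (\<integral>\<^sup>+z. ennreal (\<bar>uncurried f (y, z)\<bar> powr p) \<partial>\<nu>)"
  have m: "?k \<in> borel_measurable (Tm \<Otimes>\<^sub>M M)" by measurable
  have "mixed_moment p (uncurried f) = (\<integral>\<^sup>+s. (\<integral>\<^sup>+\<omega>. ?k (s, \<omega>) \<partial>M) \<partial>Tm)"
    unfolding mixed_moment_def by (rule nn_integral_fst[OF m, symmetric])
  also have "\<dots> = (\<integral>\<^sup>+s\<in>{0..T}. (\<integral>\<^sup>+\<omega>. ?k (s, \<omega>) \<partial>M) \<partial>lborel)"
    by (rule nn_integral_restrict_space) simp
  finally show ?thesis by (simp add: moment_def uncurried_def)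
qed

lemma mixed_moment_2:
  assumes [measurable]: "h \<in> borel_measurable Prod" shows "mixed_moment 2 h = 2 * sqn h"
proof -
  have "mixed_moment 2 h = (\<integral>\<^sup>+y. 2 * (\<integral>\<^sup>+z. ennreal ((h (y, z))\<^sup>2) \<partial>\<nu>) \<partial>(Tm \<Otimes>\<^sub>M M))"
    by (simp add: mixed_moment_def mult_2)
  also have "\<dots> = 2 * sqn h"
    using nu.nn_integral_fst[of "\<lambda>x. ennreal ((h x)\<^sup>2)" "Tm \<Otimes>\<^sub>M M"]
    unfolding sqn_def by (simp add: nn_integral_cmult)
  finally show ?thesis .
qed

lemma mixed_moment_mono:
  assumes p: "0 < p" and le: "\<And>x. x \<in> space Prod \<Longrightarrow> \<bar>h x\<bar> \<le> \<bar>k x\<bar>"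
  shows "mixed_moment p h \<le> mixed_moment p k"
  unfolding mixed_moment_def
proof (intro nn_integral_mono add_mono epowr_mono)
  fix y assume y: "y \<in> space (Tm \<Otimes>\<^sub>M M)"
  have *: "\<bar>h (y, z)\<bar> \<le> \<bar>k (y, z)\<bar>" if "z \<in> space \<nu>" for z
    using y that by (intro le) (simp add: space_pair_measure[of "Tm \<Otimes>\<^sub>M M"])
  show "ennreal ((h (y, z))\<^sup>2) \<le> ennreal ((k (y, z))\<^sup>2)" if "z \<in> space \<nu>" for z
    using *[OF that] by (intro ennreal_leI) (simp add: abs_le_square_iff)
  show "ennreal (\<bar>h (y, z)\<bar> powr p) \<le> ennreal (\<bar>k (y, z)\<bar> powr p)" if "z \<in> space \<nu>" for z
    using *[OF that] p by (intro ennreal_leI powr_mono2) auto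
qed (use p in auto)

text \<open>In the quadratic part the square of the sum costs a factor 2, which becomes
  \<open>2 powr (p / 2)\<close>, and splitting the power costs \<open>2 powr (p / 2)\<close> again;
  the product is the \<open>2 powr p\<close> that the other part needs anyway.\<close>

lemma mixed_moment_add:
  assumes p: "2 \<le> p" and [measurable]: "h \<in> borel_measurable Prod" "k \<in> borel_measurable Prod"
  shows "mixed_moment p (\<lambda>x. h x + k x) \<le> ennreal (2 powr p) * (mixed_moment p h + mixed_moment p k)"
proof -
  let ?a = "\<lambda>h y. \<integral>\<^sup>+z. ennreal ((h (y, z))\<^sup>2) \<partial>\<nu>" and ?b = "\<lambda>h y. \<integral>\<^sup>+z. ennreal (\<bar>h (y, z)\<bar> powr p) \<partial>\<nu>"
  have "mixed_moment p (\<lambda>x. h x + k x) \<le> (\<integral>\<^sup>+y. ennreal (2 powr p) * ((epowr (?a h y) (p / 2) + ?b h y) + (epowr (?a k y) (p / 2) + ?b k y)) \<partial>(Tm \<Otimes>\<^sub>M M))"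
    unfolding mixed_moment_def
  proof (rule nn_integral_mono)
    fix y assume y: "y \<in> space (Tm \<Otimes>\<^sub>M M)"
    note [measurable] = section_measurable[OF assms(2) y] section_measurable[OF assms(3) y]
    have "(h (y, z) + k (y, z))\<^sup>2 \<le> 2 * (h (y, z))\<^sup>2 + 2 * (k (y, z))\<^sup>2" for z
      using sum_squares_bound[of "h (y, z)" "k (y, z)"] by (simp add: power2_sum)
    then have "(\<integral>\<^sup>+z. ennreal ((h (y, z) + k (y, z))\<^sup>2) \<partial>\<nu>) \<le> (\<integral>\<^sup>+z. 2 * ennreal ((h (y, z))\<^sup>2) + 2 * ennreal ((k (y, z))\<^sup>2) \<partial>\<nu>)"
      by (intro nn_integral_mono) (simp add: ennreal_leI flip: ennreal_numeral ennreal_mult ennreal_plus)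
    also have "\<dots> = 2 * (?a h y + ?a k y)"
      by (simp add: nn_integral_add nn_integral_cmult distrib_left)
    finally have "epowr (\<integral>\<^sup>+z. ennreal ((h (y, z) + k (y, z))\<^sup>2) \<partial>\<nu>) (p / 2) \<le> epowr (2 * (?a h y + ?a k y)) (p / 2)"
      using p by (intro epowr_mono) auto
    also have "\<dots> = ennreal (2 powr (p / 2)) * epowr (?a h y + ?a k y) (p / 2)"
    proof -
      have "ennreal (2 powr (p / 2)) = epowr 2 (p / 2)" using epowr_ennreal[of 2 "p / 2"] by simp
      then show ?thesis using p by (simp only:, intro epowr_mult) simp
    qed
    also have "\<dots> \<le> ennreal (2 powr (p / 2)) * (ennreal (2 powr (p / 2)) * (epowr (?a h y) (p / 2) + epowr (?a k y) (p / 2)))"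
      using p by (intro mult_left_mono epowr_add_le) auto
    also have "\<dots> = ennreal (2 powr p) * (epowr (?a h y) (p / 2) + epowr (?a k y) (p / 2))"
      by (simp add: mult.assoc[symmetric] flip: ennreal_mult powr_add)
    finally have 1: "epowr (\<integral>\<^sup>+z. ennreal ((h (y, z) + k (y, z))\<^sup>2) \<partial>\<nu>) (p / 2) \<le> \<dots>" .
    have "(\<integral>\<^sup>+z. ennreal (\<bar>h (y, z) + k (y, z)\<bar> powr p) \<partial>\<nu>) \<le> (\<integral>\<^sup>+z. ennreal (2 powr p) * (ennreal (\<bar>h (y, z)\<bar> powr p) + ennreal (\<bar>k (y, z)\<bar> powr p)) \<partial>\<nu>)"
      using abs_add_powr_le_two_powr[of p] p by (intro nn_integral_mono) (simp add: ennreal_leI flip: ennreal_mult ennreal_plus)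
    also have "\<dots> = ennreal (2 powr p) * (?b h y + ?b k y)"
      by (simp add: nn_integral_add nn_integral_cmult)
    finally have "(\<integral>\<^sup>+z. ennreal (\<bar>h (y, z) + k (y, z)\<bar> powr p) \<partial>\<nu>) \<le> \<dots>" .
    from add_mono[OF 1 this]
    show "epowr (\<integral>\<^sup>+z. ennreal ((h (y, z) + k (y, z))\<^sup>2) \<partial>\<nu>) (p / 2) + (\<integral>\<^sup>+z. ennreal (\<bar>h (y, z) + k (y, z)\<bar> powr p) \<partial>\<nu>)
      \<le> ennreal (2 powr p) * ((epowr (?a h y) (p / 2) + ?b h y) + (epowr (?a k y) (p / 2) + ?b k y))"
      by (simp add: distrib_left add_ac)
  qed
  also have "\<dots> = ennreal (2 powr p) * (mixed_moment p h + mixed_moment p k)"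
    unfolding mixed_moment_def by (simp add: nn_integral_cmult nn_integral_add)
  finally show ?thesis .
qed

lemma mixed_moment_2_times:
  assumes p: "2 \<le> p" and [measurable]: "h \<in> borel_measurable Prod"
  shows "mixed_moment p (\<lambda>x. 2 * h x) = ennreal (2 powr p) * mixed_moment p h"
proof -
  let ?a = "\<lambda>h y. \<integral>\<^sup>+z. ennreal ((h (y, z))\<^sup>2) \<partial>\<nu>" and ?b = "\<lambda>h y. \<integral>\<^sup>+z. ennreal (\<bar>h (y, z)\<bar> powr p) \<partial>\<nu>"
  have "mixed_moment p (\<lambda>x. 2 * h x) = (\<integral>\<^sup>+y. ennreal (2 powr p) * (epowr (?a h y) (p / 2) + ?b h y) \<partial>(Tm \<Otimes>\<^sub>M M))"
    unfolding mixed_moment_def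
  proof (rule nn_integral_cong)
    fix y assume y: "y \<in> space (Tm \<Otimes>\<^sub>M M)"
    note [measurable] = section_measurable[OF assms(2) y]
    have "(\<integral>\<^sup>+z. ennreal ((2 * h (y, z))\<^sup>2) \<partial>\<nu>) = ennreal 4 * ?a h y"
      by (simp add: power_mult_distrib ennreal_mult nn_integral_cmult)
    moreover have "(4::real) powr (p / 2) = 2 powr p"
      using powr_powr[of 2 2 "p / 2"] by simp
    ultimately have "epowr (\<integral>\<^sup>+z. ennreal ((2 * h (y, z))\<^sup>2) \<partial>\<nu>) (p / 2) = ennreal (2 powr p) * epowr (?a h y) (p / 2)"
      using p epowr_ennreal[of 4 "p / 2"] epowr_mult[of "p / 2" "ennreal 4"] by simp
    moreover have "(\<integral>\<^sup>+z. ennreal (\<bar>2 * h (y, z)\<bar> powr p) \<partial>\<nu>) = ennreal (2 powr p) * ?b h y"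
      by (simp add: abs_mult powr_mult ennreal_mult nn_integral_cmult)
    ultimately show "epowr (\<integral>\<^sup>+z. ennreal ((2 * h (y, z))\<^sup>2) \<partial>\<nu>) (p / 2) + (\<integral>\<^sup>+z. ennreal (\<bar>2 * h (y, z)\<bar> powr p) \<partial>\<nu>)
      = ennreal (2 powr p) * (epowr (?a h y) (p / 2) + ?b h y)"
      by (simp add: distrib_left)
  qed
  then show ?thesis unfolding mixed_moment_def by (simp add: nn_integral_cmult)
qed

text \<open>The inner integral of \<open>h\<^sup>2\<close> is at most \<open>c\<^sup>2\<close> times
  the mass of \<open>A\<close>, so its power \<open>p / 2\<close> is at most a constant times
  itself; likewise \<open>|h| powr p <= c powr (p - 2) * h\<^sup>2\<close>. For such functions
  smallness in \<open>L\<^sup>2\<close> makes the mixed moment small.\<close>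

lemma mixed_moment_bounded:
  assumes p: "2 \<le> p" and A: "A \<in> sets \<nu>" "emeasure \<nu> A < \<infinity>" and c: "0 \<le> c"
  shows "\<exists>C\<ge>0. \<forall>h\<in>borel_measurable Prod. (\<forall>x\<in>space Prod. \<bar>h x\<bar> \<le> c \<and> (snd x \<notin> A \<longrightarrow> h x = 0)) \<longrightarrow>
    mixed_moment p h \<le> ennreal C * sqn h"
proof (intro exI conjI ballI impI)
  let ?m = "c\<^sup>2 * measure \<nu> A"
  let ?C = "?m powr (p / 2 - 1) + c powr (p - 2)"
  show "0 \<le> ?C" by simp
  fix h assume [measurable]: "h \<in> borel_measurable Prod" and h: "\<forall>x\<in>space Prod. \<bar>h x\<bar> \<le> c \<and> (snd x \<notin> A \<longrightarrow> h x = 0)"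
  let ?a = "\<lambda>y. \<integral>\<^sup>+z. ennreal ((h (y, z))\<^sup>2) \<partial>\<nu>"
  have "mixed_moment p h \<le> (\<integral>\<^sup>+y. ennreal ?C * ?a y \<partial>(Tm \<Otimes>\<^sub>M M))"
    unfolding mixed_moment_def
  proof (rule nn_integral_mono)
    fix y assume y: "y \<in> space (Tm \<Otimes>\<^sub>M M)"
    note [measurable] = section_measurable[OF \<open>h \<in> borel_measurable Prod\<close> y]
    have hz: "\<bar>h (y, z)\<bar> \<le> c" "z \<notin> A \<Longrightarrow> h (y, z) = 0" if "z \<in> space \<nu>" for z
      using h y that by (auto simp: space_pair_measure[of "Tm \<Otimes>\<^sub>M M"])
    have "?a y \<le> (\<integral>\<^sup>+z. ennreal (c\<^sup>2) * indicator A z \<partial>\<nu>)"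
    proof (rule nn_integral_mono)
      fix z assume z: "z \<in> space \<nu>"
      have "(h (y, z))\<^sup>2 \<le> c\<^sup>2" using hz(1)[OF z] c abs_le_square_iff[of "h (y, z)" c] by simp
      then show "ennreal ((h (y, z))\<^sup>2) \<le> ennreal (c\<^sup>2) * indicator A z"
        using hz(2)[OF z] by (cases "z \<in> A") (auto intro: ennreal_leI)
    qed
    also have "\<dots> = ennreal ?m" using A by (simp add: nn_integral_cmult_indicator emeasure_eq_ennreal_measure less_top ennreal_mult)
    finally have am: "?a y \<le> ennreal ?m" .
    then obtain r where r: "?a y = ennreal r" "0 \<le> r" by (cases "?a y") (auto simp: top_unique)
    have "0 \<le> ?m" by simp
    then have rm: "r \<le> ?m" using am unfolding r(1) by (simp only: ennreal_le_iff)
    have "r powr (p / 2) \<le> ?m powr (p / 2 - 1) * r"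
    proof (cases "r = 0")
      case False
      have "r powr (p / 2) = r powr (p / 2 - 1) * r" using r False powr_add[of r "p / 2 - 1" 1] by simp
      also have "\<dots> \<le> ?m powr (p / 2 - 1) * r" using r rm p by (intro mult_right_mono powr_mono2) auto
      finally show ?thesis .
    qed simp
    then have 1: "epowr (?a y) (p / 2) \<le> ennreal (?m powr (p / 2 - 1)) * ?a y"
      using r by (simp add: epowr_ennreal ennreal_leI flip: ennreal_mult)
    have "(\<integral>\<^sup>+z. ennreal (\<bar>h (y, z)\<bar> powr p) \<partial>\<nu>) \<le> (\<integral>\<^sup>+z. ennreal (c powr (p - 2)) * ennreal ((h (y, z))\<^sup>2) \<partial>\<nu>)"
    proof (rule nn_integral_mono)
      fix z assume z: "z \<in> space \<nu>"
      have "\<bar>h (y, z)\<bar> powr p \<le> c powr (p - 2) * (h (y, z))\<^sup>2"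
      proof (cases "h (y, z) = 0")
        case False
        have "\<bar>h (y, z)\<bar> powr p = \<bar>h (y, z)\<bar> powr (p - 2) * \<bar>h (y, z)\<bar> powr 2"
          using powr_add[of "\<bar>h (y, z)\<bar>" "p - 2" 2] by simp
        also have "\<dots> \<le> c powr (p - 2) * \<bar>h (y, z)\<bar> powr 2"
          using hz(1)[OF z] p by (intro mult_right_mono powr_mono2) auto
        finally show ?thesis by simp
      qed simp
      then show "ennreal (\<bar>h (y, z)\<bar> powr p) \<le> ennreal (c powr (p - 2)) * ennreal ((h (y, z))\<^sup>2)"
        by (simp add: ennreal_leI flip: ennreal_mult)
    qed
    also have "\<dots> = ennreal (c powr (p - 2)) * ?a y" by (simp add: nn_integral_cmult)
    finally show "epowr (?a y) (p / 2) + (\<integral>\<^sup>+z. ennreal (\<bar>h (y, z)\<bar> powr p) \<partial>\<nu>) \<le> ennreal ?C * ?a y"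
      using 1 by (simp add: ennreal_plus distrib_right add_mono)
  qed
  also have "\<dots> = ennreal ?C * sqn h"
    using nu.nn_integral_fst[of "\<lambda>x. ennreal ((h x)\<^sup>2)" "Tm \<Otimes>\<^sub>M M"]
    unfolding sqn_def by (simp add: nn_integral_cmult)
  finally show "mixed_moment p h \<le> ennreal ?C * sqn h" .
qed

text \<open>Simple functions below \<open>2 * |h|\<close>, cut off to an exhausting sequence of mark
  sets, converge by dominated convergence with bound \<open>9 * h\<^sup>2\<close>. The pointwise
  bound by \<open>|2 * h|\<close> is kept because it controls the mixed moment of the
  approximant.\<close>

lemma sqn_approx_bounded_support:
  assumes h: "h \<in> borel_measurable (Pred \<Otimes>\<^sub>M \<nu>)" and fin: "sqn h < \<infinity>" and e: "0 < e"
  shows "\<exists>A s. A \<in> sets \<nu> \<and> emeasure \<nu> A < \<infinity> \<and> simple_function (Pred \<Otimes>\<^sub>M \<nu>) s \<and>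
    (\<forall>x\<in>space Prod. \<bar>s x * indicator A (snd x)\<bar> \<le> \<bar>2 * h x\<bar>) \<and> sqn (\<lambda>x. h x - s x * indicator A (snd x)) \<le> ennreal e"
proof -
  have sp: "space (Pred \<Otimes>\<^sub>M \<nu>) = space Prod" by (simp add: space_pair_measure space_Pred)
  note [measurable] = Pred_measurable[OF h]
  obtain s where s: "\<And>i::nat. simple_function (Pred \<Otimes>\<^sub>M \<nu>) (s i)"
    "\<And>x. x \<in> space Prod \<Longrightarrow> (\<lambda>i. s i x) \<longlonglongrightarrow> h x"
    "\<And>i x. x \<in> space Prod \<Longrightarrow> \<bar>s i x\<bar> \<le> 2 * \<bar>h x\<bar>"
    using borel_measurable_implies_sequence_metric[OF h, of 0] unfolding sp dist_real_def by (simp only: diff_0_right) blast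
  obtain A :: "nat \<Rightarrow> 'z set" where A: "range A \<subseteq> sets \<nu>" "(\<Union>i. A i) = space \<nu>" "\<And>i. emeasure \<nu> (A i) \<noteq> \<infinity>" "incseq A"
    using nu.sigma_finite_incseq by metis
  have Am [measurable]: "A i \<in> sets \<nu>" for i using A by auto
  have sm [measurable]: "s i \<in> borel_measurable Prod" for i
    by (intro Pred_measurable borel_measurable_simple_function s)
  define g where "g i x = s i x * indicator (A i) (snd x)" for i x
  have gm [measurable]: "g i \<in> borel_measurable Prod" for i unfolding g_def[abs_def]
    by (intro borel_measurable_times sm measurable_compose[OF measurable_snd borel_measurable_indicator] Am)
  have gb: "\<bar>g i x\<bar> \<le> 2 * \<bar>h x\<bar>" if "x \<in> space Prod" for i x
    using s(3)[OF that, of i] by (auto simp: g_def split: split_indicator)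
  have gl: "(\<lambda>i. g i x) \<longlonglongrightarrow> h x" if x: "x \<in> space Prod" for x
  proof -
    have "snd x \<in> space \<nu>" using x by (auto simp: space_pair_measure)
    then obtain k where k: "snd x \<in> A k" using A(2) by auto
    have "eventually (\<lambda>i. g i x = s i x) sequentially"
      using eventually_ge_at_top[of k]
      by eventually_elim (use k A(4) in \<open>auto simp: g_def incseq_def split: split_indicator\<close>)
    then show ?thesis using s(2)[OF x] by (simp add: tendsto_cong)
  qed
  have "(\<lambda>i. sqn (\<lambda>x. h x - g i x)) \<longlonglongrightarrow> (\<integral>\<^sup>+x. 0 \<partial>Prod)"
    unfolding sqn_def
  proof (rule nn_integral_dominated_convergence[where w="\<lambda>x. ennreal (9 * (h x)\<^sup>2)"])
    have "(\<integral>\<^sup>+x. ennreal (9 * (h x)\<^sup>2) \<partial>Prod) = 9 * sqn h"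
      unfolding sqn_def by (simp add: ennreal_mult nn_integral_cmult)
    then show "(\<integral>\<^sup>+x. ennreal (9 * (h x)\<^sup>2) \<partial>Prod) < \<infinity>" using fin by (simp add: ennreal_mult_less_top)
    show "AE x in Prod. ennreal ((h x - g i x)\<^sup>2) \<le> ennreal (9 * (h x)\<^sup>2)" for i
    proof (rule AE_I2, rule ennreal_leI)
      fix x assume "x \<in> space Prod"
      then have "\<bar>h x - g i x\<bar> \<le> \<bar>3 * h x\<bar>" using gb[of x i] by auto
      then have "(h x - g i x)\<^sup>2 \<le> (3 * h x)\<^sup>2" by (simp only: abs_le_square_iff)
      then show "(h x - g i x)\<^sup>2 \<le> 9 * (h x)\<^sup>2" by (simp add: power_mult_distrib)
    qed
    show "AE x in Prod. (\<lambda>i. ennreal ((h x - g i x)\<^sup>2)) \<longlonglongrightarrow> 0"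
    proof (rule AE_I2)
      fix x assume x: "x \<in> space Prod"
      have "(\<lambda>i. (h x - g i x)\<^sup>2) \<longlonglongrightarrow> (h x - h x)\<^sup>2"
        by (intro tendsto_intros gl x)
      then show "(\<lambda>i. ennreal ((h x - g i x)\<^sup>2)) \<longlonglongrightarrow> 0"
        by (auto simp flip: ennreal_0 intro!: tendsto_ennrealI)
    qed
  qed (use fin in auto)
  then have "(\<lambda>i. sqn (\<lambda>x. h x - g i x)) \<longlonglongrightarrow> 0" by simp
  then have "eventually (\<lambda>i. sqn (\<lambda>x. h x - g i x) < ennreal e) sequentially"
    by (rule order_tendstoD) (use e in simp)
  then obtain i where i: "sqn (\<lambda>x. h x - g i x) < ennreal e" by (auto simp: eventually_sequentially)
  show ?thesis
    using A(3)[of i] s(1)[of i] gb[of _ i] i Am[of i] unfolding g_def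
    by (intro exI[of _ "A i"] exI[of _ "s i"]) (auto simp: abs_mult less_top)
qed

text \<open>The approximation goes through a simple function \<open>g\<close> supported in a
  finite-mass mark set. Its mixed moment is at most \<open>2 powr p\<close> times that of
  \<open>h\<close>, and splitting \<open>L\<close> into \<open>g\<close> and the difference costs
  another \<open>2 powr p\<close>, hence \<open>4 powr p\<close>. The difference is bounded and
  supported in \<open>A\<close>, so its mixed moment is controlled by its \<open>L\<^sup>2\<close>
  size.\<close>

lemma elementary_dense:
  assumes h: "h \<in> borel_measurable (Pred \<Otimes>\<^sub>M \<nu>)" and fin: "sqn h < \<infinity>" and e: "0 < e" and p: "2 \<le> p"
  shows "\<exists>L. elementary T F \<nu> L \<and> sqn (\<lambda>x. h x - uncurried (elem_fun L) x) \<le> ennreal e \<and>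
    mixed_moment p (uncurried (elem_fun L)) \<le> ennreal (4 powr p) * mixed_moment p h + ennreal e"
proof -
  have sp: "space (Pred \<Otimes>\<^sub>M \<nu>) = space Prod" by (simp add: space_pair_measure space_Pred)
  have "0 < e / 4" using e by simp
  from sqn_approx_bounded_support[OF h fin this]
  obtain A s where A: "A \<in> sets \<nu>" "emeasure \<nu> A < \<infinity>" and s: "simple_function (Pred \<Otimes>\<^sub>M \<nu>) s"
    and b: "\<And>x. x \<in> space Prod \<Longrightarrow> \<bar>s x * indicator A (snd x)\<bar> \<le> \<bar>2 * h x\<bar>"
    and a: "sqn (\<lambda>x. h x - s x * indicator A (snd x)) \<le> ennreal (e / 4)"
    by blast
  define g where "g x = s x * indicator A (snd x)" for x :: "(real \<times> 'w) \<times> 'z"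
  define V where "V = s ` space Prod"
  have V: "finite V" using simple_functionD(1)[OF s] by (simp add: V_def sp)
  define S where "S y = s -` {y} \<inter> space Prod" for y
  have S: "S y \<in> sets (Pred \<Otimes>\<^sub>M \<nu>)" for y using simple_functionD(2)[OF s, of "{y}"] by (simp add: S_def sp)
  have gS: "g x = (\<Sum>y\<in>V. y * ind_on A (S y) x)" if x: "x \<in> space Prod" for x
  proof -
    have "(\<Sum>y\<in>V. y * ind_on A (S y) x) = (\<Sum>y\<in>V. if y = s x then y * indicator A (snd x) else 0)"
      using x by (intro sum.cong) (auto simp: ind_on_def S_def split: split_indicator)
    also have "\<dots> = g x" using V x by (simp add: g_def V_def)
    finally show ?thesis by simp
  qed
  define c where "c = (\<Sum>y\<in>V. \<bar>y\<bar>)"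
  have c: "0 \<le> c" by (simp add: c_def sum_nonneg)
  have gc: "\<bar>g x\<bar> \<le> c" if x: "x \<in> space Prod" for x
  proof -
    have "\<bar>g x\<bar> \<le> \<bar>s x\<bar>" by (auto simp: g_def split: split_indicator)
    also have "\<dots> \<le> c" unfolding c_def using V x by (intro member_le_sum[of "s x" V abs]) (auto simp: V_def)
    finally show ?thesis .
  qed
  have sm: "s \<in> borel_measurable Prod" by (intro Pred_measurable borel_measurable_simple_function s)
  have gm [measurable]: "g \<in> borel_measurable Prod" unfolding g_def[abs_def]
    by (intro borel_measurable_times sm measurable_compose[OF measurable_snd borel_measurable_indicator] A)
  note [measurable] = Pred_measurable[OF h]
  from mixed_moment_bounded[OF p A mult_nonneg_nonneg[OF zero_le_numeral c]]
  obtain C where C': "0 \<le> C \<and> (\<forall>h\<in>borel_measurable Prod. (\<forall>x\<in>space Prod. \<bar>h x\<bar> \<le> 2 * c \<and> (snd x \<notin> A \<longrightarrow> h x = 0)) \<longrightarrow>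
    mixed_moment p h \<le> ennreal C * sqn h)" by (rule exE)
  note C = C'[THEN conjunct1] C'[THEN conjunct2, rule_format]
  \<comment> \<open>\<open>C\<close> depends only on the bound and the support, which are known
    before \<open>L\<close> is chosen. So the accuracy can be taken small enough that the mixed
    moment of the difference contributes at most \<open>e\<close>.\<close>
  define e' where "e' = min (e / 4) (e / (2 powr p * (C + 1)))"
  have e': "0 < e'" "e' \<le> e / 4" unfolding e'_def using e C(1) by (simp, intro min.cobounded1)
  have e'2: "2 powr p * (C * e') \<le> e"
  proof -
    have "2 powr p * (C * e') \<le> 2 powr p * ((C + 1) * e')" using e' by (intro mult_left_mono mult_right_mono) auto
    also have "\<dots> \<le> 2 powr p * ((C + 1) * (e / (2 powr p * (C + 1))))"
      using C(1) by (intro mult_left_mono) (auto simp: e'_def)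
    also have "\<dots> = e"
    proof -
      have "C + 1 \<noteq> 0" using C(1) by simp
      then show ?thesis by simp
    qed
    finally show ?thesis .
  qed
  from approximate_simple[where S=S, OF A V S e'(1)]
  obtain L where L: "elementary T F \<nu> L"
    and Lb: "\<And>x. x \<in> space Prod \<Longrightarrow> \<bar>uncurried (elem_fun L) x\<bar> \<le> c \<and> (snd x \<notin> A \<longrightarrow> uncurried (elem_fun L) x = 0)"
    and "sqn (\<lambda>x. (\<Sum>y\<in>V. y * ind_on A (S y) x) - uncurried (elem_fun L) x) \<le> ennreal e'"
    unfolding c_def by blast
  moreover have "sqn (\<lambda>x. (\<Sum>y\<in>V. y * ind_on A (S y) x) - uncurried (elem_fun L) x) = sqn (\<lambda>x. g x - uncurried (elem_fun L) x)"
    unfolding sqn_def by (intro nn_integral_cong) (simp add: gS)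
  ultimately have d: "sqn (\<lambda>x. g x - uncurried (elem_fun L) x) \<le> ennreal e'" by simp
  note Lm [measurable] = elem_fun_Prod_measurable[OF L]
  have "sqn (\<lambda>x. h x - uncurried (elem_fun L) x) \<le> 2 * sqn (\<lambda>x. h x - g x) + 2 * sqn (\<lambda>x. g x - uncurried (elem_fun L) x)"
    by (intro sqn_triangle) measurable
  also have "\<dots> \<le> 2 * ennreal (e / 4) + 2 * ennreal (e / 4)"
    using a d e' by (intro add_mono mult_left_mono) (auto simp: g_def intro: order_trans[OF _ ennreal_leI])
  also have "\<dots> = ennreal (2 * (e / 4) + 2 * (e / 4))" using e by (simp add: ennreal_mult' flip: ennreal_numeral ennreal_plus ennreal_mult)
  finally have 1: "sqn (\<lambda>x. h x - uncurried (elem_fun L) x) \<le> ennreal e" by simp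
  have "mixed_moment p (\<lambda>x. g x + (uncurried (elem_fun L) x - g x)) \<le> ennreal (2 powr p) * (mixed_moment p g + mixed_moment p (\<lambda>x. uncurried (elem_fun L) x - g x))"
    by (intro mixed_moment_add p) measurable
  then have "mixed_moment p (uncurried (elem_fun L)) \<le> ennreal (2 powr p) * (mixed_moment p g + mixed_moment p (\<lambda>x. uncurried (elem_fun L) x - g x))"
    by simp
  also have "\<dots> \<le> ennreal (2 powr p) * (ennreal (2 powr p) * mixed_moment p h + ennreal C * ennreal e')"
  proof (intro mult_left_mono add_mono)
    have "mixed_moment p g \<le> mixed_moment p (\<lambda>x. 2 * h x)" using p b by (intro mixed_moment_mono) (auto simp: g_def)
    then show "mixed_moment p g \<le> ennreal (2 powr p) * mixed_moment p h" by (simp add: mixed_moment_2_times[OF p])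
    have "mixed_moment p (\<lambda>x. uncurried (elem_fun L) x - g x) \<le> ennreal C * sqn (\<lambda>x. uncurried (elem_fun L) x - g x)"
    proof (rule C(2))
      fix x assume x: "x \<in> space Prod"
      have "snd x \<notin> A \<Longrightarrow> g x = 0" by (simp add: g_def)
      then show "\<bar>uncurried (elem_fun L) x - g x\<bar> \<le> 2 * c \<and> (snd x \<notin> A \<longrightarrow> uncurried (elem_fun L) x - g x = 0)"
        using Lb[OF x] gc[OF x] by auto
    qed measurable
    also have "\<dots> \<le> ennreal C * ennreal e'"
      using d by (intro mult_left_mono) (simp_all add: sqn_minus_commute[of "uncurried (elem_fun L)"])
    finally show "mixed_moment p (\<lambda>x. uncurried (elem_fun L) x - g x) \<le> ennreal C * ennreal e'" .
  qed auto
  also have "\<dots> = ennreal (4 powr p) * mixed_moment p h + ennreal (2 powr p * (C * e'))"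
  proof -
    have "(2::real) powr p * 2 powr p = 4 powr p" by (simp flip: powr_mult)
    then show ?thesis using C(1) e' by (simp add: distrib_left mult.assoc[symmetric] flip: ennreal_mult)
  qed
  also have "\<dots> \<le> ennreal (4 powr p) * mixed_moment p h + ennreal e"
    using e'2 by (intro add_left_mono ennreal_leI)
  finally show ?thesis using L 1 by blast
qed

end

section \<open>The stochastic integral\<close>

context poisson_basis
begin

lemma elem_integral_measurable:
  assumes "elementary T F \<nu> L" shows "elem_integral \<nu> \<mu> L \<in> borel_measurable M"
proof -
  have "truncated_integral L T \<in> borel_measurable M"
    using T_pos by (intro F_measurable_M[OF _ _ truncated_integral_measurable[OF assms]]) auto
  then show ?thesis by (simp add: truncated_integral_T[OF assms, abs_def] cong: measurable_cong)
qed

lemma elementary_mixed_moment_bound: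
  assumes "2 \<le> p"
  shows "\<exists>C\<ge>0. \<forall>L. elementary T F \<nu> L \<longrightarrow>
    (\<integral>\<^sup>+\<omega>. ennreal (\<bar>elem_integral \<nu> \<mu> L \<omega>\<bar> powr p) \<partial>M) \<le> ennreal C * mixed_moment p (uncurried (elem_fun L))"
  using elementary_moment_bound[OF assms]
  by (auto simp: integral_moment_eq_mixed_moment[OF elem_fun_Prod_measurable])

text \<open>The difference is the elementary integral of a concatenated list, to which the moment
  bound with \<open>p = 2\<close> applies; the factor 2 relates \<open>mixed_moment 2\<close> to
  \<open>sqn\<close>. An estimate up to a constant replaces the exact isometry.\<close>

lemma elementary_L2_diff_bound:
  "\<exists>C. 0 \<le> C \<and> (\<forall>L L'. elementary T F \<nu> L \<longrightarrow> elementary T F \<nu> L' \<longrightarrow>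
    (\<integral>\<^sup>+\<omega>. ennreal ((elem_integral \<nu> \<mu> L \<omega> - elem_integral \<nu> \<mu> L' \<omega>)\<^sup>2) \<partial>M) \<le>
      ennreal C * sqn (\<lambda>x. uncurried (elem_fun L) x - uncurried (elem_fun L') x))"
proof -
  obtain C where C: "0 \<le> C" and le: "\<And>L. elementary T F \<nu> L \<Longrightarrow>
    (\<integral>\<^sup>+\<omega>. ennreal (\<bar>elem_integral \<nu> \<mu> L \<omega>\<bar> powr 2) \<partial>M) \<le> ennreal C * mixed_moment 2 (uncurried (elem_fun L))"
    using elementary_mixed_moment_bound[of 2] by auto
  show ?thesis
  proof (intro exI[of _ "C * 2"] conjI allI impI)
    show "0 \<le> C * 2" using C by simp
    fix L L' assume L: "elementary T F \<nu> L" "elementary T F \<nu> L'"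
    define D where "D = L @ elem_scale (- 1) L'"
    have D: "elementary T F \<nu> D" using L by (simp add: D_def elementary_append elementary_scale)
    have i: "elem_integral \<nu> \<mu> D \<omega> = elem_integral \<nu> \<mu> L \<omega> - elem_integral \<nu> \<mu> L' \<omega>" for \<omega>
      by (simp add: D_def elem_integral_append elem_integral_scale)
    have f: "uncurried (elem_fun D) = (\<lambda>x. uncurried (elem_fun L) x - uncurried (elem_fun L') x)"
      by (simp add: fun_eq_iff D_def uncurried_def elem_fun_append elem_fun_scale)
    have "(\<integral>\<^sup>+\<omega>. ennreal ((elem_integral \<nu> \<mu> L \<omega> - elem_integral \<nu> \<mu> L' \<omega>)\<^sup>2) \<partial>M) \<le> ennreal C * (2 * sqn (uncurried (elem_fun D)))"
      using le[OF D] mixed_moment_2[OF elem_fun_Prod_measurable[OF D]] by (simp add: i)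
    also have "\<dots> = ennreal (C * 2) * sqn (uncurried (elem_fun D))"
      using C by (simp add: ennreal_mult mult.assoc)
    finally show "(\<integral>\<^sup>+\<omega>. ennreal ((elem_integral \<nu> \<mu> L \<omega> - elem_integral \<nu> \<mu> L' \<omega>)\<^sup>2) \<partial>M) \<le>
      ennreal (C * 2) * sqn (\<lambda>x. uncurried (elem_fun L) x - uncurried (elem_fun L') x)"
      by (simp add: f)
  qed
qed

lemma sqn_uncurried:
  assumes [measurable]: "uncurried f \<in> borel_measurable Prod"
  shows "sqn (uncurried f) = (\<integral>\<^sup>+\<omega>. (\<integral>\<^sup>+s\<in>{0..T}. (\<integral>\<^sup>+z. ennreal ((f s z \<omega>)\<^sup>2) \<partial>\<nu>) \<partial>lborel) \<partial>M)"
  unfolding sqn_def by (subst nn_integral_Prod(1)) (measurable, simp add: uncurried_def)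

lemma L2_integrandD:
  assumes "L2_integrand M T F \<nu> f"
  shows "uncurried f \<in> borel_measurable (Pred \<Otimes>\<^sub>M \<nu>)" "sqn (uncurried f) < \<infinity>"
proof -
  show m: "uncurried f \<in> borel_measurable (Pred \<Otimes>\<^sub>M \<nu>)"
    using assms by (simp add: L2_integrand_def uncurried_conv)
  show "sqn (uncurried f) < \<infinity>"
    using assms sqn_uncurried[OF Pred_measurable[OF m]] by (simp add: L2_integrand_def)
qed

lemma sqn_diff_eq:
  assumes f: "uncurried f \<in> borel_measurable Prod" and L: "elementary T F \<nu> L"
  shows "(\<integral>\<^sup>+\<omega>. (\<integral>\<^sup>+s\<in>{0..T}. (\<integral>\<^sup>+z. ennreal ((f s z \<omega> - elem_fun L s z \<omega>)\<^sup>2) \<partial>\<nu>) \<partial>lborel) \<partial>M) =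
    sqn (\<lambda>x. uncurried f x - uncurried (elem_fun L) x)"
proof -
  note [measurable] = f elem_fun_Prod_measurable[OF L]
  show ?thesis unfolding sqn_def by (subst nn_integral_Prod(1)) (measurable, simp add: uncurried_def)
qed

lemma geometric_tendsto_0:
  assumes "\<bar>q\<bar> < 1" shows "(\<lambda>n. ennreal (c * q ^ n)) \<longlonglongrightarrow> 0"
proof -
  have "(\<lambda>n. c * q ^ n) \<longlonglongrightarrow> c * 0"
    using assms by (intro tendsto_mult_left LIMSEQ_power_zero) auto
  from tendsto_ennrealI[OF this] show ?thesis by simp
qed

text \<open>Accuracy \<open>(1/8) ^ n\<close> leaves room for the factor \<open>2 ^ n\<close> in the
  passage from second to first moments, so the elementary integrals converge almost surely. Fatou's
  lemma then identifies the pointwise limit as the limit in \<open>L\<^sup>2\<close>.\<close>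

lemma stoch_integral_exists:
  assumes f: "L2_integrand M T F \<nu> f"
  shows "\<exists>I. is_stoch_integral M T F \<nu> \<mu> f I"
proof -
  note fP = L2_integrandD[OF f]
  note fm [measurable] = Pred_measurable[OF fP(1)]
  let ?h = "uncurried f"
  have "\<exists>L. elementary T F \<nu> L \<and> sqn (\<lambda>x. ?h x - uncurried (elem_fun L) x) \<le> ennreal ((1/8) ^ n)" for n :: nat
    using elementary_dense[OF fP, of "(1/8) ^ n" 2] by auto
  then obtain L where L: "\<And>n. elementary T F \<nu> (L n)"
    and Le: "\<And>n. sqn (\<lambda>x. ?h x - uncurried (elem_fun (L n)) x) \<le> ennreal ((1/8) ^ n)"
    by metis
  note Lm [measurable] = elem_fun_Prod_measurable[OF L]
  define X where "X n = elem_integral \<nu> \<mu> (L n)" for n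
  have Xm [measurable]: "X n \<in> borel_measurable M" for n unfolding X_def by (rule elem_integral_measurable[OF L])
  from elementary_L2_diff_bound
  obtain C where C': "0 \<le> C \<and> (\<forall>L L'. elementary T F \<nu> L \<longrightarrow> elementary T F \<nu> L' \<longrightarrow>
    (\<integral>\<^sup>+\<omega>. ennreal ((elem_integral \<nu> \<mu> L \<omega> - elem_integral \<nu> \<mu> L' \<omega>)\<^sup>2) \<partial>M) \<le>
      ennreal C * sqn (\<lambda>x. uncurried (elem_fun L) x - uncurried (elem_fun L') x))"
    by (rule exE)
  note C = C'[THEN conjunct1] C'[THEN conjunct2, rule_format]
  define K where "K = C * 4"
  have K: "0 \<le> K" using C(1) by (simp add: K_def)
  have XX: "(\<integral>\<^sup>+\<omega>. ennreal ((X m \<omega> - X n \<omega>)\<^sup>2) \<partial>M) \<le> ennreal (K * (1/8) ^ n)" if "n \<le> m" for n m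
  proof -
    have "sqn (\<lambda>x. uncurried (elem_fun (L m)) x - uncurried (elem_fun (L n)) x) \<le>
      2 * sqn (\<lambda>x. uncurried (elem_fun (L m)) x - ?h x) + 2 * sqn (\<lambda>x. ?h x - uncurried (elem_fun (L n)) x)"
      by (intro sqn_triangle) measurable
    also have "\<dots> \<le> 2 * ennreal ((1/8) ^ n) + 2 * ennreal ((1/8) ^ n)"
    proof (intro add_mono mult_left_mono Le)
      have "sqn (\<lambda>x. uncurried (elem_fun (L m)) x - ?h x) \<le> ennreal ((1/8) ^ m)"
        using Le[of m] by (simp only: sqn_minus_commute[of "uncurried (elem_fun (L m))" ?h])
      also have "\<dots> \<le> ennreal ((1/8) ^ n)" using that by (intro ennreal_leI power_decreasing) auto
      finally show "sqn (\<lambda>x. uncurried (elem_fun (L m)) x - ?h x) \<le> ennreal ((1/8) ^ n)" .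
    qed auto
    also have "\<dots> = ennreal (4 * (1/8) ^ n)"
    proof -
      have "2 * ennreal x + 2 * ennreal x = ennreal (4 * x)" if "0 \<le> x" for x
        using that by (simp flip: ennreal_numeral ennreal_plus ennreal_mult)
      then show ?thesis by simp
    qed
    finally have "ennreal C * sqn (\<lambda>x. uncurried (elem_fun (L m)) x - uncurried (elem_fun (L n)) x) \<le> ennreal C * ennreal (4 * (1/8) ^ n)"
      by (rule mult_left_mono) simp
    also have "\<dots> = ennreal (K * (1/8) ^ n)" using C(1) by (simp add: K_def mult.assoc flip: ennreal_mult)
    finally show ?thesis using C(2)[OF L L, of m n] unfolding X_def by (rule order_trans[rotated])
  qed
  have "AE \<omega> in M. summable (\<lambda>n. \<bar>X (Suc n) \<omega> - X n \<omega>\<bar>)"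
  proof (rule AE_summable_of_nn_integral[where c="1 + K"])
    fix n
    have "(\<integral>\<^sup>+\<omega>. ennreal \<bar>X (Suc n) \<omega> - X n \<omega>\<bar> \<partial>M) \<le> (\<integral>\<^sup>+\<omega>. ennreal ((1/2) ^ n) + ennreal (2 ^ n) * ennreal ((X (Suc n) \<omega> - X n \<omega>)\<^sup>2) \<partial>M)"
    proof (rule nn_integral_mono)
      fix \<omega>
      define d where "d = X (Suc n) \<omega> - X n \<omega>"
      \<comment> \<open>A weighted substitute for the Cauchy-Schwarz inequality: either
        \<open>|d|\<close> is below \<open>(1/2) ^ n\<close>, or multiplying it by
        \<open>2 ^ n * |d|\<close>, which is then at least one, only increases it.\<close>
      have "\<bar>d\<bar> \<le> (1/2) ^ n + 2 ^ n * d\<^sup>2"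
      proof (cases "\<bar>d\<bar> \<le> (1/2) ^ n")
        case False
        have "\<bar>d\<bar> = 2 ^ n * ((1/2) ^ n * \<bar>d\<bar>)" by (simp add: power_divide)
        also have "\<dots> \<le> 2 ^ n * (\<bar>d\<bar> * \<bar>d\<bar>)" using False by (intro mult_left_mono mult_right_mono) auto
        finally show ?thesis by (simp add: power2_eq_square add_increasing)
      qed (simp add: add_increasing2)
      then show "ennreal \<bar>X (Suc n) \<omega> - X n \<omega>\<bar> \<le> ennreal ((1/2) ^ n) + ennreal (2 ^ n) * ennreal ((X (Suc n) \<omega> - X n \<omega>)\<^sup>2)"
        unfolding d_def[symmetric] by (simp add: ennreal_leI flip: ennreal_mult ennreal_plus)
    qed
    also have "\<dots> = ennreal ((1/2) ^ n) + ennreal (2 ^ n) * (\<integral>\<^sup>+\<omega>. ennreal ((X (Suc n) \<omega> - X n \<omega>)\<^sup>2) \<partial>M)"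
      by (simp add: nn_integral_add nn_integral_cmult emeasure_space_1)
    also have "\<dots> \<le> ennreal ((1/2) ^ n) + ennreal (2 ^ n) * ennreal (K * (1/8) ^ n)"
      by (intro add_left_mono mult_left_mono XX) auto
    also have "\<dots> = ennreal ((1/2) ^ n + 2 ^ n * (K * (1/8) ^ n))"
      using K by (simp flip: ennreal_mult ennreal_plus)
    also have "\<dots> \<le> ennreal ((1 + K) * (1/2) ^ n)"
    proof (rule ennreal_leI)
      have "2 ^ n * (1/8::real) ^ n \<le> (1/2) ^ n"
        unfolding power_mult_distrib[symmetric] by (intro power_mono) auto
      from mult_left_mono[OF this K] show "(1/2) ^ n + 2 ^ n * (K * (1/8) ^ n) \<le> (1 + K) * (1/2) ^ n"
        by (simp add: algebra_simps)
    qed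
    finally show "(\<integral>\<^sup>+\<omega>. ennreal \<bar>X (Suc n) \<omega> - X n \<omega>\<bar> \<partial>M) \<le> ennreal ((1 + K) * (1/2) ^ n)" .
  qed (use K in auto)
  then have conv: "AE \<omega> in M. convergent (\<lambda>n. X n \<omega>)"
  proof eventually_elim
    case (elim \<omega>)
    then have "summable (\<lambda>n. X (Suc n) \<omega> - X n \<omega>)" by (rule summable_rabs_cancel)
    then have "convergent (\<lambda>n. \<Sum>i<n. X (Suc i) \<omega> - X i \<omega>)" by (simp add: summable_iff_convergent)
    moreover have "(\<lambda>n. \<Sum>i<n. X (Suc i) \<omega> - X i \<omega>) = (\<lambda>n. X n \<omega> - X 0 \<omega>)"
      by (rule ext) (rule sum_lessThan_telescope)
    ultimately have "convergent (\<lambda>n. X n \<omega> - X 0 \<omega>)" by (simp only:)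
    from convergent_add[OF this convergent_const[of "X 0 \<omega>"]] show ?case by simp
  qed
  \<comment> \<open>On the exceptional null set where the sequence diverges, \<open>lim\<close>
    takes an unspecified value, which does not affect the estimates.\<close>
  define I where "I \<omega> = lim (\<lambda>n. X n \<omega>)" for \<omega>
  have Im [measurable]: "I \<in> borel_measurable M" unfolding I_def[abs_def] by (intro borel_measurable_lim_metric) measurable
  have IX: "(\<integral>\<^sup>+\<omega>. ennreal ((I \<omega> - X n \<omega>)\<^sup>2) \<partial>M) \<le> ennreal (K * (1/8) ^ n)" for n
  proof -
    have "(\<integral>\<^sup>+\<omega>. ennreal ((I \<omega> - X n \<omega>)\<^sup>2) \<partial>M) = (\<integral>\<^sup>+\<omega>. liminf (\<lambda>m. ennreal ((X m \<omega> - X n \<omega>)\<^sup>2)) \<partial>M)"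
    proof (rule nn_integral_cong_AE)
      show "AE \<omega> in M. ennreal ((I \<omega> - X n \<omega>)\<^sup>2) = liminf (\<lambda>m. ennreal ((X m \<omega> - X n \<omega>)\<^sup>2))"
        using conv
      proof eventually_elim
        case (elim \<omega>)
        then have "(\<lambda>m. X m \<omega>) \<longlonglongrightarrow> I \<omega>" by (simp add: I_def convergent_LIMSEQ_iff)
        then have "(\<lambda>m. ennreal ((X m \<omega> - X n \<omega>)\<^sup>2)) \<longlonglongrightarrow> ennreal ((I \<omega> - X n \<omega>)\<^sup>2)"
          by (intro tendsto_ennrealI tendsto_intros)
        then show ?case by (intro lim_imp_Liminf[symmetric]) auto
      qed
    qed
    also have "\<dots> \<le> liminf (\<lambda>m. \<integral>\<^sup>+\<omega>. ennreal ((X m \<omega> - X n \<omega>)\<^sup>2) \<partial>M)"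
      by (intro nn_integral_liminf) measurable
    also have "\<dots> \<le> liminf (\<lambda>m. ennreal (K * (1/8) ^ n))"
      using XX by (intro Liminf_mono eventually_sequentiallyI[of n]) auto
    finally show ?thesis by (simp add: Liminf_const)
  qed
  note z = geometric_tendsto_0[of "1/8"]
  have "is_stoch_integral M T F \<nu> \<mu> f I"
    unfolding is_stoch_integral_def
  proof (intro conjI exI[of _ L] allI)
    show "(\<lambda>n. \<integral>\<^sup>+\<omega>. (\<integral>\<^sup>+s\<in>{0..T}. (\<integral>\<^sup>+z. ennreal ((f s z \<omega> - elem_fun (L n) s z \<omega>)\<^sup>2) \<partial>\<nu>) \<partial>lborel) \<partial>M) \<longlonglongrightarrow> 0"
      unfolding sqn_diff_eq[OF fm L]
      by (rule tendsto_sandwich[OF _ _ tendsto_const z[of 1]]) (use Le in auto)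
    show "(\<lambda>n. \<integral>\<^sup>+\<omega>. ennreal ((I \<omega> - elem_integral \<nu> \<mu> (L n) \<omega>)\<^sup>2) \<partial>M) \<longlonglongrightarrow> 0"
      using IX unfolding X_def
      by (intro tendsto_sandwich[OF _ _ tendsto_const z[of K]]) auto
  qed (use f L in auto)
  then show ?thesis by blast
qed

text \<open>The statement is about every version \<open>I\<close>, whose defining sequence
  \<open>L0\<close> has no moment control. A sequence from \<open>elementary_dense\<close> is
  therefore taken for the same integrand; by \<open>elementary_L2_diff_bound\<close> its integrals
  are close to those of \<open>L0\<close> and hence to \<open>I\<close>. A geometric rate gives
  almost sure convergence, and Fatou's lemma transfers the bound.\<close>

lemma stoch_integral_moment_bound:
  assumes p: "2 \<le> p"
  shows "\<exists>C\<ge>0. \<forall>f I. is_stoch_integral M T F \<nu> \<mu> f I \<longrightarrow>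
    (\<integral>\<^sup>+\<omega>. ennreal (\<bar>I \<omega>\<bar> powr p) \<partial>M) \<le> ennreal C * mixed_moment p (uncurried f)"
proof -
  obtain C where C: "0 \<le> C" and Cle: "\<And>L. elementary T F \<nu> L \<Longrightarrow>
    (\<integral>\<^sup>+\<omega>. ennreal (\<bar>elem_integral \<nu> \<mu> L \<omega>\<bar> powr p) \<partial>M) \<le> ennreal C * mixed_moment p (uncurried (elem_fun L))"
    using elementary_mixed_moment_bound[OF p] by blast
  from elementary_L2_diff_bound
  obtain C2 where C2': "0 \<le> C2 \<and> (\<forall>L L'. elementary T F \<nu> L \<longrightarrow> elementary T F \<nu> L' \<longrightarrow>
    (\<integral>\<^sup>+\<omega>. ennreal ((elem_integral \<nu> \<mu> L \<omega> - elem_integral \<nu> \<mu> L' \<omega>)\<^sup>2) \<partial>M) \<le>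
      ennreal C2 * sqn (\<lambda>x. uncurried (elem_fun L) x - uncurried (elem_fun L') x))"
    by (rule exE)
  note C2 = C2'[THEN conjunct1] C2'[THEN conjunct2, rule_format]
  have "(\<integral>\<^sup>+\<omega>. ennreal (\<bar>I \<omega>\<bar> powr p) \<partial>M) \<le> ennreal (C * 4 powr p) * mixed_moment p (uncurried f)"
    if I: "is_stoch_integral M T F \<nu> \<mu> f I" for f I
  proof -
    have f: "L2_integrand M T F \<nu> f" and Im [measurable]: "I \<in> borel_measurable M"
      using I by (auto simp: is_stoch_integral_def)
    note fP = L2_integrandD[OF f]
    note fm [measurable] = Pred_measurable[OF fP(1)]
    let ?h = "uncurried f"
    obtain L0 where L0: "\<And>n. elementary T F \<nu> (L0 n)"
      and L0f: "(\<lambda>n. sqn (\<lambda>x. ?h x - uncurried (elem_fun (L0 n)) x)) \<longlonglongrightarrow> 0"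
      and L0I: "(\<lambda>n. \<integral>\<^sup>+\<omega>. ennreal ((I \<omega> - elem_integral \<nu> \<mu> (L0 n) \<omega>)\<^sup>2) \<partial>M) \<longlonglongrightarrow> 0"
    proof -
      from I obtain L0 where L0: "\<forall>n. elementary T F \<nu> (L0 n)"
        and a: "(\<lambda>n. \<integral>\<^sup>+\<omega>. (\<integral>\<^sup>+s\<in>{0..T}. (\<integral>\<^sup>+z. ennreal ((f s z \<omega> - elem_fun (L0 n) s z \<omega>)\<^sup>2) \<partial>\<nu>) \<partial>lborel) \<partial>M) \<longlonglongrightarrow> 0"
        and b: "(\<lambda>n. \<integral>\<^sup>+\<omega>. ennreal ((I \<omega> - elem_integral \<nu> \<mu> (L0 n) \<omega>)\<^sup>2) \<partial>M) \<longlonglongrightarrow> 0"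
        unfolding is_stoch_integral_def by blast
      show ?thesis
        using that[OF L0[rule_format] a[unfolded sqn_diff_eq[OF fm L0[rule_format]]] b] .
    qed
    have "\<exists>L. elementary T F \<nu> L \<and> (\<integral>\<^sup>+\<omega>. ennreal ((I \<omega> - elem_integral \<nu> \<mu> L \<omega>)\<^sup>2) \<partial>M) \<le> ennreal (1 * (1/2) ^ k) \<and>
      mixed_moment p (uncurried (elem_fun L)) \<le> ennreal (4 powr p) * mixed_moment p ?h + ennreal (1 * (1/2) ^ k)" for k :: nat
    proof -
      \<comment> \<open>The distance from \<open>I\<close> is at most
        \<open>2 * e + 2 * (C2 * (4 * e))\<close>, two triangle inequalities being involved. The
        denominator makes this, and also \<open>e\<close> itself, at most
        \<open>(1/2) ^ k\<close>.\<close>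
      define e where "e = (1/2::real) ^ k / (4 + 8 * C2)"
      have e: "0 < e" using C2 by (simp add: e_def add_pos_nonneg)
      have e1: "(4 + 8 * C2) * e = (1/2) ^ k" using C2(1) by (simp add: e_def add_pos_nonneg)
      have "eventually (\<lambda>n. sqn (\<lambda>x. ?h x - uncurried (elem_fun (L0 n)) x) < ennreal e \<and>
        (\<integral>\<^sup>+\<omega>. ennreal ((I \<omega> - elem_integral \<nu> \<mu> (L0 n) \<omega>)\<^sup>2) \<partial>M) < ennreal e) sequentially"
        using order_tendstoD(2)[OF L0f, of "ennreal e"] order_tendstoD(2)[OF L0I, of "ennreal e"] e
        by (auto intro: eventually_conj)
      then obtain n where n: "sqn (\<lambda>x. ?h x - uncurried (elem_fun (L0 n)) x) \<le> ennreal e"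
        "(\<integral>\<^sup>+\<omega>. ennreal ((I \<omega> - elem_integral \<nu> \<mu> (L0 n) \<omega>)\<^sup>2) \<partial>M) \<le> ennreal e"
        by (auto simp: eventually_sequentially intro: less_imp_le)
      from elementary_dense[OF fP e p] obtain L where L: "elementary T F \<nu> L"
        "sqn (\<lambda>x. ?h x - uncurried (elem_fun L) x) \<le> ennreal e"
        "mixed_moment p (uncurried (elem_fun L)) \<le> ennreal (4 powr p) * mixed_moment p ?h + ennreal e" by blast
      note [measurable] = elem_fun_Prod_measurable[OF L(1)] elem_fun_Prod_measurable[OF L0, of n]
        elem_integral_measurable[OF L(1)] elem_integral_measurable[OF L0, of n]
      let ?X = "elem_integral \<nu> \<mu> L" and ?Y = "elem_integral \<nu> \<mu> (L0 n)"
      have "sqn (\<lambda>x. uncurried (elem_fun (L0 n)) x - uncurried (elem_fun L) x) \<le>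
        2 * sqn (\<lambda>x. uncurried (elem_fun (L0 n)) x - ?h x) + 2 * sqn (\<lambda>x. ?h x - uncurried (elem_fun L) x)"
        by (intro sqn_triangle) measurable
      also have "\<dots> \<le> 2 * ennreal e + 2 * ennreal e"
        using n(1) L(2) by (intro add_mono mult_left_mono) (simp_all only: sqn_minus_commute[of "uncurried (elem_fun (L0 n))" ?h] zero_le_numeral)
      also have "\<dots> = ennreal (4 * e)" using e by (simp flip: ennreal_numeral ennreal_plus ennreal_mult)
      finally have d: "sqn (\<lambda>x. uncurried (elem_fun (L0 n)) x - uncurried (elem_fun L) x) \<le> ennreal (4 * e)" .
      have "(\<integral>\<^sup>+\<omega>. ennreal ((I \<omega> - ?X \<omega>)\<^sup>2) \<partial>M) \<le>
        (\<integral>\<^sup>+\<omega>. 2 * ennreal ((I \<omega> - ?Y \<omega>)\<^sup>2) + 2 * ennreal ((?Y \<omega> - ?X \<omega>)\<^sup>2) \<partial>M)"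
      proof (rule nn_integral_mono)
        fix \<omega>
        have "(I \<omega> - ?X \<omega>)\<^sup>2 \<le> 2 * (I \<omega> - ?Y \<omega>)\<^sup>2 + 2 * (?Y \<omega> - ?X \<omega>)\<^sup>2"
          using sum_squares_bound[of "I \<omega> - ?Y \<omega>" "?Y \<omega> - ?X \<omega>"] power2_sum[of "I \<omega> - ?Y \<omega>" "?Y \<omega> - ?X \<omega>"] by simp
        then show "ennreal ((I \<omega> - ?X \<omega>)\<^sup>2) \<le> 2 * ennreal ((I \<omega> - ?Y \<omega>)\<^sup>2) + 2 * ennreal ((?Y \<omega> - ?X \<omega>)\<^sup>2)"
          by (simp add: ennreal_leI flip: ennreal_numeral ennreal_mult ennreal_plus)
      qed
      also have "\<dots> = 2 * (\<integral>\<^sup>+\<omega>. ennreal ((I \<omega> - ?Y \<omega>)\<^sup>2) \<partial>M) + 2 * (\<integral>\<^sup>+\<omega>. ennreal ((?Y \<omega> - ?X \<omega>)\<^sup>2) \<partial>M)"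
        by (simp add: nn_integral_add nn_integral_cmult)
      also have "\<dots> \<le> 2 * ennreal e + 2 * (ennreal C2 * ennreal (4 * e))"
        using n(2) order_trans[OF C2(2)[OF L0 L(1)] mult_left_mono[OF d]]
        by (intro add_mono mult_left_mono) auto
      also have "\<dots> = ennreal (2 * e + 2 * (C2 * (4 * e)))"
        using e C2(1) by (simp flip: ennreal_numeral ennreal_plus ennreal_mult)
      also have "\<dots> \<le> ennreal (1 * (1/2) ^ k)"
        using e e1 by (intro ennreal_leI) (simp add: algebra_simps)
      finally have 1: "(\<integral>\<^sup>+\<omega>. ennreal ((I \<omega> - ?X \<omega>)\<^sup>2) \<partial>M) \<le> ennreal (1 * (1/2) ^ k)" .
      have "e \<le> (4 + 8 * C2) * e" using e C2(1) by (simp add: algebra_simps)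
      then have "ennreal (4 powr p) * mixed_moment p ?h + ennreal e \<le> ennreal (4 powr p) * mixed_moment p ?h + ennreal (1 * (1/2) ^ k)"
        unfolding e1 by (intro add_left_mono ennreal_leI) simp
      from order_trans[OF L(3) this] 1 L(1) show ?thesis by (intro exI[of _ L] conjI)
    qed
    then have "\<exists>L. \<forall>k. elementary T F \<nu> (L k) \<and> (\<integral>\<^sup>+\<omega>. ennreal ((I \<omega> - elem_integral \<nu> \<mu> (L k) \<omega>)\<^sup>2) \<partial>M) \<le> ennreal (1 * (1/2) ^ k) \<and>
      mixed_moment p (uncurried (elem_fun (L k))) \<le> ennreal (4 powr p) * mixed_moment p ?h + ennreal (1 * (1/2) ^ k)"
      by (intro choice allI)
    then obtain L where L': "\<forall>k. elementary T F \<nu> (L k) \<and> (\<integral>\<^sup>+\<omega>. ennreal ((I \<omega> - elem_integral \<nu> \<mu> (L k) \<omega>)\<^sup>2) \<partial>M) \<le> ennreal (1 * (1/2) ^ k) \<and>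
      mixed_moment p (uncurried (elem_fun (L k))) \<le> ennreal (4 powr p) * mixed_moment p ?h + ennreal (1 * (1/2) ^ k)"
      by (rule exE)
    note L = L'[THEN spec, THEN conjunct1] L'[THEN spec, THEN conjunct2, THEN conjunct1] L'[THEN spec, THEN conjunct2, THEN conjunct2]
    define X where "X k = elem_integral \<nu> \<mu> (L k)" for k
    have [measurable]: "X n \<in> borel_measurable M" for n unfolding X_def by (rule elem_integral_measurable[OF L(1)])
    have "AE \<omega> in M. summable (\<lambda>k. (I \<omega> - X k \<omega>)\<^sup>2)"
      by (rule AE_summable_of_nn_integral[where c=1]) (use L(2) in \<open>auto simp: X_def[symmetric]\<close>)
    then have XI: "AE \<omega> in M. (\<lambda>k. X k \<omega>) \<longlonglongrightarrow> I \<omega>"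
    proof eventually_elim
      case (elim \<omega>)
      then have "(\<lambda>k. (I \<omega> - X k \<omega>)\<^sup>2) \<longlonglongrightarrow> 0" by (rule summable_LIMSEQ_zero)
      then have "(\<lambda>k. sqrt ((I \<omega> - X k \<omega>)\<^sup>2)) \<longlonglongrightarrow> sqrt 0" by (rule tendsto_real_sqrt)
      then have "(\<lambda>k. I \<omega> - X k \<omega>) \<longlonglongrightarrow> 0" by (simp add: tendsto_rabs_zero_iff)
      from tendsto_diff[OF tendsto_const[of "I \<omega>"] this] show ?case by simp
    qed
    have "(\<integral>\<^sup>+\<omega>. ennreal (\<bar>I \<omega>\<bar> powr p) \<partial>M) = (\<integral>\<^sup>+\<omega>. liminf (\<lambda>k. ennreal (\<bar>X k \<omega>\<bar> powr p)) \<partial>M)"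
    proof (rule nn_integral_cong_AE)
      show "AE \<omega> in M. ennreal (\<bar>I \<omega>\<bar> powr p) = liminf (\<lambda>k. ennreal (\<bar>X k \<omega>\<bar> powr p))"
        using XI
      proof eventually_elim
        case (elim \<omega>)
        have "(\<lambda>k. ennreal (\<bar>X k \<omega>\<bar> powr p)) \<longlonglongrightarrow> ennreal (\<bar>I \<omega>\<bar> powr p)"
          using p by (intro tendsto_ennrealI tendsto_powr' tendsto_rabs elim tendsto_const) auto
        then show ?case by (intro lim_imp_Liminf[symmetric]) auto
      qed
    qed
    also have "\<dots> \<le> liminf (\<lambda>k. \<integral>\<^sup>+\<omega>. ennreal (\<bar>X k \<omega>\<bar> powr p) \<partial>M)"
      by (intro nn_integral_liminf) measurable
    also have "\<dots> \<le> liminf (\<lambda>k. ennreal C * (ennreal (4 powr p) * mixed_moment p ?h + ennreal (1 * (1/2) ^ k)))"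
    proof (intro Liminf_mono always_eventually allI)
      fix k
      have "(\<integral>\<^sup>+\<omega>. ennreal (\<bar>X k \<omega>\<bar> powr p) \<partial>M) \<le> ennreal C * mixed_moment p (uncurried (elem_fun (L k)))"
        unfolding X_def by (rule Cle[OF L(1)])
      also have "\<dots> \<le> ennreal C * (ennreal (4 powr p) * mixed_moment p ?h + ennreal (1 * (1/2) ^ k))"
        using L(3) by (intro mult_left_mono) auto
      finally show "(\<integral>\<^sup>+\<omega>. ennreal (\<bar>X k \<omega>\<bar> powr p) \<partial>M) \<le> \<dots>" .
    qed
    also have "\<dots> = ennreal C * (ennreal (4 powr p) * mixed_moment p ?h + 0)"
      by (intro lim_imp_Liminf ennreal_tendsto_cmult tendsto_add tendsto_const geometric_tendsto_0) auto
    finally show ?thesis using C by (simp add: ennreal_mult mult.assoc)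
  qed
  then show ?thesis using C by (intro exI[of _ "C * 4 powr p"]) auto
qed

text \<open>Concatenating one approximating sequence with the negative of the other approximates
  both the difference of the integrands and that of the versions. Increments of the stochastic
  convolution thereby become integrals, to which the moment bound applies.\<close>

lemma is_stoch_integral_diff:
  assumes f: "is_stoch_integral M T F \<nu> \<mu> f I" and g: "is_stoch_integral M T F \<nu> \<mu> g J"
  shows "is_stoch_integral M T F \<nu> \<mu> (\<lambda>s z \<omega>. f s z \<omega> - g s z \<omega>) (\<lambda>\<omega>. I \<omega> - J \<omega>)"
proof -
  have L2: "L2_integrand M T F \<nu> f" "L2_integrand M T F \<nu> g" and [measurable]: "I \<in> borel_measurable M" "J \<in> borel_measurable M"
    using f g by (auto simp: is_stoch_integral_def)
  note fP = L2_integrandD[OF L2(1)] and gP = L2_integrandD[OF L2(2)]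
  note fm [measurable] = Pred_measurable[OF fP(1)] and gm [measurable] = Pred_measurable[OF gP(1)]
  let ?d = "\<lambda>s z \<omega>. f s z \<omega> - g s z \<omega>"
  have dP: "uncurried ?d \<in> borel_measurable (Pred \<Otimes>\<^sub>M \<nu>)"
    using fP(1) gP(1) by (simp add: uncurried_def[abs_def])
  note dm = Pred_measurable[OF dP]
  have de: "uncurried ?d x = uncurried f x - uncurried g x" for x by (simp add: uncurried_def)
  have "sqn (uncurried ?d) \<le> 2 * sqn (uncurried f) + 2 * sqn (\<lambda>x. - uncurried g x)"
    using sqn_add[of "uncurried f" "\<lambda>x. - uncurried g x"] by (simp add: de[abs_def])
  also have "\<dots> < \<infinity>" using fP(2) gP(2) by (simp add: sqn_uminus ennreal_mult_less_top)
  finally have fin: "sqn (uncurried ?d) < \<infinity>" .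
  have dL2: "L2_integrand M T F \<nu> ?d"
    unfolding L2_integrand_def
  proof
    show "(\<lambda>((s, \<omega>), z). f s z \<omega> - g s z \<omega>) \<in> borel_measurable (Pred \<Otimes>\<^sub>M \<nu>)"
      using dP by (simp add: uncurried_def[abs_def] split_beta')
    have "sqn (uncurried ?d) = (\<integral>\<^sup>+\<omega>. (\<integral>\<^sup>+s\<in>{0..T}. (\<integral>\<^sup>+z. ennreal ((f s z \<omega> - g s z \<omega>)\<^sup>2) \<partial>\<nu>) \<partial>lborel) \<partial>M)"
      by (rule sqn_uncurried[OF dm])
    then show "(\<integral>\<^sup>+\<omega>. (\<integral>\<^sup>+s\<in>{0..T}. (\<integral>\<^sup>+z. ennreal ((f s z \<omega> - g s z \<omega>)\<^sup>2) \<partial>\<nu>) \<partial>lborel) \<partial>M) < \<infinity>"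
      using fin by simp
  qed
  obtain L where L: "\<forall>n. elementary T F \<nu> (L n)"
    and Lf: "(\<lambda>n. \<integral>\<^sup>+\<omega>. (\<integral>\<^sup>+s\<in>{0..T}. (\<integral>\<^sup>+z. ennreal ((f s z \<omega> - elem_fun (L n) s z \<omega>)\<^sup>2) \<partial>\<nu>) \<partial>lborel) \<partial>M) \<longlonglongrightarrow> 0"
    and LI: "(\<lambda>n. \<integral>\<^sup>+\<omega>. ennreal ((I \<omega> - elem_integral \<nu> \<mu> (L n) \<omega>)\<^sup>2) \<partial>M) \<longlonglongrightarrow> 0"
    using f unfolding is_stoch_integral_def by blast
  obtain L' where L': "\<forall>n. elementary T F \<nu> (L' n)"
    and Lg: "(\<lambda>n. \<integral>\<^sup>+\<omega>. (\<integral>\<^sup>+s\<in>{0..T}. (\<integral>\<^sup>+z. ennreal ((g s z \<omega> - elem_fun (L' n) s z \<omega>)\<^sup>2) \<partial>\<nu>) \<partial>lborel) \<partial>M) \<longlonglongrightarrow> 0"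
    and LJ: "(\<lambda>n. \<integral>\<^sup>+\<omega>. ennreal ((J \<omega> - elem_integral \<nu> \<mu> (L' n) \<omega>)\<^sup>2) \<partial>M) \<longlonglongrightarrow> 0"
    using g unfolding is_stoch_integral_def by blast
  note e = L[rule_format] L'[rule_format]
  note [measurable] = elem_fun_Prod_measurable[OF e(1)] elem_fun_Prod_measurable[OF e(2)]
    elem_integral_measurable[OF e(1)] elem_integral_measurable[OF e(2)]
  define D where "D n = L n @ elem_scale (- 1) (L' n)" for n
  have D: "elementary T F \<nu> (D n)" for n using e by (simp add: D_def elementary_append elementary_scale)
  have lim: "(\<lambda>n. 2 * a n + 2 * b n) \<longlonglongrightarrow> (0::ennreal)" if "a \<longlonglongrightarrow> 0" "b \<longlonglongrightarrow> 0" for a b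
  proof -
    have "(\<lambda>n. 2 * a n + 2 * b n) \<longlonglongrightarrow> (2 * 0 + 2 * 0 :: ennreal)"
      using that by (intro tendsto_add ennreal_tendsto_cmult) auto
    then show ?thesis by simp
  qed
  show ?thesis
    unfolding is_stoch_integral_def
  proof (intro conjI exI[of _ D] allI dL2 D)
    show "(\<lambda>n. \<integral>\<^sup>+\<omega>. (\<integral>\<^sup>+s\<in>{0..T}. (\<integral>\<^sup>+z. ennreal ((f s z \<omega> - g s z \<omega> - elem_fun (D n) s z \<omega>)\<^sup>2) \<partial>\<nu>) \<partial>lborel) \<partial>M) \<longlonglongrightarrow> 0"
      unfolding sqn_diff_eq[OF dm D]
    proof (rule tendsto_sandwich[OF _ _ tendsto_const lim[OF Lf Lg]])
      show "\<forall>\<^sub>F n in sequentially. sqn (\<lambda>x. uncurried ?d x - uncurried (elem_fun (D n)) x) \<le>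
        2 * (\<integral>\<^sup>+\<omega>. (\<integral>\<^sup>+s\<in>{0..T}. (\<integral>\<^sup>+z. ennreal ((f s z \<omega> - elem_fun (L n) s z \<omega>)\<^sup>2) \<partial>\<nu>) \<partial>lborel) \<partial>M) +
        2 * (\<integral>\<^sup>+\<omega>. (\<integral>\<^sup>+s\<in>{0..T}. (\<integral>\<^sup>+z. ennreal ((g s z \<omega> - elem_fun (L' n) s z \<omega>)\<^sup>2) \<partial>\<nu>) \<partial>lborel) \<partial>M)"
        unfolding sqn_diff_eq[OF fm e(1)] sqn_diff_eq[OF gm e(2)]
      proof (intro always_eventually allI)
        fix n
        have "(\<lambda>x. uncurried ?d x - uncurried (elem_fun (D n)) x) =
          (\<lambda>x. (uncurried f x - uncurried (elem_fun (L n)) x) + - (uncurried g x - uncurried (elem_fun (L' n)) x))"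
          by (simp add: fun_eq_iff uncurried_def D_def elem_fun_append elem_fun_scale)
        then show "sqn (\<lambda>x. uncurried ?d x - uncurried (elem_fun (D n)) x) \<le> 2 * sqn (\<lambda>x. uncurried f x - uncurried (elem_fun (L n)) x) +
          2 * sqn (\<lambda>x. uncurried g x - uncurried (elem_fun (L' n)) x)"
          using sqn_add[of "\<lambda>x. uncurried f x - uncurried (elem_fun (L n)) x" "\<lambda>x. - (uncurried g x - uncurried (elem_fun (L' n)) x)"]
            sqn_uminus[of "\<lambda>x. uncurried g x - uncurried (elem_fun (L' n)) x"]
          by simp
      qed
    qed simp
    show "(\<lambda>n. \<integral>\<^sup>+\<omega>. ennreal ((I \<omega> - J \<omega> - elem_integral \<nu> \<mu> (D n) \<omega>)\<^sup>2) \<partial>M) \<longlonglongrightarrow> 0"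
    proof (rule tendsto_sandwich[OF _ _ tendsto_const lim[OF LI LJ]])
      show "\<forall>\<^sub>F n in sequentially. (\<integral>\<^sup>+\<omega>. ennreal ((I \<omega> - J \<omega> - elem_integral \<nu> \<mu> (D n) \<omega>)\<^sup>2) \<partial>M) \<le>
        2 * (\<integral>\<^sup>+\<omega>. ennreal ((I \<omega> - elem_integral \<nu> \<mu> (L n) \<omega>)\<^sup>2) \<partial>M) + 2 * (\<integral>\<^sup>+\<omega>. ennreal ((J \<omega> - elem_integral \<nu> \<mu> (L' n) \<omega>)\<^sup>2) \<partial>M)"
      proof (intro always_eventually allI)
        fix n
        let ?a = "\<lambda>\<omega>. I \<omega> - elem_integral \<nu> \<mu> (L n) \<omega>" and ?b = "\<lambda>\<omega>. J \<omega> - elem_integral \<nu> \<mu> (L' n) \<omega>"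
        have "(\<integral>\<^sup>+\<omega>. ennreal ((I \<omega> - J \<omega> - elem_integral \<nu> \<mu> (D n) \<omega>)\<^sup>2) \<partial>M) \<le> (\<integral>\<^sup>+\<omega>. 2 * ennreal ((?a \<omega>)\<^sup>2) + 2 * ennreal ((?b \<omega>)\<^sup>2) \<partial>M)"
        proof (rule nn_integral_mono)
          fix \<omega>
          have eq: "I \<omega> - J \<omega> - elem_integral \<nu> \<mu> (D n) \<omega> = ?a \<omega> - ?b \<omega>"
            by (simp add: D_def elem_integral_append elem_integral_scale)
          have "(x - y)\<^sup>2 \<le> 2 * x\<^sup>2 + 2 * y\<^sup>2" for x y :: real
            using sum_squares_bound[of x "- y"] by (simp add: power2_diff)
          then have "ennreal ((x - y)\<^sup>2) \<le> 2 * ennreal (x\<^sup>2) + 2 * ennreal (y\<^sup>2)" for x y :: real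
            by (simp add: ennreal_leI flip: ennreal_numeral ennreal_mult ennreal_plus)
          then show "ennreal ((I \<omega> - J \<omega> - elem_integral \<nu> \<mu> (D n) \<omega>)\<^sup>2) \<le> 2 * ennreal ((?a \<omega>)\<^sup>2) + 2 * ennreal ((?b \<omega>)\<^sup>2)"
            unfolding eq .
        qed
        also have "\<dots> = 2 * (\<integral>\<^sup>+\<omega>. ennreal ((?a \<omega>)\<^sup>2) \<partial>M) + 2 * (\<integral>\<^sup>+\<omega>. ennreal ((?b \<omega>)\<^sup>2) \<partial>M)"
          by (simp add: nn_integral_add nn_integral_cmult)
        finally show "(\<integral>\<^sup>+\<omega>. ennreal ((I \<omega> - J \<omega> - elem_integral \<nu> \<mu> (D n) \<omega>)\<^sup>2) \<partial>M) \<le> \<dots>" .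
      qed
    qed simp
  qed measurable
qed

end

section \<open>Kernel estimates\<close>

lemma distr_lborel_reflect: "distr lborel borel (\<lambda>y. x - y) = (lborel :: 'x::euclidean_space measure)"
proof -
  have "lborel = density (distr lborel borel (\<lambda>y::'x. x + (-1) *\<^sub>R y)) (\<lambda>_. 1)"
    using lborel_affine[of "-1" x] by simp
  then show ?thesis by (simp add: density_1)
qed

lemma integral_lborel_reflect:
  fixes F :: "'x::euclidean_space \<Rightarrow> real"
  assumes "F \<in> borel_measurable borel"
  shows "(LINT y|lborel. F (x - y)) = (LINT w|lborel. F w)"
proof -
  have "(LINT w|lborel. F w) = (LINT w|distr lborel borel (\<lambda>y. x - y). F w)"
    by (simp add: distr_lborel_reflect)
  also have "\<dots> = (LINT y|lborel. F (x - y))"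
    using assms by (intro integral_distr) auto
  finally show ?thesis ..
qed

text \<open>Turns a pointwise bound by a kernel weight times a constant into integrability and a
  real bound. Finiteness of the weight's integral is what allows \<open>enn2real\<close> without
  loss.\<close>

lemma weighted_integral_bound:
  fixes \<phi> \<psi> :: "'a \<Rightarrow> real"
  assumes [measurable]: "\<phi> \<in> borel_measurable M" "\<psi> \<in> borel_measurable M"
    and le: "\<And>w. \<bar>\<phi> w\<bar> \<le> \<psi> w * c" and nn: "\<And>w. 0 \<le> \<psi> w" and c: "0 \<le> c"
    and fin: "(\<integral>\<^sup>+w. ennreal (\<psi> w) \<partial>M) < \<infinity>"
  shows "integrable M \<phi>" "\<bar>LINT w|M. \<phi> w\<bar> \<le> enn2real (\<integral>\<^sup>+w. ennreal (\<psi> w) \<partial>M) * c"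
proof -
  have i: "integrable M \<psi>" using fin nn by (intro integrableI_nonneg) auto
  then have i': "integrable M (\<lambda>w. \<psi> w * c)" by simp
  show "integrable M \<phi>" by (rule Bochner_Integration.integrable_bound[OF i']) (use le nn c in \<open>auto simp: abs_mult\<close>)
  then have "(LINT w|M. \<bar>\<phi> w\<bar>) \<le> (LINT w|M. \<psi> w * c)"
    using i' le by (intro integral_mono) auto
  then have "\<bar>LINT w|M. \<phi> w\<bar> \<le> (LINT w|M. \<psi> w * c)"
    using integral_abs_bound[of M \<phi>] by linarith
  also have "\<dots> = (LINT w|M. \<psi> w) * c" by simp
  also have "(LINT w|M. \<psi> w) = enn2real (\<integral>\<^sup>+w. ennreal (\<psi> w) \<partial>M)"
    using nn by (intro integral_eq_nn_integral) auto
  finally show "\<bar>LINT w|M. \<phi> w\<bar> \<le> enn2real (\<integral>\<^sup>+w. ennreal (\<psi> w) \<partial>M) * c" .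
qed

lemma ennreal_enn2real_powr_le: "0 < a \<Longrightarrow> ennreal (enn2real x powr a) \<le> epowr x a"
  by (cases x) (auto simp: epowr_ennreal)

lemma AE_finite_of_epowr_integral:
  fixes k :: "real \<Rightarrow> ennreal"
  assumes [measurable]: "k \<in> borel_measurable borel" and a: "0 < a" and le: "(\<integral>\<^sup>+r\<in>{s..t}. epowr (k r) a \<partial>lborel) \<le> ennreal c"
  shows "AE r in lborel. r \<in> {s..t} \<longrightarrow> k r < \<infinity>"
proof -
  have "(\<integral>\<^sup>+r\<in>{s..t}. epowr (k r) a \<partial>lborel) \<noteq> \<infinity>" using le by (auto simp: top_unique)
  then have "AE r in lborel. epowr (k r) a * indicator {s..t} r \<noteq> \<infinity>"
    by (intro nn_integral_PInf_AE) auto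
  then show ?thesis
  proof eventually_elim
    case (elim r)
    then show ?case by (cases "k r") (auto simp: less_top)
  qed
qed

section \<open>The hypotheses on integrand and kernel, and moments of \<open>g1\<close>\<close>

locale kernel_problem = poisson_basis M T F \<nu> \<mu>
  for M :: "'w measure" and T :: real and F :: "real \<Rightarrow> 'w measure"
    and \<nu> :: "'z measure" and \<mu> :: "'w \<Rightarrow> (real \<times> 'z) measure" +
  fixes g1 :: "'z \<Rightarrow> 'w \<Rightarrow> real"
    and g :: "real \<Rightarrow> 'x::euclidean_space \<Rightarrow> 'z \<Rightarrow> 'w \<Rightarrow> real"
    and K :: "real \<Rightarrow> 'x \<Rightarrow> real"
    and \<beta> p0 p Cg \<gamma>1 \<gamma>2 N0 N1 :: real
  assumes beta: "0 < \<beta>" and p2: "2 \<le> p" and pp0: "p \<le> p0"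
    and g1_measurable: "(\<lambda>(z, \<omega>). g1 z \<omega>) \<in> borel_measurable (\<nu> \<Otimes>\<^sub>M M)"
    and g1_nonneg: "\<forall>z\<in>space \<nu>. \<forall>\<omega>\<in>space M. 0 \<le> g1 z \<omega>"
    and g1_moment: "(\<integral>\<^sup>+\<omega>. epowr (\<integral>\<^sup>+z. ennreal ((g1 z \<omega>)\<^sup>2) \<partial>\<nu>) (p0 / 2)
                + (\<integral>\<^sup>+z. ennreal (g1 z \<omega> powr p0) \<partial>\<nu>) \<partial>M) < \<infinity>"
    and g_measurable: "(\<lambda>((t, \<omega>), x, z). g t x z \<omega>)
           \<in> borel_measurable (predictable_sigma M T F \<Otimes>\<^sub>M (borel \<Otimes>\<^sub>M \<nu>))"
    and g_holder: "AE \<omega> in M. \<forall>z\<in>space \<nu>.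
           (\<forall>t\<in>{0..T}. \<forall>s\<in>{0..T}. \<forall>x y.
              \<bar>g t x z \<omega> - g s y z \<omega>\<bar> \<le> Cg * pdist (t, x) (s, y) powr \<beta> * g1 z \<omega>)
           \<and> g 0 0 z \<omega> = 0"
    and K_measurable: "(\<lambda>(t, x). K t x) \<in> borel_measurable borel"
    and gammas: "0 < \<gamma>1" "0 < \<gamma>2" and Ns: "0 < N0" "0 < N1"
    and K_diff: "\<And>s t. 0 \<le> s \<Longrightarrow> s < t \<Longrightarrow> t \<le> T \<Longrightarrow>
           (\<integral>\<^sup>+r\<in>{0..s}. epowr (\<integral>\<^sup>+z. ennreal (\<bar>K (t - r) z - K (s - r) z\<bar> * (1 + norm z powr \<beta>)) \<partial>lborel) p \<partial>lborel)
             \<le> ennreal (N1 * (t - s) powr (\<gamma>1 * p / 2))"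
    and K_bound: "\<And>s t. 0 \<le> s \<Longrightarrow> s < t \<Longrightarrow> t \<le> T \<Longrightarrow>
           (\<integral>\<^sup>+r\<in>{0..s}. epowr (\<integral>\<^sup>+z. ennreal \<bar>K (s - r) z\<bar> \<partial>lborel) p \<partial>lborel) \<le> ennreal N0"
    and K_weighted: "\<And>s t. 0 \<le> s \<Longrightarrow> s < t \<Longrightarrow> t \<le> T \<Longrightarrow>
           (\<integral>\<^sup>+r\<in>{s..t}. epowr (\<integral>\<^sup>+z. ennreal (\<bar>K (t - r) z\<bar> * (1 + norm z powr \<beta>)) \<partial>lborel) p \<partial>lborel)
             \<le> ennreal (N1 * (t - s) powr (\<gamma>2 * p / 2))"
begin

definition g1_norm :: "real \<Rightarrow> ennreal" where
  "g1_norm q = (\<integral>\<^sup>+\<omega>. epowr (\<integral>\<^sup>+z. ennreal ((g1 z \<omega>)\<^sup>2) \<partial>\<nu>) (q / 2) + (\<integral>\<^sup>+z. ennreal (g1 z \<omega> powr q) \<partial>\<nu>) \<partial>M)"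

lemma g1_swap [measurable]: "(\<lambda>x. g1 (snd x) (fst x)) \<in> borel_measurable (M \<Otimes>\<^sub>M \<nu>)"
  using measurable_compose[OF measurable_pair_swap' g1_measurable] by (simp add: split_beta')

lemma g1_inner_measurable [measurable]:
  "(\<lambda>\<omega>. \<integral>\<^sup>+z. ennreal ((g1 z \<omega>)\<^sup>2) \<partial>\<nu>) \<in> borel_measurable M"
  "(\<lambda>\<omega>. \<integral>\<^sup>+z. ennreal (g1 z \<omega> powr q) \<partial>\<nu>) \<in> borel_measurable M"
  using nu.borel_measurable_nn_integral_fst[of "\<lambda>x. ennreal ((g1 (snd x) (fst x))\<^sup>2)" M]
    nu.borel_measurable_nn_integral_fst[of "\<lambda>x. ennreal (g1 (snd x) (fst x) powr q)" M] by simp_all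

lemma g1_section [measurable]: "\<omega> \<in> space M \<Longrightarrow> (\<lambda>z. g1 z \<omega>) \<in> borel_measurable \<nu>"
  using measurable_compose[OF measurable_Pair1' g1_swap] by simp

text \<open>Intermediate exponents are interpolated: \<open>y powr q\<close> is at most
  \<open>y\<^sup>2 + y powr p0\<close>, and the integral of \<open>g1\<^sup>2\<close> is at most one
  plus its power \<open>p0 / 2\<close>. This is needed for \<open>q = p\<close> in the moment bound
  and for \<open>q = 2\<close> in the existence of the integral.\<close>

lemma g1_norm_finite:
  assumes q: "2 \<le> q" "q \<le> p0" shows "g1_norm q < \<infinity>"
proof -
  let ?a = "\<lambda>\<omega>. \<integral>\<^sup>+z. ennreal ((g1 z \<omega>)\<^sup>2) \<partial>\<nu>" and ?b = "\<lambda>\<omega>. \<integral>\<^sup>+z. ennreal (g1 z \<omega> powr p0) \<partial>\<nu>"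
  have "g1_norm q \<le> (\<integral>\<^sup>+\<omega>. 2 + 2 * (epowr (?a \<omega>) (p0 / 2) + ?b \<omega>) \<partial>M)"
    unfolding g1_norm_def
  proof (rule nn_integral_mono)
    fix \<omega> assume \<omega>: "\<omega> \<in> space M"
    note [measurable] = g1_section[OF \<omega>]
    have 1: "epowr (?a \<omega>) (q / 2) \<le> 1 + epowr (?a \<omega>) (p0 / 2)" using q by (intro epowr_le_add_one) auto
    have 2: "?a \<omega> \<le> 1 + epowr (?a \<omega>) (p0 / 2)" using q epowr_le_add_one[of 1 "p0 / 2" "?a \<omega>"] by simp
    have "(\<integral>\<^sup>+z. ennreal (g1 z \<omega> powr q) \<partial>\<nu>) \<le> (\<integral>\<^sup>+z. ennreal ((g1 z \<omega>)\<^sup>2) + ennreal (g1 z \<omega> powr p0) \<partial>\<nu>)"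
    proof (rule nn_integral_mono)
      fix z assume z: "z \<in> space \<nu>"
      define y where "y = g1 z \<omega>"
      have y: "0 \<le> y" using g1_nonneg z \<omega> by (simp add: y_def)
      have "y powr q \<le> y\<^sup>2 + y powr p0"
      proof (cases "y \<le> 1")
        case True
        have "y powr q \<le> y\<^sup>2"
        proof (cases "y = 0")
          case False
          have "y powr q \<le> y powr 2" using True y q by (intro powr_mono') auto
          then show ?thesis using y False by simp
        qed simp
        then show ?thesis by (simp add: add_increasing2)
      next
        case False
        then have "y powr q \<le> y powr p0" using q by (intro powr_mono) auto
        then show ?thesis by (simp add: add_increasing)
      qed
      then show "ennreal (g1 z \<omega> powr q) \<le> ennreal ((g1 z \<omega>)\<^sup>2) + ennreal (g1 z \<omega> powr p0)"
        by (simp add: y_def[symmetric] ennreal_leI flip: ennreal_plus)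
    qed
    also have "\<dots> = ?a \<omega> + ?b \<omega>" by (simp add: nn_integral_add)
    also have "\<dots> \<le> (1 + epowr (?a \<omega>) (p0 / 2)) + ?b \<omega>" using 2 by (intro add_right_mono)
    finally have "epowr (?a \<omega>) (q / 2) + (\<integral>\<^sup>+z. ennreal (g1 z \<omega> powr q) \<partial>\<nu>) \<le>
      (1 + epowr (?a \<omega>) (p0 / 2)) + ((1 + epowr (?a \<omega>) (p0 / 2)) + ?b \<omega>)" using 1 by (intro add_mono)
    also have "\<dots> = (1 + 1) + (epowr (?a \<omega>) (p0 / 2) + epowr (?a \<omega>) (p0 / 2)) + ?b \<omega>" by (simp only: ac_simps)
    also have "\<dots> \<le> (1 + 1) + (epowr (?a \<omega>) (p0 / 2) + epowr (?a \<omega>) (p0 / 2)) + (?b \<omega> + ?b \<omega>)"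
      by (intro add_left_mono) simp
    also have "\<dots> = 2 + 2 * (epowr (?a \<omega>) (p0 / 2) + ?b \<omega>)"
      by (simp add: mult_2 ac_simps distrib_left)
    finally show "epowr (?a \<omega>) (q / 2) + (\<integral>\<^sup>+z. ennreal (g1 z \<omega> powr q) \<partial>\<nu>) \<le> 2 + 2 * (epowr (?a \<omega>) (p0 / 2) + ?b \<omega>)" .
  qed
  also have "\<dots> = 2 + 2 * g1_norm p0"
    unfolding g1_norm_def by (simp add: nn_integral_add nn_integral_cmult emeasure_space_1)
  also have "\<dots> < \<infinity>" using g1_moment by (simp add: g1_norm_def ennreal_mult_less_top)
  finally show ?thesis .
qed

text \<open>Since \<open>h s\<close> is deterministic, it leaves both inner integrals with the same
  power, because \<open>(h s)\<^sup>2\<close> to the power \<open>q / 2\<close> is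
  \<open>h s powr q\<close>. Hence the mixed moment factors. The exceptional null set of \<omega>
  may vary with \<open>s\<close>, as the order of integration is time outside, chance
  inside.\<close>

lemma mixed_moment_le_weight:
  assumes q: "2 \<le> q" and f [measurable]: "uncurried f \<in> borel_measurable Prod"
    and h: "h \<in> borel_measurable borel" "\<And>s. 0 \<le> h s"
    and le: "AE s in lborel. s \<in> {0..T} \<longrightarrow> (AE \<omega> in M. \<forall>z\<in>space \<nu>. \<bar>f s z \<omega>\<bar> \<le> h s * g1 z \<omega>)"
  shows "mixed_moment q (uncurried f) \<le> (\<integral>\<^sup>+s\<in>{0..T}. ennreal (h s powr q) \<partial>lborel) * g1_norm q"
proof -
  note [measurable] = h(1)
  have "mixed_moment q (uncurried f) = (\<integral>\<^sup>+s\<in>{0..T}. moment M \<nu> q f s \<partial>lborel)"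
    by (rule integral_moment_eq_mixed_moment[OF f, symmetric])
  also have "\<dots> \<le> (\<integral>\<^sup>+s. (ennreal (h s powr q) * indicator {0..T} s) * g1_norm q \<partial>lborel)"
  proof (rule nn_integral_mono_AE)
    show "AE s in lborel. moment M \<nu> q f s * indicator {0..T} s \<le> (ennreal (h s powr q) * indicator {0..T} s) * g1_norm q"
      using le
    proof eventually_elim
      case (elim s)
      show ?case
      proof (cases "s \<in> {0..T}")
        case True
        have "moment M \<nu> q f s \<le> (\<integral>\<^sup>+\<omega>. ennreal (h s powr q) * (epowr (\<integral>\<^sup>+z. ennreal ((g1 z \<omega>)\<^sup>2) \<partial>\<nu>) (q / 2) + (\<integral>\<^sup>+z. ennreal (g1 z \<omega> powr q) \<partial>\<nu>)) \<partial>M)"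
          unfolding moment_def
        proof (rule nn_integral_mono_AE)
          have "AE \<omega> in M. \<forall>z\<in>space \<nu>. \<bar>f s z \<omega>\<bar> \<le> h s * g1 z \<omega>" using elim True by simp
          then show "AE \<omega> in M. epowr (\<integral>\<^sup>+z. ennreal ((f s z \<omega>)\<^sup>2) \<partial>\<nu>) (q / 2) + (\<integral>\<^sup>+z. ennreal (\<bar>f s z \<omega>\<bar> powr q) \<partial>\<nu>)
            \<le> ennreal (h s powr q) * (epowr (\<integral>\<^sup>+z. ennreal ((g1 z \<omega>)\<^sup>2) \<partial>\<nu>) (q / 2) + (\<integral>\<^sup>+z. ennreal (g1 z \<omega> powr q) \<partial>\<nu>))"
            using AE_space
          proof eventually_elim
            case (elim \<omega>)
            note [measurable] = g1_section[OF elim(2)]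
            have "(\<integral>\<^sup>+z. ennreal ((f s z \<omega>)\<^sup>2) \<partial>\<nu>) \<le> (\<integral>\<^sup>+z. ennreal ((h s)\<^sup>2) * ennreal ((g1 z \<omega>)\<^sup>2) \<partial>\<nu>)"
            proof (rule nn_integral_mono)
              fix z assume "z \<in> space \<nu>"
              then have "\<bar>f s z \<omega>\<bar> \<le> \<bar>h s * g1 z \<omega>\<bar>" using elim by (auto intro: order_trans[OF _ abs_ge_self])
              then have "(f s z \<omega>)\<^sup>2 \<le> (h s * g1 z \<omega>)\<^sup>2" by (simp only: abs_le_square_iff)
              then show "ennreal ((f s z \<omega>)\<^sup>2) \<le> ennreal ((h s)\<^sup>2) * ennreal ((g1 z \<omega>)\<^sup>2)"
                by (simp add: power_mult_distrib ennreal_leI flip: ennreal_mult)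
            qed
            also have "\<dots> = ennreal ((h s)\<^sup>2) * (\<integral>\<^sup>+z. ennreal ((g1 z \<omega>)\<^sup>2) \<partial>\<nu>)"
              by (simp add: nn_integral_cmult)
            finally have "epowr (\<integral>\<^sup>+z. ennreal ((f s z \<omega>)\<^sup>2) \<partial>\<nu>) (q / 2) \<le> epowr (ennreal ((h s)\<^sup>2) * (\<integral>\<^sup>+z. ennreal ((g1 z \<omega>)\<^sup>2) \<partial>\<nu>)) (q / 2)"
              using q by (intro epowr_mono) auto
            also have "\<dots> = epowr (ennreal ((h s)\<^sup>2)) (q / 2) * epowr (\<integral>\<^sup>+z. ennreal ((g1 z \<omega>)\<^sup>2) \<partial>\<nu>) (q / 2)"
              using q by (intro epowr_mult) auto
            also have "epowr (ennreal ((h s)\<^sup>2)) (q / 2) = ennreal (h s powr q)"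
            proof -
              have "((h s)\<^sup>2) powr (q / 2) = h s powr q"
                using h(2)[of s] powr_powr[of "h s" 2 "q / 2"] by (cases "h s = 0") auto
              then show ?thesis by (simp add: epowr_ennreal)
            qed
            finally have 1: "epowr (\<integral>\<^sup>+z. ennreal ((f s z \<omega>)\<^sup>2) \<partial>\<nu>) (q / 2) \<le> ennreal (h s powr q) * epowr (\<integral>\<^sup>+z. ennreal ((g1 z \<omega>)\<^sup>2) \<partial>\<nu>) (q / 2)" .
            have "(\<integral>\<^sup>+z. ennreal (\<bar>f s z \<omega>\<bar> powr q) \<partial>\<nu>) \<le> (\<integral>\<^sup>+z. ennreal (h s powr q) * ennreal (g1 z \<omega> powr q) \<partial>\<nu>)"
            proof (rule nn_integral_mono)
              fix z assume z: "z \<in> space \<nu>"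
              then have "\<bar>f s z \<omega>\<bar> powr q \<le> (h s * g1 z \<omega>) powr q" using elim q by (intro powr_mono2) auto
              also have "\<dots> = h s powr q * g1 z \<omega> powr q" using h(2) g1_nonneg z elim by (simp add: powr_mult)
              finally show "ennreal (\<bar>f s z \<omega>\<bar> powr q) \<le> ennreal (h s powr q) * ennreal (g1 z \<omega> powr q)"
                by (simp add: ennreal_leI flip: ennreal_mult)
            qed
            also have "\<dots> = ennreal (h s powr q) * (\<integral>\<^sup>+z. ennreal (g1 z \<omega> powr q) \<partial>\<nu>)"
              by (simp add: nn_integral_cmult)
            finally show ?case using 1 by (simp add: distrib_left add_mono)
          qed
        qed
        also have "\<dots> = ennreal (h s powr q) * g1_norm q"
          unfolding g1_norm_def by (simp add: nn_integral_cmult)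
        finally show ?thesis using True by simp
      qed simp
    qed
  qed
  also have "\<dots> = (\<integral>\<^sup>+s\<in>{0..T}. ennreal (h s powr q) \<partial>lborel) * g1_norm q"
    by (rule nn_integral_multc) measurable
  finally show ?thesis .
qed

section \<open>Kernel masses and pointwise bounds for the convolution\<close>

definition \<kappa> :: "real \<Rightarrow> real \<Rightarrow> ennreal" where
  "\<kappa> t r = (\<integral>\<^sup>+w. ennreal (\<bar>K (t - r) w\<bar> * (1 + norm w powr \<beta>)) \<partial>lborel)"

definition \<kappa>d :: "real \<Rightarrow> real \<Rightarrow> real \<Rightarrow> ennreal" where
  "\<kappa>d s t r = (\<integral>\<^sup>+w. ennreal (\<bar>K (t - r) w - K (s - r) w\<bar> * (1 + norm w powr \<beta>)) \<partial>lborel)"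

definition \<kappa>0 :: "real \<Rightarrow> real \<Rightarrow> ennreal" where
  "\<kappa>0 s r = (\<integral>\<^sup>+w. ennreal \<bar>K (s - r) w\<bar> \<partial>lborel)"

lemma K_compose [measurable]:
  assumes [measurable]: "a \<in> borel_measurable S" "b \<in> borel_measurable S"
  shows "(\<lambda>x. K (a x) (b x)) \<in> borel_measurable S"
proof -
  have "(\<lambda>x. (a x, b x)) \<in> borel_measurable S" by measurable
  from measurable_compose[OF this K_measurable] show ?thesis by simp
qed

lemma kappa_measurable [measurable]:
  "\<kappa> t \<in> borel_measurable borel" "\<kappa>d s t \<in> borel_measurable borel" "\<kappa>0 s \<in> borel_measurable borel"
  unfolding \<kappa>_def[abs_def] \<kappa>d_def[abs_def] \<kappa>0_def[abs_def] by measurable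

lemma \<kappa>0_le: "\<kappa>0 s r \<le> \<kappa> s r"
  unfolding \<kappa>0_def \<kappa>_def by (intro nn_integral_mono ennreal_leI) (simp add: mult_le_cancel_left1)

text \<open>For \<open>|x| <= R\<close> and times in \<open>[0, T]\<close> the parabolic distance of
  \<open>(r, x - w)\<close> from the origin is at most \<open>R + sqrt T + |w|\<close>; the factor
  \<open>2 powr \<beta>\<close> splits the power of this sum. The absolute value of
  \<open>Cg\<close> is taken because no sign is assumed.\<close>

definition growth :: "real \<Rightarrow> real" where
  "growth R = \<bar>Cg\<bar> * (2 powr \<beta> * ((R + sqrt T) powr \<beta> + 1))"

lemma growth_nonneg: "0 \<le> growth R"
  by (simp add: growth_def)

definition nice :: "'w \<Rightarrow> bool" where
  "nice \<omega> \<longleftrightarrow> \<omega> \<in> space M \<and> (\<forall>z\<in>space \<nu>.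
           (\<forall>t\<in>{0..T}. \<forall>s\<in>{0..T}. \<forall>x y.
              \<bar>g t x z \<omega> - g s y z \<omega>\<bar> \<le> \<bar>Cg\<bar> * pdist (t, x) (s, y) powr \<beta> * g1 z \<omega>)
           \<and> g 0 0 z \<omega> = 0)"

lemma AE_nice: "AE \<omega> in M. nice \<omega>"
  using g_holder AE_space
proof eventually_elim
  case (elim \<omega>)
  have "Cg * pdist X Y powr \<beta> * g1 z \<omega> \<le> \<bar>Cg\<bar> * pdist X Y powr \<beta> * g1 z \<omega>" if "z \<in> space \<nu>" for z and X Y :: "real \<times> 'x"
    using g1_nonneg that elim by (intro mult_right_mono) auto
  then show ?case using elim unfolding nice_def by (meson order_trans)
qed

lemma niceD:
  assumes "nice \<omega>" "z \<in> space \<nu>"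
  shows "t \<in> {0..T} \<Longrightarrow> s \<in> {0..T} \<Longrightarrow> \<bar>g t x z \<omega> - g s y z \<omega>\<bar> \<le> \<bar>Cg\<bar> * pdist (t, x) (s, y) powr \<beta> * g1 z \<omega>"
    "g 0 0 z \<omega> = 0" "0 \<le> g1 z \<omega>" "\<omega> \<in> space M"
  using assms g1_nonneg unfolding nice_def by auto

text \<open>Comparison with the origin, where \<open>g\<close> vanishes, turns Hoelder continuity
  into a growth bound. This is the source of the weight \<open>1 + |w|^\<beta>\<close> in the kernel
  conditions.\<close>

lemma g_growth:
  assumes n: "nice \<omega>" "z \<in> space \<nu>" and r: "r \<in> {0..T}" and R: "norm x \<le> R"
  shows "\<bar>g r (x - w) z \<omega>\<bar> \<le> (1 + norm w powr \<beta>) * (growth R * g1 z \<omega>)"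
proof -
  have "\<bar>g r (x - w) z \<omega>\<bar> \<le> \<bar>Cg\<bar> * pdist (r, x - w) (0, 0) powr \<beta> * g1 z \<omega>"
    using niceD(1)[OF n r, of 0 "x - w" 0] niceD(2)[OF n] T_pos by simp
  also have "\<dots> \<le> \<bar>Cg\<bar> * (2 powr \<beta> * (((R + sqrt T) powr \<beta> + 1) * (1 + norm w powr \<beta>))) * g1 z \<omega>"
  proof (intro mult_right_mono mult_left_mono)
    have sr: "sqrt \<bar>r\<bar> \<le> sqrt T" "0 \<le> sqrt T" using r T_pos by auto
    have R0: "0 \<le> R" using R norm_ge_zero[of x] by linarith
    have "norm (x - w) \<le> R + norm w" using norm_triangle_ineq4[of x w] R by linarith
    then have "pdist (r, x - w) (0, 0) \<le> \<bar>(R + sqrt T) + norm w\<bar>"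
    proof -
      have "max (norm (x - w)) (sqrt \<bar>r\<bar>) \<le> (R + sqrt T) + norm w"
        using sr R0 \<open>norm (x - w) \<le> R + norm w\<close> norm_ge_zero[of w]
        by (intro max.boundedI; linarith)
      from order_trans[OF this abs_ge_self] show ?thesis
        by (simp only: pdist_def fst_conv snd_conv diff_0_right)
    qed
    then have "pdist (r, x - w) (0, 0) powr \<beta> \<le> \<bar>(R + sqrt T) + norm w\<bar> powr \<beta>"
      using beta by (intro powr_mono2) (auto simp: pdist_def le_max_iff_disj)
    also have "\<dots> \<le> 2 powr \<beta> * (\<bar>R + sqrt T\<bar> powr \<beta> + \<bar>norm w\<bar> powr \<beta>)"
      using beta by (intro abs_add_powr_le_two_powr) auto
    also have "\<dots> \<le> 2 powr \<beta> * (((R + sqrt T) powr \<beta> + 1) * (1 + norm w powr \<beta>))"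
      using R0 sr by (intro mult_left_mono) (auto simp: algebra_simps)
    finally show "pdist (r, x - w) (0, 0) powr \<beta> \<le> \<dots>" .
  qed (use niceD(3)[OF n] in auto)
  also have "\<dots> = (1 + norm w powr \<beta>) * (growth R * g1 z \<omega>)" by (simp add: growth_def)
  finally show ?thesis .
qed

lemma g_section:
  assumes "r \<in> {0..T}" "\<omega> \<in> space M" "z \<in> space \<nu>"
  shows "(\<lambda>y. g r y z \<omega>) \<in> borel_measurable borel"
proof -
  have "(r, \<omega>) \<in> space Pred" using assms by (simp add: space_Pred)
  then have "(\<lambda>y. ((r, \<omega>), (y, z))) \<in> measurable borel (Pred \<Otimes>\<^sub>M (borel \<Otimes>\<^sub>M \<nu>))"
    using assms by (intro measurable_Pair measurable_const measurable_ident_sets) auto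
  from measurable_compose[OF this g_measurable] show ?thesis by simp
qed

text \<open>The reflection \<open>w = x - y\<close> moves the space variable from the kernel to
  \<open>g\<close>, where the Hoelder condition acts; the kernel conditions compare \<open>K\<close>
  at different times only.\<close>

lemma kernel_integrand_convolution:
  assumes "r \<in> {0..T}" "\<omega> \<in> space M" "z \<in> space \<nu>"
  shows "kernel_integrand K g (t, x) r z \<omega> = indicator {0..t} r * (LINT w|lborel. K (t - r) w * g r (x - w) z \<omega>)"
proof -
  note [measurable] = g_section[OF assms]
  have "(\<lambda>w. K (t - r) w * g r (x - w) z \<omega>) \<in> borel_measurable borel" by measurable
  from integral_lborel_reflect[OF this, of x] show ?thesis by (simp add: kernel_integrand_def)
qed

lemma convolution_bound:
  assumes n: "nice \<omega>" "z \<in> space \<nu>" and r: "r \<in> {0..T}" and R: "norm x \<le> R" and fin: "\<kappa> t r < \<infinity>"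
  shows "integrable lborel (\<lambda>w. K (t - r) w * g r (x - w) z \<omega>)"
    "\<bar>LINT w|lborel. K (t - r) w * g r (x - w) z \<omega>\<bar> \<le> enn2real (\<kappa> t r) * (growth R * g1 z \<omega>)"
proof -
  note [measurable] = g_section[OF r niceD(4)[OF n] n(2)]
  have le: "\<bar>K (t - r) w * g r (x - w) z \<omega>\<bar> \<le> (\<bar>K (t - r) w\<bar> * (1 + norm w powr \<beta>)) * (growth R * g1 z \<omega>)" for w
    using mult_left_mono[OF g_growth[OF n r R, of w], of "\<bar>K (t - r) w\<bar>"] by (simp add: abs_mult mult.assoc)
  have c: "0 \<le> growth R * g1 z \<omega>" using growth_nonneg niceD(3)[OF n] by simp
  show "integrable lborel (\<lambda>w. K (t - r) w * g r (x - w) z \<omega>)"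
    "\<bar>LINT w|lborel. K (t - r) w * g r (x - w) z \<omega>\<bar> \<le> enn2real (\<kappa> t r) * (growth R * g1 z \<omega>)"
    using le c fin unfolding \<kappa>_def
    by (intro weighted_integral_bound[where \<psi>="\<lambda>w. \<bar>K (t - r) w\<bar> * (1 + norm w powr \<beta>)" and c="growth R * g1 z \<omega>"]; simp)+
qed

text \<open>The time increment falls on the kernel with \<open>g\<close> unchanged, so the growth
  bound applies with the weighted mass of the kernel difference. Combining the two integrals
  requires each of them to exist, hence the separate finiteness of \<open>\<kappa> t r\<close> and
  \<open>\<kappa> s r\<close>.\<close>

lemma convolution_time_diff_bound:
  assumes n: "nice \<omega>" "z \<in> space \<nu>" and r: "r \<in> {0..T}" and R: "norm x \<le> R"
    and fin: "\<kappa> t r < \<infinity>" "\<kappa> s r < \<infinity>" "\<kappa>d s t r < \<infinity>"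
  shows "\<bar>(LINT w|lborel. K (t - r) w * g r (x - w) z \<omega>) - (LINT w|lborel. K (s - r) w * g r (x - w) z \<omega>)\<bar>
    \<le> enn2real (\<kappa>d s t r) * (growth R * g1 z \<omega>)"
proof -
  note [measurable] = g_section[OF r niceD(4)[OF n] n(2)]
  have "(LINT w|lborel. K (t - r) w * g r (x - w) z \<omega>) - (LINT w|lborel. K (s - r) w * g r (x - w) z \<omega>) =
    (LINT w|lborel. (K (t - r) w - K (s - r) w) * g r (x - w) z \<omega>)"
    using convolution_bound(1)[OF n r R fin(1)] convolution_bound(1)[OF n r R fin(2)]
    by (simp add: left_diff_distrib)
  moreover have le: "\<bar>(K (t - r) w - K (s - r) w) * g r (x - w) z \<omega>\<bar> \<le> (\<bar>K (t - r) w - K (s - r) w\<bar> * (1 + norm w powr \<beta>)) * (growth R * g1 z \<omega>)" for w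
    using mult_left_mono[OF g_growth[OF n r R, of w], of "\<bar>K (t - r) w - K (s - r) w\<bar>"] by (simp add: abs_mult mult.assoc)
  have c: "0 \<le> growth R * g1 z \<omega>" using growth_nonneg niceD(3)[OF n] by simp
  have "\<bar>LINT w|lborel. (K (t - r) w - K (s - r) w) * g r (x - w) z \<omega>\<bar> \<le> enn2real (\<kappa>d s t r) * (growth R * g1 z \<omega>)"
    using le c fin unfolding \<kappa>d_def
    by (intro weighted_integral_bound(2)[where \<psi>="\<lambda>w. \<bar>K (t - r) w - K (s - r) w\<bar> * (1 + norm w powr \<beta>)"]; simp)
  ultimately show ?thesis by simp
qed

text \<open>The shift by \<open>w\<close> cancels in \<open>(x - w) - (y - w)\<close> and the times
  agree, so the increment of \<open>g\<close> is bounded uniformly in \<open>w\<close> and the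
  unweighted mass \<open>\<kappa>0\<close> appears.\<close>

lemma convolution_space_diff_bound:
  assumes n: "nice \<omega>" "z \<in> space \<nu>" and r: "r \<in> {0..T}" and fin: "\<kappa> s r < \<infinity>"
  shows "\<bar>(LINT w|lborel. K (s - r) w * g r (x - w) z \<omega>) - (LINT w|lborel. K (s - r) w * g r (y - w) z \<omega>)\<bar>
    \<le> enn2real (\<kappa>0 s r) * (\<bar>Cg\<bar> * norm (x - y) powr \<beta> * g1 z \<omega>)"
proof -
  note [measurable] = g_section[OF r niceD(4)[OF n] n(2)]
  have "(LINT w|lborel. K (s - r) w * g r (x - w) z \<omega>) - (LINT w|lborel. K (s - r) w * g r (y - w) z \<omega>) =
    (LINT w|lborel. K (s - r) w * (g r (x - w) z \<omega> - g r (y - w) z \<omega>))"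
    using convolution_bound(1)[OF n r order_refl fin, of x] convolution_bound(1)[OF n r order_refl fin, of y]
    by (simp add: right_diff_distrib)
  moreover have le: "\<bar>K (s - r) w * (g r (x - w) z \<omega> - g r (y - w) z \<omega>)\<bar> \<le> \<bar>K (s - r) w\<bar> * (\<bar>Cg\<bar> * norm (x - y) powr \<beta> * g1 z \<omega>)" for w
    using niceD(1)[OF n r r, of "x - w" "y - w"] by (simp add: abs_mult pdist_def mult_left_mono)
  have c: "0 \<le> \<bar>Cg\<bar> * norm (x - y) powr \<beta> * g1 z \<omega>" using niceD(3)[OF n] by simp
  have "\<kappa>0 s r < \<infinity>" using fin \<kappa>0_le[of s r] by (rule order_le_less_trans[rotated])
  then have "\<bar>LINT w|lborel. K (s - r) w * (g r (x - w) z \<omega> - g r (y - w) z \<omega>)\<bar> \<le> enn2real (\<kappa>0 s r) * (\<bar>Cg\<bar> * norm (x - y) powr \<beta> * g1 z \<omega>)"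
    using le c unfolding \<kappa>0_def
    by (intro weighted_integral_bound(2)[where \<psi>="\<lambda>w. \<bar>K (s - r) w\<bar>"]; simp)
  ultimately show ?thesis by simp
qed

text \<open>
  Where \<open>\<kappa> t r\<close> is infinite the convolution may fail to be integrable; its Lebesgue integral is then
  \<open>0\<close> and differences of such integrals satisfy no bound. Only a null set of times is affected.
\<close>

lemma AE_kappa_finite:
  assumes "0 < t" "t \<le> T"
  shows "AE r in lborel. r \<in> {0..t} \<longrightarrow> \<kappa> t r < \<infinity>"
  using K_weighted[of 0 t] assms p2 unfolding \<kappa>_def[symmetric]
  by (intro AE_finite_of_epowr_integral[where a=p]) auto

text \<open>The kernel enters the integrand through the time coordinate, which must therefore be
  predictable. Time 0 has its own generators and is treated apart from the left-open
  intervals.\<close>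

lemma fst_Pred_measurable: "fst \<in> borel_measurable Pred"
proof (rule borel_measurableI_le)
  fix a :: real
  have G: "{0} \<times> A \<in> sets Pred" if "A \<in> sets (F 0)" for A
    using sigma_sets.Basic that unfolding sets_Pred by auto
  have H: "{s<..t} \<times> A \<in> sets Pred" if "0 \<le> s" "s < t" "t \<le> T" "A \<in> sets (F s)" for s t A
    using sigma_sets.Basic that unfolding sets_Pred by blast
  have sp: "space M \<in> sets (F 0)" using T_pos space_F[of 0] sets.top[of "F 0"] by simp
  consider "a < 0" | "a = 0" | "0 < a" "a < T" | "T \<le> a" by linarith
  then show "{x \<in> space Pred. fst x \<le> a} \<in> sets Pred"
  proof cases
    case 1
    then have "{x \<in> space Pred. fst x \<le> a} = {}" by (auto simp: space_Pred)
    then show ?thesis by (simp only: sets.empty_sets)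
  next
    case 2
    then have "{x \<in> space Pred. fst x \<le> a} = {0} \<times> space M" using T_pos by (auto simp: space_Pred)
    then show ?thesis using G[OF sp] by (simp only:)
  next
    case 3
    then have "{x \<in> space Pred. fst x \<le> a} = {0} \<times> space M \<union> {0<..a} \<times> space M" by (auto simp: space_Pred)
    moreover have "{0} \<times> space M \<in> sets Pred" "{0<..a} \<times> space M \<in> sets Pred" using G H[of 0 a] sp 3 by auto
    ultimately show ?thesis by (simp only: sets.Un)
  next
    case 4
    then have "{x \<in> space Pred. fst x \<le> a} = space Pred" by (auto simp: space_Pred)
    then show ?thesis by (simp only: sets.top)
  qed
qed

lemma kernel_integrand_measurable:
  "uncurried (kernel_integrand K g X) \<in> borel_measurable (Pred \<Otimes>\<^sub>M \<nu>)"
proof -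
  obtain t x where X: "X = (t, x)" by (cases X)
  note [measurable] = fst_Pred_measurable
  have "(\<lambda>q. (fst (fst q), (snd q, snd (fst q)))) \<in> measurable ((Pred \<Otimes>\<^sub>M \<nu>) \<Otimes>\<^sub>M lborel) (Pred \<Otimes>\<^sub>M (borel \<Otimes>\<^sub>M \<nu>))"
    by measurable
  from measurable_compose[OF this g_measurable]
  have [measurable]: "(\<lambda>q. g (fst (fst (fst q))) (snd q) (snd (fst q)) (snd (fst (fst q)))) \<in> borel_measurable ((Pred \<Otimes>\<^sub>M \<nu>) \<Otimes>\<^sub>M lborel)"
    by (simp add: split_beta')
  have "(\<lambda>(q, y). K (t - fst (fst q)) (x - y) * g (fst (fst q)) y (snd q) (snd (fst q))) \<in> borel_measurable ((Pred \<Otimes>\<^sub>M \<nu>) \<Otimes>\<^sub>M lborel)"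
    unfolding split_beta' by measurable
  then have [measurable]: "(\<lambda>q. LINT y|lborel. K (t - fst (fst q)) (x - y) * g (fst (fst q)) y (snd q) (snd (fst q))) \<in> borel_measurable (Pred \<Otimes>\<^sub>M \<nu>)"
    by (rule lborel.borel_measurable_lebesgue_integral)
  show ?thesis
    unfolding uncurried_def[abs_def] kernel_integrand_def X fst_conv snd_conv by measurable
qed

text \<open>An inequality only, because \<open>enn2real\<close> sends an infinite mass to 0.\<close>

lemma integral_weight_le:
  assumes c: "0 \<le> c" and [measurable]: "k \<in> borel_measurable borel"
  shows "(\<integral>\<^sup>+r\<in>{0..T}. ennreal ((c * (enn2real (k r) * indicator {u..v} r)) powr p) \<partial>lborel) \<le>
    ennreal (c powr p) * (\<integral>\<^sup>+r\<in>{u..v}. epowr (k r) p \<partial>lborel)"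
proof -
  have "(\<integral>\<^sup>+r\<in>{0..T}. ennreal ((c * (enn2real (k r) * indicator {u..v} r)) powr p) \<partial>lborel) \<le>
    (\<integral>\<^sup>+r. ennreal (c powr p) * (epowr (k r) p * indicator {u..v} r) \<partial>lborel)"
  proof (rule nn_integral_mono)
    fix r
    have "ennreal (c powr p) * ennreal (enn2real (k r) powr p) \<le> ennreal (c powr p) * epowr (k r) p"
      using p2 by (intro mult_left_mono ennreal_enn2real_powr_le) auto
    then show "ennreal ((c * (enn2real (k r) * indicator {u..v} r)) powr p) * indicator {0..T} r \<le> ennreal (c powr p) * (epowr (k r) p * indicator {u..v} r)"
      using c by (auto simp: powr_mult ennreal_mult split: split_indicator)
  qed
  also have "\<dots> = ennreal (c powr p) * (\<integral>\<^sup>+r\<in>{u..v}. epowr (k r) p \<partial>lborel)"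
    by (rule nn_integral_cmult) measurable
  finally show ?thesis .
qed

lemma integral_powr_sum_le:
  assumes [measurable]: "h1 \<in> borel_measurable borel" "h2 \<in> borel_measurable borel" and h: "\<And>r. 0 \<le> h1 r" "\<And>r. 0 \<le> h2 r"
  shows "(\<integral>\<^sup>+r\<in>{0..T}. ennreal ((h1 r + h2 r) powr p) \<partial>lborel) \<le>
    ennreal (2 powr p) * ((\<integral>\<^sup>+r\<in>{0..T}. ennreal (h1 r powr p) \<partial>lborel) + (\<integral>\<^sup>+r\<in>{0..T}. ennreal (h2 r powr p) \<partial>lborel))"
proof -
  have "(\<integral>\<^sup>+r\<in>{0..T}. ennreal ((h1 r + h2 r) powr p) \<partial>lborel) \<le>
    (\<integral>\<^sup>+r. ennreal (2 powr p) * (ennreal (h1 r powr p) * indicator {0..T} r + ennreal (h2 r powr p) * indicator {0..T} r) \<partial>lborel)"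
  proof (rule nn_integral_mono)
    fix r
    have "(h1 r + h2 r) powr p \<le> 2 powr p * (h1 r powr p + h2 r powr p)"
      using abs_add_powr_le_two_powr[of p "h1 r" "h2 r"] p2 h by simp
    then show "ennreal ((h1 r + h2 r) powr p) * indicator {0..T} r \<le> ennreal (2 powr p) * (ennreal (h1 r powr p) * indicator {0..T} r + ennreal (h2 r powr p) * indicator {0..T} r)"
      by (auto simp: ennreal_leI simp flip: ennreal_plus ennreal_mult split: split_indicator)
  qed
  also have "\<dots> = ennreal (2 powr p) * ((\<integral>\<^sup>+r\<in>{0..T}. ennreal (h1 r powr p) \<partial>lborel) + (\<integral>\<^sup>+r\<in>{0..T}. ennreal (h2 r powr p) \<partial>lborel))"
    by (simp add: nn_integral_cmult nn_integral_add)
  finally show ?thesis .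
qed

section \<open>Mixed moments of the kernel integrand and of its increments\<close>

definition weight :: "real \<Rightarrow> real \<Rightarrow> real \<Rightarrow> real" where
  "weight R t r = growth R * (enn2real (\<kappa> t r) * indicator {0..t} r)"

lemma weight_measurable [measurable]: "weight R t \<in> borel_measurable borel"
  unfolding weight_def[abs_def] by measurable

lemma weight_nonneg: "0 \<le> weight R t r"
  by (simp add: weight_def growth_nonneg)

lemma kernel_integrand_le_weight:
  assumes t: "0 < t" "t \<le> T" and R: "norm x \<le> R"
  shows "AE r in lborel. r \<in> {0..T} \<longrightarrow> (AE \<omega> in M. \<forall>z\<in>space \<nu>. \<bar>kernel_integrand K g (t, x) r z \<omega>\<bar> \<le> weight R t r * g1 z \<omega>)"
  using AE_kappa_finite[OF t]
proof eventually_elim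
  case (elim r)
  show ?case
  proof (intro impI)
    assume r: "r \<in> {0..T}"
    show "AE \<omega> in M. \<forall>z\<in>space \<nu>. \<bar>kernel_integrand K g (t, x) r z \<omega>\<bar> \<le> weight R t r * g1 z \<omega>"
      using AE_nice
    proof eventually_elim
      case (elim \<omega>)
      show ?case
      proof
        fix z assume z: "z \<in> space \<nu>"
        note k = kernel_integrand_convolution[OF r niceD(4)[OF elim z] z, of t x]
        show "\<bar>kernel_integrand K g (t, x) r z \<omega>\<bar> \<le> weight R t r * g1 z \<omega>"
        proof (cases "r \<in> {0..t}")
          case True
          then have "\<kappa> t r < \<infinity>" using \<open>r \<in> {0..t} \<longrightarrow> \<kappa> t r < \<infinity>\<close> by simp
          from convolution_bound(2)[OF elim z r R this] show ?thesis
            unfolding k weight_def using True by (simp add: mult_ac)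
        qed (simp add: k weight_def)
      qed
    qed
  qed
qed

lemma integral_weight_powr:
  assumes t: "0 < t" "t \<le> T"
  shows "(\<integral>\<^sup>+r\<in>{0..T}. ennreal (weight R t r powr p) \<partial>lborel) \<le> ennreal (growth R powr p * (N1 * T powr (\<gamma>2 * p / 2)))"
proof -
  have "(\<integral>\<^sup>+r\<in>{0..T}. ennreal (weight R t r powr p) \<partial>lborel) \<le> ennreal (growth R powr p) * (\<integral>\<^sup>+r\<in>{0..t}. epowr (\<kappa> t r) p \<partial>lborel)"
    unfolding weight_def by (intro integral_weight_le growth_nonneg kappa_measurable)
  also have "\<dots> \<le> ennreal (growth R powr p) * ennreal (N1 * T powr (\<gamma>2 * p / 2))"
  proof (rule mult_left_mono)
    have "(\<integral>\<^sup>+r\<in>{0..t}. epowr (\<kappa> t r) p \<partial>lborel) \<le> ennreal (N1 * (t - 0) powr (\<gamma>2 * p / 2))"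
      using K_weighted[of 0 t] t unfolding \<kappa>_def by simp
    also have "\<dots> \<le> ennreal (N1 * T powr (\<gamma>2 * p / 2))"
      using t gammas p2 Ns by (intro ennreal_leI mult_left_mono powr_mono2) auto
    finally show "(\<integral>\<^sup>+r\<in>{0..t}. epowr (\<kappa> t r) p \<partial>lborel) \<le> \<dots>" .
  qed simp
  finally show ?thesis using Ns by (simp add: ennreal_mult)
qed

lemma kernel_integrand_mixed_moment_le:
  assumes t: "0 < t" "t \<le> T" and R: "norm x \<le> R"
  shows "mixed_moment p (uncurried (kernel_integrand K g (t, x))) \<le> ennreal (growth R powr p * (N1 * T powr (\<gamma>2 * p / 2))) * g1_norm p"
proof -
  have "mixed_moment p (uncurried (kernel_integrand K g (t, x))) \<le> (\<integral>\<^sup>+r\<in>{0..T}. ennreal (weight R t r powr p) \<partial>lborel) * g1_norm p"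
    by (intro mixed_moment_le_weight p2 Pred_measurable kernel_integrand_measurable weight_measurable weight_nonneg kernel_integrand_le_weight t R)
  also have "\<dots> \<le> ennreal (growth R powr p * (N1 * T powr (\<gamma>2 * p / 2))) * g1_norm p"
    by (intro mult_right_mono integral_weight_powr t) simp
  finally show ?thesis .
qed

text \<open>The kernel conditions are stated for the exponent \<open>p\<close>; square integrability
  follows from \<open>y powr 2 <= 1 + y powr p\<close>, since the time horizon is finite, and from
  the second moment of \<open>g1\<close>.\<close>

lemma kernel_integrand_L2:
  assumes t: "0 < t" "t \<le> T"
  shows "L2_integrand M T F \<nu> (kernel_integrand K g (t, x))"
proof -
  let ?f = "kernel_integrand K g (t, x)"
  have m: "uncurried ?f \<in> borel_measurable Prod" by (intro Pred_measurable kernel_integrand_measurable)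
  have "(\<integral>\<^sup>+r\<in>{0..T}. ennreal (weight (norm x) t r powr 2) \<partial>lborel) \<le>
    (\<integral>\<^sup>+r. indicator {0..T} r + ennreal (weight (norm x) t r powr p) * indicator {0..T} r \<partial>lborel)"
  proof (rule nn_integral_mono)
    fix r
    define y where "y = weight (norm x) t r"
    have "y powr 2 \<le> 1 + y powr p"
      using powr_mult_le_add_powr[OF p2, of 1 "y\<^sup>2"] weight_nonneg[of "norm x" t r] powr_powr[of y 2 "p / 2"]
      by (cases "y = 0") (auto simp: y_def)
    from ennreal_leI[OF this] have "ennreal (y powr 2) \<le> 1 + ennreal (y powr p)" by simp
    then show "ennreal (weight (norm x) t r powr 2) * indicator {0..T} r \<le> indicator {0..T} r + ennreal (weight (norm x) t r powr p) * indicator {0..T} r"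
      unfolding y_def[symmetric] by (auto split: split_indicator)
  qed
  also have "\<dots> = ennreal T + (\<integral>\<^sup>+r\<in>{0..T}. ennreal (weight (norm x) t r powr p) \<partial>lborel)"
    using T_pos by (simp add: nn_integral_add)
  also have "\<dots> < \<infinity>"
    using integral_weight_powr[OF t, of "norm x"] by (auto simp: less_top[symmetric] top_unique)
  finally have fin: "(\<integral>\<^sup>+r\<in>{0..T}. ennreal (weight (norm x) t r powr 2) \<partial>lborel) < \<infinity>" .
  have "mixed_moment 2 (uncurried ?f) \<le> (\<integral>\<^sup>+r\<in>{0..T}. ennreal (weight (norm x) t r powr 2) \<partial>lborel) * g1_norm 2"
    by (intro mixed_moment_le_weight m weight_measurable weight_nonneg kernel_integrand_le_weight t) auto
  also have "\<dots> < \<infinity>"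
    using fin g1_norm_finite[of 2] p2 pp0 by (simp add: ennreal_mult_less_top)
  finally have "2 * sqn (uncurried ?f) < \<infinity>" unfolding mixed_moment_2[OF m] .
  then have "sqn (uncurried ?f) < \<infinity>" by (auto simp: ennreal_mult_less_top)
  then show ?thesis
    unfolding L2_integrand_def uncurried_conv using sqn_uncurried[OF m] kernel_integrand_measurable by simp
qed

text \<open>Up to time \<open>s\<close> both integrands are present and the kernel difference
  counts, which gives \<open>h1\<close> and the exponent \<open>\<gamma>1\<close>; between
  \<open>s\<close> and \<open>t\<close> only the later one is present, which gives \<open>h2\<close>
  and \<open>\<gamma>2\<close>. Both weights are nonzero at most at the common time
  \<open>s\<close>, and the larger sum is harmless there.\<close>

lemma kernel_time_diff_mixed_moment_le:
  assumes st: "0 < s" "s < t" "t \<le> T" and R: "norm x \<le> R"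
  shows "mixed_moment p (uncurried (\<lambda>r z \<omega>. kernel_integrand K g (t, x) r z \<omega> - kernel_integrand K g (s, x) r z \<omega>)) \<le>
    ennreal (2 powr p * (growth R powr p * (N1 * (t - s) powr (\<gamma>1 * p / 2)) + growth R powr p * (N1 * (t - s) powr (\<gamma>2 * p / 2)))) * g1_norm p"
proof -
  let ?f = "\<lambda>r z \<omega>. kernel_integrand K g (t, x) r z \<omega> - kernel_integrand K g (s, x) r z \<omega>"
  define h1 where "h1 r = growth R * (enn2real (\<kappa>d s t r) * indicator {0..s} r)" for r
  define h2 where "h2 r = growth R * (enn2real (\<kappa> t r) * indicator {s..t} r)" for r
  have hm [measurable]: "h1 \<in> borel_measurable borel" "h2 \<in> borel_measurable borel"
    unfolding h1_def[abs_def] h2_def[abs_def] by measurable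
  have h0: "0 \<le> h1 r" "0 \<le> h2 r" for r by (auto simp: h1_def h2_def growth_nonneg)
  have m: "uncurried ?f \<in> borel_measurable Prod"
    using Pred_measurable[OF kernel_integrand_measurable[of "(t, x)"]] Pred_measurable[OF kernel_integrand_measurable[of "(s, x)"]]
    by (simp add: uncurried_def[abs_def])
  have fd: "AE r in lborel. r \<in> {0..s} \<longrightarrow> \<kappa>d s t r < \<infinity>"
    using K_diff[of s t] st p2 unfolding \<kappa>d_def[symmetric]
    by (intro AE_finite_of_epowr_integral[where a=p]) auto
  have tp: "0 < t" "t \<le> T" and sp: "0 < s" "s \<le> T" using st by auto
  have ae: "AE r in lborel. r \<in> {0..T} \<longrightarrow> (AE \<omega> in M. \<forall>z\<in>space \<nu>. \<bar>?f r z \<omega>\<bar> \<le> (h1 r + h2 r) * g1 z \<omega>)"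
    using AE_kappa_finite[OF tp] AE_kappa_finite[OF sp] fd
  proof eventually_elim
    case (elim r)
    note fin = elim
    show ?case
    proof
      assume r: "r \<in> {0..T}"
      show "AE \<omega> in M. \<forall>z\<in>space \<nu>. \<bar>?f r z \<omega>\<bar> \<le> (h1 r + h2 r) * g1 z \<omega>"
        using AE_nice
      proof eventually_elim
        case (elim \<omega>)
        show ?case
        proof
          fix z assume z: "z \<in> space \<nu>"
          note k = kernel_integrand_convolution[OF r niceD(4)[OF elim z] z]
          have g0: "0 \<le> g1 z \<omega>" by (rule niceD(3)[OF elim z])
          consider "r \<le> s" | "s < r" "r \<le> t" | "t < r" by linarith
          then show "\<bar>?f r z \<omega>\<bar> \<le> (h1 r + h2 r) * g1 z \<omega>"
          proof cases
            case 1
            then have "\<bar>?f r z \<omega>\<bar> \<le> enn2real (\<kappa>d s t r) * (growth R * g1 z \<omega>)"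
              unfolding k using convolution_time_diff_bound[OF elim z r R, of t s] fin r st by simp
            also have "\<dots> = h1 r * g1 z \<omega>" using 1 r by (simp add: h1_def)
            also have "\<dots> \<le> (h1 r + h2 r) * g1 z \<omega>" using h0 g0 by (intro mult_right_mono) auto
            finally show ?thesis .
          next
            case 2
            then have "\<bar>?f r z \<omega>\<bar> \<le> enn2real (\<kappa> t r) * (growth R * g1 z \<omega>)"
              unfolding k using convolution_bound(2)[OF elim z r R, of t] fin r st by simp
            also have "\<dots> = h2 r * g1 z \<omega>" using 2 r by (simp add: h2_def)
            also have "\<dots> \<le> (h1 r + h2 r) * g1 z \<omega>" using h0 g0 by (intro mult_right_mono) auto
            finally show ?thesis .
          next
            case 3
            then show ?thesis unfolding k using st h0 g0 by simp
          qed
        qed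
      qed
    qed
  qed
  have "mixed_moment p (uncurried ?f) \<le> (\<integral>\<^sup>+r\<in>{0..T}. ennreal ((h1 r + h2 r) powr p) \<partial>lborel) * g1_norm p"
    using h0 by (intro mixed_moment_le_weight p2 m ae) (auto intro: add_nonneg_nonneg)
  also have "\<dots> \<le> ennreal (2 powr p * (growth R powr p * (N1 * (t - s) powr (\<gamma>1 * p / 2)) + growth R powr p * (N1 * (t - s) powr (\<gamma>2 * p / 2)))) * g1_norm p"
  proof (rule mult_right_mono)
    have "(\<integral>\<^sup>+r\<in>{0..T}. ennreal ((h1 r + h2 r) powr p) \<partial>lborel) \<le>
      ennreal (2 powr p) * ((\<integral>\<^sup>+r\<in>{0..T}. ennreal (h1 r powr p) \<partial>lborel) + (\<integral>\<^sup>+r\<in>{0..T}. ennreal (h2 r powr p) \<partial>lborel))"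
      by (intro integral_powr_sum_le hm h0)
    also have "\<dots> \<le> ennreal (2 powr p) * (ennreal (growth R powr p) * (\<integral>\<^sup>+r\<in>{0..s}. epowr (\<kappa>d s t r) p \<partial>lborel)
      + ennreal (growth R powr p) * (\<integral>\<^sup>+r\<in>{s..t}. epowr (\<kappa> t r) p \<partial>lborel))"
      unfolding h1_def h2_def by (intro mult_left_mono add_mono integral_weight_le growth_nonneg kappa_measurable) auto
    also have "\<dots> \<le> ennreal (2 powr p) * (ennreal (growth R powr p) * ennreal (N1 * (t - s) powr (\<gamma>1 * p / 2))
      + ennreal (growth R powr p) * ennreal (N1 * (t - s) powr (\<gamma>2 * p / 2)))"
      using K_diff[of s t] K_weighted[of s t] st unfolding \<kappa>_def \<kappa>d_def by (intro mult_left_mono add_mono) auto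
    also have "\<dots> = ennreal (2 powr p * (growth R powr p * (N1 * (t - s) powr (\<gamma>1 * p / 2)) + growth R powr p * (N1 * (t - s) powr (\<gamma>2 * p / 2))))"
      using Ns by (simp add: ennreal_mult ennreal_plus)
    finally show "(\<integral>\<^sup>+r\<in>{0..T}. ennreal ((h1 r + h2 r) powr p) \<partial>lborel) \<le> \<dots>" .
  qed simp
  finally show ?thesis .
qed

lemma kernel_space_diff_mixed_moment_le:
  assumes s: "0 < s" "s < T"
  shows "mixed_moment p (uncurried (\<lambda>r z \<omega>. kernel_integrand K g (s, x) r z \<omega> - kernel_integrand K g (s, y) r z \<omega>)) \<le>
    ennreal ((\<bar>Cg\<bar> * norm (x - y) powr \<beta>) powr p * N0) * g1_norm p"
proof -
  let ?f = "\<lambda>r z \<omega>. kernel_integrand K g (s, x) r z \<omega> - kernel_integrand K g (s, y) r z \<omega>"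
  define c where "c = \<bar>Cg\<bar> * norm (x - y) powr \<beta>"
  define h where "h r = c * (enn2real (\<kappa>0 s r) * indicator {0..s} r)" for r
  have c: "0 \<le> c" by (simp add: c_def)
  have hm [measurable]: "h \<in> borel_measurable borel" unfolding h_def[abs_def] by measurable
  have h0: "0 \<le> h r" for r using c by (simp add: h_def)
  have m: "uncurried ?f \<in> borel_measurable Prod"
    using Pred_measurable[OF kernel_integrand_measurable[of "(s, x)"]] Pred_measurable[OF kernel_integrand_measurable[of "(s, y)"]]
    by (simp add: uncurried_def[abs_def])
  have "0 < s" "s \<le> T" using s by auto
  from AE_kappa_finite[OF this]
  have ae: "AE r in lborel. r \<in> {0..T} \<longrightarrow> (AE \<omega> in M. \<forall>z\<in>space \<nu>. \<bar>?f r z \<omega>\<bar> \<le> h r * g1 z \<omega>)"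
  proof eventually_elim
    case (elim r)
    show ?case
    proof
      assume r: "r \<in> {0..T}"
      show "AE \<omega> in M. \<forall>z\<in>space \<nu>. \<bar>?f r z \<omega>\<bar> \<le> h r * g1 z \<omega>"
        using AE_nice
      proof eventually_elim
        case (elim \<omega>)
        show ?case
        proof
          fix z assume z: "z \<in> space \<nu>"
          note k = kernel_integrand_convolution[OF r niceD(4)[OF elim z] z]
          show "\<bar>?f r z \<omega>\<bar> \<le> h r * g1 z \<omega>"
          proof (cases "r \<in> {0..s}")
            case True
            then have "\<kappa> s r < \<infinity>" using \<open>r \<in> {0..s} \<longrightarrow> \<kappa> s r < \<infinity>\<close> by simp
            from convolution_space_diff_bound[OF elim z r this, of x y] show ?thesis
              unfolding k h_def c_def using True by (simp add: mult_ac)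
          qed (simp add: k h_def)
        qed
      qed
    qed
  qed
  have "mixed_moment p (uncurried ?f) \<le> (\<integral>\<^sup>+r\<in>{0..T}. ennreal (h r powr p) \<partial>lborel) * g1_norm p"
    by (intro mixed_moment_le_weight p2 m ae hm h0)
  also have "\<dots> \<le> ennreal (c powr p * N0) * g1_norm p"
  proof (rule mult_right_mono)
    have "(\<integral>\<^sup>+r\<in>{0..T}. ennreal (h r powr p) \<partial>lborel) \<le> ennreal (c powr p) * (\<integral>\<^sup>+r\<in>{0..s}. epowr (\<kappa>0 s r) p \<partial>lborel)"
      unfolding h_def by (intro integral_weight_le c kappa_measurable)
    \<comment> \<open>The condition on the unweighted mass is stated for \<open>s\<close> together
      with some later time; \<open>T\<close> is taken, hence the assumption
      \<open>s < T\<close>.\<close>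
    also have "\<dots> \<le> ennreal (c powr p) * ennreal N0"
      using K_bound[of s T] s unfolding \<kappa>0_def by (intro mult_left_mono) auto
    finally show "(\<integral>\<^sup>+r\<in>{0..T}. ennreal (h r powr p) \<partial>lborel) \<le> ennreal (c powr p * N0)"
      using Ns by (simp add: ennreal_mult)
  qed simp
  finally show ?thesis by (simp add: c_def)
qed

end

section \<open>Hoelder continuity of the stochastic convolution\<close>

context kernel_problem
begin

abbreviation u :: "real \<times> 'x \<Rightarrow> 'w \<Rightarrow> real" where
  "u \<equiv> stoch_conv M T F \<nu> \<mu> K g"

text \<open>Existence of the integral makes the choice operator return a genuine version.\<close>

lemma stoch_conv_is_integral:
  assumes "0 < t" "t \<le> T"
  shows "is_stoch_integral M T F \<nu> \<mu> (kernel_integrand K g (t, x)) (u (t, x))"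
  unfolding stoch_conv_def by (rule someI_ex[OF stoch_integral_exists[OF kernel_integrand_L2[OF assms]]])

lemma u_measurable: "0 < t \<Longrightarrow> t \<le> T \<Longrightarrow> u (t, x) \<in> borel_measurable M"
  using stoch_conv_is_integral by (simp add: is_stoch_integral_def)

text \<open>One constant serves all three estimates. Bounds on values and on time increments use the
  growth of \<open>g\<close> and hold for \<open>|x| <= R\<close>; the spatial increment uses only
  the Hoelder condition and holds for all points.\<close>

lemma moment_estimates:
  "\<exists>A. 0 \<le> A \<and> (\<forall>t x. 0 < t \<longrightarrow> t < T \<longrightarrow> norm x \<le> R \<longrightarrow> (\<integral>\<^sup>+\<omega>. ennreal (\<bar>u (t, x) \<omega>\<bar> powr p) \<partial>M) \<le> ennreal A) \<and>
    (\<forall>s t x. 0 < s \<longrightarrow> s < T \<longrightarrow> 0 < t \<longrightarrow> t < T \<longrightarrow> norm x \<le> R \<longrightarrow>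
      (\<integral>\<^sup>+\<omega>. ennreal (\<bar>u (t, x) \<omega> - u (s, x) \<omega>\<bar> powr p) \<partial>M) \<le> ennreal (A * (\<bar>t - s\<bar> powr (\<gamma>1 * p / 2) + \<bar>t - s\<bar> powr (\<gamma>2 * p / 2)))) \<and>
    (\<forall>s x y. 0 < s \<longrightarrow> s < T \<longrightarrow>
      (\<integral>\<^sup>+\<omega>. ennreal (\<bar>u (s, x) \<omega> - u (s, y) \<omega>\<bar> powr p) \<partial>M) \<le> ennreal (A * norm (x - y) powr (\<beta> * p)))"
proof -
  obtain C where C: "0 \<le> C" and bound: "\<And>f I. is_stoch_integral M T F \<nu> \<mu> f I \<Longrightarrow>
    (\<integral>\<^sup>+\<omega>. ennreal (\<bar>I \<omega>\<bar> powr p) \<partial>M) \<le> ennreal C * mixed_moment p (uncurried f)"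
    using stoch_integral_moment_bound[OF p2] by blast
  obtain G where G: "g1_norm p = ennreal G" "0 \<le> G"
    using g1_norm_finite[OF p2 pp0] by (cases "g1_norm p") auto
  have est: "(\<integral>\<^sup>+\<omega>. ennreal (\<bar>I \<omega>\<bar> powr p) \<partial>M) \<le> ennreal (C * G * a)"
    if "is_stoch_integral M T F \<nu> \<mu> f I" "mixed_moment p (uncurried f) \<le> ennreal a * g1_norm p" "0 \<le> a" for f I a
  proof -
    have "(\<integral>\<^sup>+\<omega>. ennreal (\<bar>I \<omega>\<bar> powr p) \<partial>M) \<le> ennreal C * (ennreal a * g1_norm p)"
      using bound[OF that(1)] mult_left_mono[OF that(2), of "ennreal C"] by (simp add: order_trans)
    also have "\<dots> = ennreal (C * G * a)"
      using C G that(3) by (simp add: mult_ac flip: ennreal_mult)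
    finally show ?thesis .
  qed
  define gr where "gr = growth R powr p"
  define A1 where "A1 = C * G * (gr * (N1 * T powr (\<gamma>2 * p / 2)))"
  define A2 where "A2 = C * G * (2 powr p * gr * N1)"
  define A3 where "A3 = C * G * (\<bar>Cg\<bar> powr p * N0)"
  have A0: "0 \<le> A1" "0 \<le> A2" "0 \<le> A3"
    using C G(2) Ns by (simp_all add: A1_def A2_def A3_def gr_def)
  define A where "A = A1 + A2 + A3"
  show ?thesis
  proof (intro exI[of _ A] conjI allI impI)
    show "0 \<le> A" using A0 by (simp add: A_def)
    fix t and x :: 'x assume t: "0 < t" "t < T" and R: "norm x \<le> R"
    have "(\<integral>\<^sup>+\<omega>. ennreal (\<bar>u (t, x) \<omega>\<bar> powr p) \<partial>M) \<le> ennreal A1"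
      unfolding A1_def gr_def using t R Ns
      by (intro est[OF stoch_conv_is_integral] kernel_integrand_mixed_moment_le) auto
    also have "\<dots> \<le> ennreal A" using A0 by (intro ennreal_leI) (simp add: A_def)
    finally show "(\<integral>\<^sup>+\<omega>. ennreal (\<bar>u (t, x) \<omega>\<bar> powr p) \<partial>M) \<le> ennreal A" .
  next
    fix s t and x :: 'x assume s: "0 < s" "s < T" and t: "0 < t" "t < T" and R: "norm x \<le> R"
    have lt: "(\<integral>\<^sup>+\<omega>. ennreal (\<bar>u (t, x) \<omega> - u (s, x) \<omega>\<bar> powr p) \<partial>M) \<le> ennreal (A * (\<bar>t - s\<bar> powr (\<gamma>1 * p / 2) + \<bar>t - s\<bar> powr (\<gamma>2 * p / 2)))"
      if st: "0 < s" "s < t" "t < T" for s t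
    proof -
      let ?b = "\<bar>t - s\<bar> powr (\<gamma>1 * p / 2) + \<bar>t - s\<bar> powr (\<gamma>2 * p / 2)"
      have eq: "2 powr p * (growth R powr p * (N1 * (t - s) powr (\<gamma>1 * p / 2)) + growth R powr p * (N1 * (t - s) powr (\<gamma>2 * p / 2))) = 2 powr p * gr * N1 * ?b"
        using st by (simp add: gr_def algebra_simps)
      have "is_stoch_integral M T F \<nu> \<mu> (\<lambda>r z \<omega>. kernel_integrand K g (t, x) r z \<omega> - kernel_integrand K g (s, x) r z \<omega>) (\<lambda>\<omega>. u (t, x) \<omega> - u (s, x) \<omega>)"
        using st by (intro is_stoch_integral_diff stoch_conv_is_integral) auto
      moreover have "mixed_moment p (uncurried (\<lambda>r z \<omega>. kernel_integrand K g (t, x) r z \<omega> - kernel_integrand K g (s, x) r z \<omega>)) \<le> ennreal (2 powr p * gr * N1 * ?b) * g1_norm p"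
        using kernel_time_diff_mixed_moment_le[OF st(1,2) _ R] st unfolding eq by simp
      ultimately have "(\<integral>\<^sup>+\<omega>. ennreal (\<bar>u (t, x) \<omega> - u (s, x) \<omega>\<bar> powr p) \<partial>M) \<le> ennreal (C * G * (2 powr p * gr * N1 * ?b))"
        using Ns by (intro est) (auto simp: gr_def)
      also have "\<dots> = ennreal (A2 * ?b)" by (simp add: A2_def mult.assoc)
      also have "\<dots> \<le> ennreal (A * ?b)" using A0 by (intro ennreal_leI mult_right_mono) (auto simp: A_def)
      finally show ?thesis .
    qed
    consider "s < t" | "s = t" | "t < s" by linarith
    then show "(\<integral>\<^sup>+\<omega>. ennreal (\<bar>u (t, x) \<omega> - u (s, x) \<omega>\<bar> powr p) \<partial>M) \<le> ennreal (A * (\<bar>t - s\<bar> powr (\<gamma>1 * p / 2) + \<bar>t - s\<bar> powr (\<gamma>2 * p / 2)))"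
    proof cases
      case 1
      then show ?thesis using lt[of s t] s t by simp
    next
      case 2
      then show ?thesis by simp
    next
      case 3
      then show ?thesis using lt[of t s] s t by (simp add: abs_minus_commute)
    qed
  next
    fix s and x y :: 'x assume s: "0 < s" "s < T"
    have eq: "(\<bar>Cg\<bar> * norm (x - y) powr \<beta>) powr p * N0 = \<bar>Cg\<bar> powr p * N0 * norm (x - y) powr (\<beta> * p)"
      by (simp add: powr_mult powr_powr)
    have "is_stoch_integral M T F \<nu> \<mu> (\<lambda>r z \<omega>. kernel_integrand K g (s, x) r z \<omega> - kernel_integrand K g (s, y) r z \<omega>) (\<lambda>\<omega>. u (s, x) \<omega> - u (s, y) \<omega>)"
      using s by (intro is_stoch_integral_diff stoch_conv_is_integral) auto
    from est[OF this kernel_space_diff_mixed_moment_le[OF s, of x y, unfolded eq]]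
    have "(\<integral>\<^sup>+\<omega>. ennreal (\<bar>u (s, x) \<omega> - u (s, y) \<omega>\<bar> powr p) \<partial>M) \<le> ennreal (C * G * (\<bar>Cg\<bar> powr p * N0 * norm (x - y) powr (\<beta> * p)))"
      using Ns by simp
    also have "\<dots> = ennreal (A3 * norm (x - y) powr (\<beta> * p))" by (simp add: A3_def mult.assoc)
    also have "\<dots> \<le> ennreal (A * norm (x - y) powr (\<beta> * p))" using A0 by (intro ennreal_leI mult_right_mono) (auto simp: A_def)
    finally show "(\<integral>\<^sup>+\<omega>. ennreal (\<bar>u (s, x) \<omega> - u (s, y) \<omega>\<bar> powr p) \<partial>M) \<le> ennreal (A * norm (x - y) powr (\<beta> * p))" .
  qed
qed

lemma Lp_norm_le:
  assumes "(\<integral>\<^sup>+\<omega>. ennreal (\<bar>X \<omega>\<bar> powr p) \<partial>M) \<le> ennreal a" "0 \<le> a"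
  shows "Lp_norm M p X \<le> ennreal (a powr (1 / p))"
proof -
  have "Lp_norm M p X \<le> epowr (ennreal a) (1 / p)"
    unfolding Lp_norm_def using assms p2 by (intro epowr_mono) auto
  then show ?thesis using assms by (simp add: epowr_ennreal)
qed

text \<open>Two points are joined through \<open>(s, x)\<close>, one increment in time and one in
  space. The halved time exponents match the parabolic distance \<open>d\<close>, since
  \<open>sqrt |t - s| <= d\<close>. As \<open>S\<close> is bounded, so is \<open>d\<close>, and
  powers with larger exponents are absorbed into the smallest one.\<close>

lemma stoch_conv_holder:
  assumes S: "S \<subseteq> {0<..<T} \<times> UNIV" "bounded S"
  shows "holder_Lp M p (min \<gamma>1 (min \<gamma>2 \<beta>)) S u"
proof -
  define \<gamma> where "\<gamma> = min \<gamma>1 (min \<gamma>2 \<beta>)"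
  have \<gamma>: "\<gamma> \<le> \<gamma>1" "\<gamma> \<le> \<gamma>2" "\<gamma> \<le> \<beta>" "0 < \<gamma>" using gammas beta by (auto simp: \<gamma>_def)
  obtain R where R: "\<And>X. X \<in> S \<Longrightarrow> norm (snd X) \<le> R"
  proof -
    obtain B where "\<And>X. X \<in> S \<Longrightarrow> norm X \<le> B" using S(2) by (auto simp: bounded_iff)
    then have "norm (snd X) \<le> B" if "X \<in> S" for X using order_trans[OF norm_snd_le[of "snd X" "fst X"]] that by simp
    then show ?thesis by (rule that)
  qed
  have time: "0 < fst X" "fst X < T" if "X \<in> S" for X using S(1) that by auto
  from moment_estimates[of R]
  obtain A where A': "0 \<le> A \<and> (\<forall>t x. 0 < t \<longrightarrow> t < T \<longrightarrow> norm x \<le> R \<longrightarrow> (\<integral>\<^sup>+\<omega>. ennreal (\<bar>u (t, x) \<omega>\<bar> powr p) \<partial>M) \<le> ennreal A) \<and>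
    (\<forall>s t x. 0 < s \<longrightarrow> s < T \<longrightarrow> 0 < t \<longrightarrow> t < T \<longrightarrow> norm x \<le> R \<longrightarrow>
      (\<integral>\<^sup>+\<omega>. ennreal (\<bar>u (t, x) \<omega> - u (s, x) \<omega>\<bar> powr p) \<partial>M) \<le> ennreal (A * (\<bar>t - s\<bar> powr (\<gamma>1 * p / 2) + \<bar>t - s\<bar> powr (\<gamma>2 * p / 2)))) \<and>
    (\<forall>s x y. 0 < s \<longrightarrow> s < T \<longrightarrow>
      (\<integral>\<^sup>+\<omega>. ennreal (\<bar>u (s, x) \<omega> - u (s, y) \<omega>\<bar> powr p) \<partial>M) \<le> ennreal (A * norm (x - y) powr (\<beta> * p)))"
    by (rule exE)
  note A = A'[THEN conjunct1]
  note A1 = A'[THEN conjunct2, THEN conjunct1, rule_format]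
  note A2 = A'[THEN conjunct2, THEN conjunct2, THEN conjunct1, rule_format]
  note A3 = A'[THEN conjunct2, THEN conjunct2, THEN conjunct2, rule_format]
  \<comment> \<open>\<open>2 * R\<close> and \<open>sqrt T\<close> bound the two parts of the
    distance; the lower bound 1 makes powers of \<open>B\<close> increase with the exponent. In
    \<open>E\<close> the exponent is the sum of all three, which exceeds every
    \<open>c - \<gamma>\<close> that occurs.\<close>
  define B where "B = max 1 (max (2 * R) (sqrt T))"
  define E where "E = B powr ((\<gamma>1 + \<gamma>2 + \<beta>) * p)"
  have B: "1 \<le> B" by (simp add: B_def)
  have pw: "a powr (c * p) \<le> E * d powr (\<gamma> * p)" if a: "0 \<le> a" "a \<le> d" and d: "0 < d" "d \<le> B" and c: "\<gamma> \<le> c" "c \<le> \<gamma>1 + \<gamma>2 + \<beta>" for a c d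
  proof -
    have "a powr (c * p) \<le> d powr (c * p)" using a c \<gamma> p2 by (intro powr_mono2) auto
    also have "\<dots> = d powr ((c - \<gamma>) * p) * d powr (\<gamma> * p)"
      by (simp flip: powr_add add: algebra_simps)
    also have "\<dots> \<le> E * d powr (\<gamma> * p)"
    proof (rule mult_right_mono)
      have "d powr ((c - \<gamma>) * p) \<le> B powr ((c - \<gamma>) * p)" using d c p2 by (intro powr_mono2) auto
      also have "\<dots> \<le> E" unfolding E_def using B c \<gamma> p2 by (intro powr_mono mult_right_mono) auto
      finally show "d powr ((c - \<gamma>) * p) \<le> E" .
    qed simp
    finally show ?thesis .
  qed
  have E: "0 \<le> E" by (simp add: E_def)
  \<comment> \<open>\<open>2 powr p\<close> comes from splitting the increment, and the 3 counts two
    terms in time and one in space.\<close>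
  define H where "H = 2 powr p * (A * (3 * E))"
  have H: "0 \<le> H" using A E by (simp add: H_def)
  have bound: "Lp_norm M p (u X) \<le> ennreal (A powr (1 / p))" if X: "X \<in> S" for X
    using A1[of "fst X" "snd X"] time[OF X] R[OF X] A by (intro Lp_norm_le) auto
  have incr: "Lp_norm M p (\<lambda>\<omega>. u X \<omega> - u Y \<omega>) / ennreal (pdist X Y powr \<gamma>) \<le> ennreal (H powr (1 / p))"
    if X: "X \<in> S" and Y: "Y \<in> S" and ne: "X \<noteq> Y" for X Y
  proof -
    obtain t x s y where XY: "X = (t, x)" "Y = (s, y)" by (cases X, cases Y)
    have ts: "0 < t" "t < T" "0 < s" "s < T" using time[OF X] time[OF Y] by (auto simp: XY)
    have xy: "norm x \<le> R" "norm y \<le> R" using R[OF X] R[OF Y] by (auto simp: XY)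
    define d where "d = pdist X Y"
    have d1: "norm (x - y) \<le> d" "sqrt \<bar>t - s\<bar> \<le> d" by (auto simp: d_def pdist_def XY)
    have d0: "0 < d" using ne by (auto simp: d_def pdist_def XY less_max_iff_disj)
    have dB: "d \<le> B"
    proof -
      have "norm (x - y) \<le> 2 * R" using norm_triangle_ineq4[of x y] xy by linarith
      moreover have "sqrt \<bar>t - s\<bar> \<le> sqrt T" using ts by (intro real_sqrt_le_mono) auto
      ultimately have "max (norm (x - y)) (sqrt \<bar>t - s\<bar>) \<le> max (2 * R) (sqrt T)"
        by (intro max.mono)
      then show ?thesis unfolding d_def pdist_def XY B_def fst_conv snd_conv by (rule max.coboundedI2)
    qed
    note [measurable] = u_measurable[OF ts(1) less_imp_le[OF ts(2)]] u_measurable[OF ts(3) less_imp_le[OF ts(4)]]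
    have sq: "\<bar>t - s\<bar> powr (c * p / 2) = sqrt \<bar>t - s\<bar> powr (c * p)" for c
      using powr_powr[of "\<bar>t - s\<bar>" "1 / 2" "c * p"] by (simp add: powr_half_sqrt)
    have "(\<integral>\<^sup>+\<omega>. ennreal (\<bar>u X \<omega> - u Y \<omega>\<bar> powr p) \<partial>M) \<le>
      (\<integral>\<^sup>+\<omega>. ennreal (2 powr p) * (ennreal (\<bar>u (t, x) \<omega> - u (s, x) \<omega>\<bar> powr p) + ennreal (\<bar>u (s, x) \<omega> - u (s, y) \<omega>\<bar> powr p)) \<partial>M)"
    proof (rule nn_integral_mono)
      fix \<omega>
      have "\<bar>u X \<omega> - u Y \<omega>\<bar> powr p \<le> 2 powr p * (\<bar>u (t, x) \<omega> - u (s, x) \<omega>\<bar> powr p + \<bar>u (s, x) \<omega> - u (s, y) \<omega>\<bar> powr p)"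
        using abs_add_powr_le_two_powr[of p "u (t, x) \<omega> - u (s, x) \<omega>" "u (s, x) \<omega> - u (s, y) \<omega>"] p2 by (simp add: XY)
      then show "ennreal (\<bar>u X \<omega> - u Y \<omega>\<bar> powr p) \<le> ennreal (2 powr p) * (ennreal (\<bar>u (t, x) \<omega> - u (s, x) \<omega>\<bar> powr p) + ennreal (\<bar>u (s, x) \<omega> - u (s, y) \<omega>\<bar> powr p))"
        by (simp add: ennreal_leI flip: ennreal_mult ennreal_plus)
    qed
    also have "\<dots> = ennreal (2 powr p) * ((\<integral>\<^sup>+\<omega>. ennreal (\<bar>u (t, x) \<omega> - u (s, x) \<omega>\<bar> powr p) \<partial>M) + (\<integral>\<^sup>+\<omega>. ennreal (\<bar>u (s, x) \<omega> - u (s, y) \<omega>\<bar> powr p) \<partial>M))"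
      by (simp add: nn_integral_cmult nn_integral_add)
    also have "\<dots> \<le> ennreal (2 powr p) * (ennreal (A * (E * d powr (\<gamma> * p) + E * d powr (\<gamma> * p))) + ennreal (A * (E * d powr (\<gamma> * p))))"
    proof (intro mult_left_mono add_mono)
      have "A * (\<bar>t - s\<bar> powr (\<gamma>1 * p / 2) + \<bar>t - s\<bar> powr (\<gamma>2 * p / 2)) \<le> A * (E * d powr (\<gamma> * p) + E * d powr (\<gamma> * p))"
        unfolding sq using A d1 d0 dB \<gamma> gammas beta by (intro mult_left_mono add_mono pw) auto
      then show "(\<integral>\<^sup>+\<omega>. ennreal (\<bar>u (t, x) \<omega> - u (s, x) \<omega>\<bar> powr p) \<partial>M) \<le> ennreal (A * (E * d powr (\<gamma> * p) + E * d powr (\<gamma> * p)))"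
        by (rule order_trans[OF A2[OF ts(3,4) ts(1,2) xy(1)] ennreal_leI])
      have "A * norm (x - y) powr (\<beta> * p) \<le> A * (E * d powr (\<gamma> * p))"
        using A d1 d0 dB \<gamma> gammas beta by (intro mult_left_mono pw) auto
      then show "(\<integral>\<^sup>+\<omega>. ennreal (\<bar>u (s, x) \<omega> - u (s, y) \<omega>\<bar> powr p) \<partial>M) \<le> ennreal (A * (E * d powr (\<gamma> * p)))"
        by (rule order_trans[OF A3[OF ts(3,4)] ennreal_leI])
    qed simp
    also have "\<dots> = ennreal (2 powr p * (A * (E * d powr (\<gamma> * p) + E * d powr (\<gamma> * p)) + A * (E * d powr (\<gamma> * p))))"
      using A E by (simp only: ennreal_plus[symmetric] ennreal_mult[symmetric] mult_nonneg_nonneg add_nonneg_nonneg powr_ge_zero)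
    also have "2 powr p * (A * (E * d powr (\<gamma> * p) + E * d powr (\<gamma> * p)) + A * (E * d powr (\<gamma> * p))) = H * d powr (\<gamma> * p)"
      by (simp add: H_def algebra_simps)
    finally have "Lp_norm M p (\<lambda>\<omega>. u X \<omega> - u Y \<omega>) \<le> ennreal ((H * d powr (\<gamma> * p)) powr (1 / p))"
      using H by (intro Lp_norm_le) auto
    also have "(H * d powr (\<gamma> * p)) powr (1 / p) = H powr (1 / p) * d powr \<gamma>"
      using H p2 by (simp add: powr_mult powr_powr)
    finally have "Lp_norm M p (\<lambda>\<omega>. u X \<omega> - u Y \<omega>) / ennreal (d powr \<gamma>) \<le> ennreal (H powr (1 / p) * d powr \<gamma>) / ennreal (d powr \<gamma>)"
      by (rule divide_right_mono_ennreal)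
    also have "\<dots> = ennreal (H powr (1 / p))"
      using d0 by (subst divide_ennreal) auto
    finally show ?thesis by (simp add: d_def)
  qed
  have "(SUP X\<in>S. Lp_norm M p (u X)) \<le> ennreal (A powr (1 / p))"
    using bound by (intro SUP_least) auto
  moreover have "(SUP (X, Y)\<in>{(X, Y). X \<in> S \<and> Y \<in> S \<and> X \<noteq> Y}.
        Lp_norm M p (\<lambda>\<omega>. u X \<omega> - u Y \<omega>) / ennreal (pdist X Y powr \<gamma>)) \<le> ennreal (H powr (1 / p))"
    using incr by (intro SUP_least) auto
  ultimately have "(SUP X\<in>S. Lp_norm M p (u X)) + (SUP (X, Y)\<in>{(X, Y). X \<in> S \<and> Y \<in> S \<and> X \<noteq> Y}.
        Lp_norm M p (\<lambda>\<omega>. u X \<omega> - u Y \<omega>) / ennreal (pdist X Y powr \<gamma>)) \<le> ennreal (A powr (1 / p)) + ennreal (H powr (1 / p))"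
    by (rule add_mono)
  also have "\<dots> < \<infinity>" by simp
  finally show ?thesis
    unfolding holder_Lp_def \<gamma>_def[symmetric] using time u_measurable
    by (auto simp: less_imp_le)
qed

end

text \<open>The first conjunct certifies that the chosen random variables are versions of the
  stochastic integral at every point of the closure; the Hoelder statement thus concerns the
  integral itself and not a value returned by the choice operator for want of a candidate.\<close>

theorem corollary2p2:
  fixes M :: "'w measure" and F :: "real \<Rightarrow> 'w measure" and T :: real
    and \<nu> :: "'z measure" and \<mu> :: "'w \<Rightarrow> (real \<times> 'z) measure"
    and D :: "(real \<times> (real ^ 'd)) set"
    and g1 :: "'z \<Rightarrow> 'w \<Rightarrow> real"
    and g :: "real \<Rightarrow> real ^ 'd \<Rightarrow> 'z \<Rightarrow> 'w \<Rightarrow> real"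
    and K :: "real \<Rightarrow> real ^ 'd \<Rightarrow> real"
    and \<beta> p0 p Cg \<gamma>1 \<gamma>2 N0 N1 :: real
  assumes "0 < T"
    and "stochastic_basis M T F"
    and "sigma_finite_measure \<nu>"
    and "poisson_random_measure M T F \<nu> \<mu>"
    and "open D" and "connected D" and "D \<noteq> {}" and "bounded D" and "A_type D"
    and "closure D \<subseteq> {0<..<T} \<times> UNIV"
    and "0 < \<beta>" and "\<beta> < 1" and "2 < p0" and "2 \<le> p" and "p \<le> p0"
    and "(\<lambda>(z, \<omega>). g1 z \<omega>) \<in> borel_measurable (\<nu> \<Otimes>\<^sub>M M)"
    and "\<forall>z\<in>space \<nu>. \<forall>\<omega>\<in>space M. 0 \<le> g1 z \<omega>"
    and "(\<integral>\<^sup>+\<omega>. epowr (\<integral>\<^sup>+z. ennreal ((g1 z \<omega>)\<^sup>2) \<partial>\<nu>) (p0 / 2)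
                + (\<integral>\<^sup>+z. ennreal (g1 z \<omega> powr p0) \<partial>\<nu>) \<partial>M) < \<infinity>"
    and "(\<lambda>((t, \<omega>), x, z). g t x z \<omega>)
           \<in> borel_measurable (predictable_sigma M T F \<Otimes>\<^sub>M (borel \<Otimes>\<^sub>M \<nu>))"
    and "AE \<omega> in M. \<forall>z\<in>space \<nu>.
           (\<forall>t\<in>{0..T}. \<forall>s\<in>{0..T}. \<forall>x y.
              \<bar>g t x z \<omega> - g s y z \<omega>\<bar> \<le> Cg * pdist (t, x) (s, y) powr \<beta> * g1 z \<omega>)
           \<and> g 0 0 z \<omega> = 0"
    and "(\<lambda>(t, x). K t x) \<in> borel_measurable borel"
    and "0 < \<gamma>1" and "0 < \<gamma>2" and "0 < N0" and "0 < N1"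
    and "\<And>s t. 0 \<le> s \<Longrightarrow> s < t \<Longrightarrow> t \<le> T \<Longrightarrow>
           (\<integral>\<^sup>+r\<in>{0..s}. epowr (\<integral>\<^sup>+z. ennreal (\<bar>K (t - r) z - K (s - r) z\<bar> * (1 + norm z powr \<beta>)) \<partial>lborel) p \<partial>lborel)
             \<le> ennreal (N1 * (t - s) powr (\<gamma>1 * p / 2))"
    and "\<And>s t. 0 \<le> s \<Longrightarrow> s < t \<Longrightarrow> t \<le> T \<Longrightarrow>
           (\<integral>\<^sup>+r\<in>{0..s}. epowr (\<integral>\<^sup>+z. ennreal \<bar>K (s - r) z\<bar> \<partial>lborel) p \<partial>lborel) \<le> ennreal N0"
    and "\<And>s t. 0 \<le> s \<Longrightarrow> s < t \<Longrightarrow> t \<le> T \<Longrightarrow>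
           (\<integral>\<^sup>+r\<in>{s..t}. epowr (\<integral>\<^sup>+z. ennreal (\<bar>K (t - r) z\<bar> * (1 + norm z powr \<beta>)) \<partial>lborel) p \<partial>lborel)
             \<le> ennreal (N1 * (t - s) powr (\<gamma>2 * p / 2))"
  shows "(\<forall>X\<in>closure D. is_stoch_integral M T F \<nu> \<mu> (kernel_integrand K g X) (stoch_conv M T F \<nu> \<mu> K g X))
    \<and> holder_Lp M p (min \<gamma>1 (min \<gamma>2 \<beta>)) (closure D) (stoch_conv M T F \<nu> \<mu> K g)"
proof -
  interpret kernel_problem M T F \<nu> \<mu> g1 g K \<beta> p0 p Cg \<gamma>1 \<gamma>2 N0 N1
    by (intro kernel_problem.intro poisson_basis.intro kernel_problem_axioms.intro) (fact assms)+
  show ?thesis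
  proof
    show "\<forall>X\<in>closure D. is_stoch_integral M T F \<nu> \<mu> (kernel_integrand K g X) (stoch_conv M T F \<nu> \<mu> K g X)"
    proof
      fix X assume "X \<in> closure D"
      then have "0 < fst X" "fst X \<le> T" using assms(10) by auto
      from stoch_conv_is_integral[OF this, of "snd X"]
      show "is_stoch_integral M T F \<nu> \<mu> (kernel_integrand K g X) (stoch_conv M T F \<nu> \<mu> K g X)" by simp
    qed
    show "holder_Lp M p (min \<gamma>1 (min \<gamma>2 \<beta>)) (closure D) (stoch_conv M T F \<nu> \<mu> K g)"
      using assms(8,10) by (intro stoch_conv_holder) auto
  qed
qed

end
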